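(* Let $G$ be a countable, amenable group, let $\mathcal{A}$ be a finite alphabet, and let $X \subset \mathcal{A}^G$ be any subshift such that $P_X : C(\mathcal{A}^G) \to \mathbb{R}$ is computable from above. Then the function $C(\mathcal{A}^G)\to\mathbb{R}$ sending $\phi$ to its ground state energy $\sup_{\nu \in M_\sigma(X)} \int \phi \, d\nu$ is computable from above.
   Context: $F \Subset G$ means $F$ is a finite subset of $G$. A Følner sequence in $G$ is a sequence $F_1 \subsetneq F_2 \subsetneq \cdots$ of finite subsets with $\bigcup_n F_n = G$ and $\lim_{n} |KF_n \triangle F_n|/|F_n| = 0$ for every $K \Subset G$; a countable group is amenable if it admits a Følner sequence. $\mathcal{A}$ is finite and discrete, $\mathcal{A}^G$ has the product topology, and $(\sigma_g x)(h) = x(hg)$. A subshift is a nonempty closed set $X \subset \mathcal{A}^G$ invariant under all $\sigma_g$. $M_\sigma(X)$ is the set of $\sigma$-invariant Borel probability measures on $X$. For $F \Subset G$, $L_F(X) = \{x|_F : x \in X\}$; for $w \in \mathcal{A}^F$, $[w]=\{x : x|_F = w\}$. $C(\mathcal{A}^G)$ is the space of continuous real-valued functions with the uniform norm. For $\phi \in C(\mathcal{A}^G)$, $Z_F(\phi) = \sum_{w \in L_F(X)} \exp\left(\sup_{x \in [w]\cap X} \sum_{g \in F} \phi(\sigma_g x)\right)$ and $P_X(\phi) = \lim_{n} \frac{1}{|F_n|}\log Z_{F_n}(\phi)$ for a Følner sequence $(F_n)$ (the limit exists and is independent of the Følner sequence). Fix an enumeration of the elements of $G$ (used to name finite subsets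 of $G$). A function on $\mathcal{A}^G$ is locally constant if for some $E \Subset G$ its value at $x$ depends only on $x|_E$. Fix a computable enumeration $(s_n)$ of all rational-valued locally constant functions on $\mathcal{A}^G$, each given by a finite set $E \Subset G$ and a finite table $\mathcal{A}^E \to \mathbb{Q}$. An oracle for $\phi \in C(\mathcal{A}^G)$ is a function $\gamma : \mathbb{N} \to \mathbb{N}$ with $\|s_{\gamma(n)} - \phi\|_\infty < 2^{-n}$ for all $n$. A function $f : C(\mathcal{A}^G) \to \mathbb{R}$ is computable from above if there is a Turing machine $T$ such that for every $\phi$ and every oracle $\gamma$ for $\phi$, $(T(\gamma,n))_{n \in \mathbb{N}}$ is a sequence of rationals decreasing to $f(\phi)$. *)

theory Defs
  imports "HOL-Analysis.Analysis" "HOL-Library.Nat_Bijection" "HOL-Library.Countable"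
begin

section \<open>Amenability\<close>

text \<open>Groups are types of class \<^class>\<open>group_add\<close>, which is not assumed commutative: the product
  \<open>gh\<close> is written \<open>g + h\<close>.
  Strict inclusion forces the group to be infinite. The set \<open>K\<close> has to be nonempty, since for
  \<open>K = {}\<close> the quotient is eventually 1.\<close>

definition folner_sequence :: "(nat \<Rightarrow> 'g::group_add set) \<Rightarrow> bool" where
  "folner_sequence F \<longleftrightarrow>
     (\<forall>n. finite (F n) \<and> F n \<subset> F (Suc n)) \<and> (\<Union>n. F n) = UNIV \<and>
     (\<forall>K. finite K \<and> K \<noteq> {} \<longrightarrow>
        (\<lambda>n. real (card (sym_diff {k + f | k f. k \<in> K \<and> f \<in> F n} (F n))) / real (card (F n)))
          \<longlonglongrightarrow> 0)"

section \<open>Subshifts, pressure and ground state energy\<close>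

text \<open>The topology of a function type is the product topology, so for an alphabet \<open>'a\<close> of class
  \<^class>\<open>discrete_topology\<close> the full shift is the space \<open>'g \<Rightarrow> 'a\<close>. When \<open>'a\<close> is also finite, this
  space is compact, and the type of bounded continuous real-valued functions on it is
  the space of all continuous ones with the uniform norm.\<close>

definition shift :: "'g::group_add \<Rightarrow> ('g \<Rightarrow> 'a) \<Rightarrow> ('g \<Rightarrow> 'a)" where
  "shift g x = (\<lambda>h. x (h + g))"

definition subshift :: "('g::group_add \<Rightarrow> 'a::topological_space) set \<Rightarrow> bool" where
  "subshift X \<longleftrightarrow> X \<noteq> {} \<and> closed X \<and> (\<forall>g. shift g ` X \<subseteq> X)"

definition language :: "('g \<Rightarrow> 'a) set \<Rightarrow> 'g set \<Rightarrow> ('g \<Rightarrow> 'a) set" where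
  "language X F = (\<lambda>x. restrict x F) ` X"

definition cylinder :: "'g set \<Rightarrow> ('g \<Rightarrow> 'a) \<Rightarrow> ('g \<Rightarrow> 'a) set" where
  "cylinder F w = {x. restrict x F = w}"

definition partition_function ::
    "('g::group_add \<Rightarrow> 'a::topological_space) set \<Rightarrow> 'g set \<Rightarrow> (('g \<Rightarrow> 'a) \<Rightarrow>\<^sub>C real) \<Rightarrow> real" where
  "partition_function X F \<phi> =
     (\<Sum>w\<in>language X F. exp (SUP x\<in>cylinder F w \<inter> X. \<Sum>g\<in>F. apply_bcontfun \<phi> (shift g x)))"

definition pressure ::
    "('g::group_add \<Rightarrow> 'a::topological_space) set \<Rightarrow> (('g \<Rightarrow> 'a) \<Rightarrow>\<^sub>C real) \<Rightarrow> real" where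
  "pressure X \<phi> = (THE p. \<forall>F. folner_sequence F \<longrightarrow>
     (\<lambda>n. ln (partition_function X (F n) \<phi>) / real (card (F n))) \<longlonglongrightarrow> p)"

definition invariant_measures ::
    "('g::group_add \<Rightarrow> 'a::topological_space) set \<Rightarrow> ('g \<Rightarrow> 'a) measure set" where
  "invariant_measures X =
     {\<nu>. sets \<nu> = sets (restrict_space borel X) \<and> emeasure \<nu> (space \<nu>) = 1 \<and>
         (\<forall>g. distr \<nu> \<nu> (shift g) = \<nu>)}"

definition ground_state_energy ::
    "('g::group_add \<Rightarrow> 'a::topological_space) set \<Rightarrow> (('g \<Rightarrow> 'a) \<Rightarrow>\<^sub>C real) \<Rightarrow> real" where
  "ground_state_energy X \<phi> = (SUP \<nu>\<in>invariant_measures X. \<integral>x. apply_bcontfun \<phi> x \<partial>\<nu>)"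

section \<open>Oracle Turing machines\<close>

text \<open>Deterministic machines with finitely many two-way infinite tapes. States, tape symbols and
  tapes are numbered from 0; symbol 0 is the blank. A tape is its content together with the
  head position. Numbers are written in unary, and the number on a tape is the number of cells
  carrying the symbol 1. Tape 0 holds the input and, on halting, the output; tape 1 is the
  oracle tape: in the query state, the number \<open>m\<close> on it is replaced in one step by \<open>\<gamma> m\<close>.\<close>

datatype move = Left | Stay | Right

record otm =
  tapes :: nat
  symbols :: nat
  states :: nat
  start :: nat
  halt :: nat
  query :: nat
  answer :: nat
  delta :: "nat \<Rightarrow> nat list \<Rightarrow> nat \<times> (nat \<times> move) list"

text \<open>Only the restriction of \<open>delta\<close> to the finitely many states and tuples of symbols of the
  machine is relevant, so a well-formed machine is a finite object.\<close>

definition wf_otm :: "otm \<Rightarrow> bool" where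
  "wf_otm M \<longleftrightarrow>
     2 \<le> tapes M \<and> 2 \<le> symbols M \<and>
     start M < states M \<and> halt M < states M \<and> query M < states M \<and> answer M < states M \<and>
     (\<forall>q < states M. \<forall>rs. length rs = tapes M \<and> set rs \<subseteq> {..<symbols M} \<longrightarrow>
        fst (delta M q rs) < states M \<and>
        length (snd (delta M q rs)) = tapes M \<and>
        fst ` set (snd (delta M q rs)) \<subseteq> {..<symbols M})"

type_synonym tape = "(int \<Rightarrow> nat) \<times> int"

definition unary :: "nat \<Rightarrow> tape" where
  "unary n = ((\<lambda>i. if 0 \<le> i \<and> i < int n then 1 else 0), 0)"

definition tape_number :: "tape \<Rightarrow> nat" where
  "tape_number t = card {i. fst t i = 1}"

definition read_tape :: "tape \<Rightarrow> nat" where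
  "read_tape t = fst t (snd t)"

fun act :: "nat \<times> move \<Rightarrow> tape \<Rightarrow> tape" where
  "act (b, d) (c, i) =
     (c(i := b), (case d of Left \<Rightarrow> i - 1 | Stay \<Rightarrow> i | Right \<Rightarrow> i + 1))"

fun otm_step :: "otm \<Rightarrow> (nat \<Rightarrow> nat) \<Rightarrow> nat \<times> tape list \<Rightarrow> nat \<times> tape list" where
  "otm_step M \<gamma> (q, ts) =
     (if q = halt M then (q, ts)
      else if q = query M then (answer M, ts[1 := unary (\<gamma> (tape_number (ts ! 1)))])
      else let (q', as) = delta M q (map read_tape ts) in (q', map2 act as ts))"

definition otm_init :: "otm \<Rightarrow> nat \<Rightarrow> nat \<times> tape list" where
  "otm_init M n = (start M, unary n # replicate (tapes M - 1) (unary 0))"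

definition otm_outputs :: "otm \<Rightarrow> (nat \<Rightarrow> nat) \<Rightarrow> nat \<Rightarrow> nat \<Rightarrow> bool" where
  "otm_outputs M \<gamma> n m \<longleftrightarrow>
     (\<exists>t ts. (otm_step M \<gamma> ^^ t) (otm_init M n) = (halt M, ts) \<and> tape_number (ts ! 0) = m)"

text \<open>Computability without an oracle: the oracle has no influence on the output.\<close>

definition turing_computable :: "(nat \<Rightarrow> nat) \<Rightarrow> bool" where
  "turing_computable f \<longleftrightarrow> (\<exists>M. wf_otm M \<and> (\<forall>\<gamma> n. otm_outputs M \<gamma> n (f n)))"

section \<open>Locally constant functions given by tables\<close>

text \<open>Relative to an enumeration \<open>e\<close> of the group and a numbering \<open>\<alpha>\<close> of the alphabet, a pair
  \<open>(is, qs)\<close> represents the finite set \<open>E = {e i | i \<in> set is}\<close> together with the table assigning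
  to a pattern on \<open>E\<close> the entry of \<open>qs\<close> whose index is the number with digits
  \<open>\<alpha> (x (e i))\<close>, \<open>i\<close> running through \<open>is\<close>, in base \<open>CARD('a)\<close> (least significant digit first).\<close>

type_synonym lc_table = "nat list \<times> rat list"

fun valid_table :: "'a itself \<Rightarrow> lc_table \<Rightarrow> bool" where
  "valid_table _ (is, qs) \<longleftrightarrow> distinct is \<and> length qs = CARD('a) ^ length is"

fun table_fun :: "(nat \<Rightarrow> 'g) \<Rightarrow> ('a \<Rightarrow> nat) \<Rightarrow> lc_table \<Rightarrow> ('g \<Rightarrow> 'a) \<Rightarrow> rat" where
  "table_fun e \<alpha> (is, qs) x = qs ! horner_sum (\<lambda>i. \<alpha> (x (e i))) CARD('a) is"

definition table_bcontfun ::
    "(nat \<Rightarrow> 'g) \<Rightarrow> ('a \<Rightarrow> nat) \<Rightarrow> lc_table \<Rightarrow> (('g \<Rightarrow> 'a::topological_space) \<Rightarrow>\<^sub>C real)" where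
  "table_bcontfun e \<alpha> s = Bcontfun (\<lambda>x. of_rat (table_fun e \<alpha> s x))"

definition locally_constant :: "(('g \<Rightarrow> 'a) \<Rightarrow> 'b) \<Rightarrow> bool" where
  "locally_constant f \<longleftrightarrow> (\<exists>E. finite E \<and> (\<forall>x y. (\<forall>g\<in>E. x g = y g) \<longrightarrow> f x = f y))"

definition decode_table :: "nat \<Rightarrow> lc_table" where
  "decode_table c =
     (let (a, b) = prod_decode c in (list_decode a, map nat_to_rat_surj (list_decode b)))"

definition computable_lc_enumeration ::
    "(nat \<Rightarrow> 'g) \<Rightarrow> ('a \<Rightarrow> nat) \<Rightarrow> (nat \<Rightarrow> lc_table) \<Rightarrow> bool" where
  "computable_lc_enumeration e \<alpha> s \<longleftrightarrow>
     (\<forall>n. valid_table TYPE('a) (s n)) \<and>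
     (\<exists>c. turing_computable c \<and> (\<forall>n. s n = decode_table (c n))) \<and>
     (\<forall>f :: ('g \<Rightarrow> 'a) \<Rightarrow> rat. locally_constant f \<longrightarrow> (\<exists>n. table_fun e \<alpha> (s n) = f))"

text \<open>\<^const>\<open>table_bcontfun\<close> is meaningful on valid tables.\<close>

lemma horner_sum_less_power:
  fixes b :: nat
  assumes "\<And>i. f i < b"
  shows "horner_sum f b is < b ^ length is"
proof (induction "is")
  case Nil
  show ?case by simp
next
  case (Cons i "is")
  have "f i + b * horner_sum f b is < b + b * horner_sum f b is"
    using assms by simp
  also have "\<dots> = b * Suc (horner_sum f b is)" by simp
  also have "\<dots> \<le> b * b ^ length is"
    using Cons by (intro mult_le_mono) auto
  finally show ?case by simp
qed

lemma apply_table_bcontfun: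
  fixes e :: "nat \<Rightarrow> 'g" and \<alpha> :: "'a::{finite,discrete_topology} \<Rightarrow> nat"
  assumes "bij_betw \<alpha> UNIV {..<CARD('a)}" and "valid_table TYPE('a) s"
  shows "apply_bcontfun (table_bcontfun e \<alpha> s) x = of_rat (table_fun e \<alpha> s x)"
proof -
  obtain "is" qs where s: "s = (is, qs)" by (cases s)
  define h where "h x = horner_sum (\<lambda>i. \<alpha> (x (e i))) CARD('a) is" for x :: "'g \<Rightarrow> 'a"
  have \<alpha>: "\<alpha> y < CARD('a)" for y
    using bij_betwE[OF assms(1)] by auto
  have h_less: "h x < length qs" for x
    using horner_sum_less_power[of "\<lambda>i. \<alpha> (x (e i))" "CARD('a)" "is"] \<alpha> assms(2)
    by (simp add: s h_def)
  have "continuous_on UNIV (\<lambda>x :: 'g \<Rightarrow> 'a. horner_sum (\<lambda>i. \<alpha> (x (e i))) CARD('a) is)"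
  proof (induction "is")
    case (Cons i "is")
    have "continuous_on UNIV (\<lambda>x :: 'g \<Rightarrow> 'a. \<alpha> (x (e i)))"
      by (rule continuous_on_compose2[of UNIV \<alpha>])
        (auto simp: continuous_on_discrete continuous_on_open_vimage open_discrete)
    then show ?case
      using Cons by (auto intro!: continuous_intros)
  qed simp
  then have h: "continuous_on UNIV h"
    by (simp add: h_def)
  have "continuous_on UNIV (\<lambda>x. of_rat (qs ! h x) :: real)"
    by (rule continuous_on_compose2[of UNIV "\<lambda>k. of_rat (qs ! k) :: real", OF _ h])
      (auto simp: continuous_on_open_vimage open_discrete)
  moreover have "bounded (range (\<lambda>x. of_rat (qs ! h x) :: real))"
    by (rule bounded_subset[of "of_rat ` set qs"])
      (auto intro: finite_imp_bounded simp: h_less)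
  ultimately have "(\<lambda>x. of_rat (table_fun e \<alpha> s x) :: real) \<in> bcontfun"
    by (simp add: bcontfun_def s h_def)
  then show ?thesis
    by (simp add: table_bcontfun_def Bcontfun_inverse)
qed

section \<open>Computability from above\<close>

definition is_oracle ::
    "(nat \<Rightarrow> 'g) \<Rightarrow> ('a \<Rightarrow> nat) \<Rightarrow> (nat \<Rightarrow> lc_table) \<Rightarrow>
     (('g \<Rightarrow> 'a::topological_space) \<Rightarrow>\<^sub>C real) \<Rightarrow> (nat \<Rightarrow> nat) \<Rightarrow> bool" where
  "is_oracle e \<alpha> s \<phi> \<gamma> \<longleftrightarrow> (\<forall>n. norm (table_bcontfun e \<alpha> (s (\<gamma> n)) - \<phi>) < (1 / 2) ^ n)"

text \<open>Rational outputs are coded by natural numbers through \<^const>\<open>nat_to_rat_surj\<close>.\<close>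

definition computable_from_above ::
    "(nat \<Rightarrow> 'g) \<Rightarrow> ('a \<Rightarrow> nat) \<Rightarrow> (nat \<Rightarrow> lc_table) \<Rightarrow>
     ((('g \<Rightarrow> 'a::topological_space) \<Rightarrow>\<^sub>C real) \<Rightarrow> real) \<Rightarrow> bool" where
  "computable_from_above e \<alpha> s f \<longleftrightarrow>
     (\<exists>M. wf_otm M \<and>
        (\<forall>\<phi> \<gamma>. is_oracle e \<alpha> s \<phi> \<gamma> \<longrightarrow>
           (\<exists>r. (\<forall>n. otm_outputs M \<gamma> n (r n)) \<and>
                decseq (\<lambda>n. nat_to_rat_surj (r n)) \<and>
                (\<lambda>n. of_rat (nat_to_rat_surj (r n))) \<longlonglongrightarrow> f \<phi>)))"

end

theory Submission
  imports Defs "HOL-Probability.Levy" "HOL-Probability.Probability_Mass_Function"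
begin

text \<open>
  The ground state energy is the zero-temperature limit of the pressure. If \<open>\<nu>\<close> is invariant and \<open>F\<close>
  is finite and nonempty, then \<open>\<integral>\<phi> d\<nu>\<close> is the integral of the Birkhoff average of \<open>\<phi>\<close> over \<open>F\<close>, hence at most
  \<open>ln Z\<^sub>F(\<phi>) / |F|\<close>; so the ground state energy of \<open>\<phi>\<close> is at most \<open>P(c\<phi>)/c\<close> for every \<open>c > 0\<close>. Conversely \<open>Z\<^sub>F(c\<phi>)\<close> has at
  most \<open>|A|\<^sup>|\<^sup>F\<^sup>|\<close> summands, each at most the exponential of \<open>c\<close> times the largest Birkhoff sum. Empirical
  measures of points with the largest Birkhoff sums accumulate at an invariant measure, so
  \<open>P(c\<phi>)/c\<close> exceeds the ground state energy by at most \<open>ln |A| / c\<close>. Thus the energy is the infimum of \<open>P(c\<phi>)/c\<close> over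
  \<open>c = 1, 2, \<dots>\<close>, and a machine that approximates the pressure from above yields
  one for the energy: run it on all multiples of \<open>\<phi>\<close> and keep the running minimum of the quotients.

  Three points of this sketch need work.

  \<^item> The pressure is a limit, and its existence has to be established. The logarithm of the partition function
    satisfies Shearer's inequality: if every point of \<open>F\<close> lies in exactly \<open>k\<close> of the sets \<open>T\<^sub>i\<close>, then
    \<open>ln Z\<^sub>F\<close> is at most \<open>1/k\<close> times the sum of the \<open>ln Z\<close> of the \<open>T\<^sub>i\<close> (\<open>ln_partition_function_cover\<close>). Covering a Folner
    set by the translates of a fixed finite set \<open>K\<close> then shows that the limit is the infimum
    of \<open>ln Z\<^sub>K / |K|\<close> over all \<open>K\<close>, without quasi-tilings (\<open>pressure_limit\<close>).

  \<^item> Compactness of the space of measures is obtained by embedding the shift space into the real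
    line, where Helly's selection theorem provides limits and Levy's theorem separates measures
    (\<open>empirical_measures_accumulate\<close>, \<open>ex_invariant_measure_of_folner\<close>).

  \<^item> The algorithm has to become a Turing machine. A class of oracle functionals on numbers is
    closed under composition, pairing, recursion and unbounded search, and every member is realised by a machine
    (\<open>oracle_computable_otm\<close>). Conversely the given machine is simulated inside this class, even when its queries are answered by
    another computed oracle (\<open>oc_simulate\<close>). The oracle for a multiple of \<open>\<phi>\<close> comes
    from a search for a table with the right values, since equality of two tables
    as functions is decidable (\<open>table_scaled_iff\<close>). The conclusion is drawn in
    \<open>computable_from_above_rescaled_limit\<close>.
\<close>

section \<open>A weighted covering inequality\<close>

text \<open>If no entry vanishes, this is \<open>ln u \<le> u - 1\<close> summed over the entries divided by their mean.\<close>

lemma prod_powr_le_mean: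
  fixes a :: "'i \<Rightarrow> real"
  assumes J: "finite J" "J \<noteq> {}" and a: "\<And>i. i \<in> J \<Longrightarrow> 0 \<le> a i"
  shows "(\<Prod>i\<in>J. a i powr (1 / card J)) \<le> (\<Sum>i\<in>J. a i) / card J"
proof (cases "\<exists>i\<in>J. a i = 0")
  case True
  then have "(\<Prod>i\<in>J. a i powr (1 / card J)) = 0" using J by (intro prod_zero) auto
  also have "0 \<le> (\<Sum>i\<in>J. a i) / card J" using a by (intro divide_nonneg_nonneg sum_nonneg) auto
  finally show ?thesis .
next
  case False
  then have pos: "0 < a i" if "i \<in> J" for i using a[OF that] that by (metis le_less)
  define m where "m = (\<Sum>i\<in>J. a i) / card J"
  have c: "0 < card J" using J by (simp add: card_gt_0_iff)
  have m: "0 < m" unfolding m_def using J c pos by (intro divide_pos_pos sum_pos) auto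
  have "(\<Sum>i\<in>J. ln (a i) - ln m) \<le> (\<Sum>i\<in>J. a i / m - 1)"
  proof (rule sum_mono)
    fix i assume "i \<in> J"
    then show "ln (a i) - ln m \<le> a i / m - 1"
      using ln_le_minus_one[of "a i / m"] pos[OF \<open>i \<in> J\<close>] m by (simp add: ln_div)
  qed
  also have "\<dots> = (\<Sum>i\<in>J. a i) / m - card J"
    by (simp add: sum_subtractf sum_divide_distrib)
  also have "\<dots> = 0" using c m by (simp add: m_def field_simps)
  finally have *: "(\<Sum>i\<in>J. ln (a i)) \<le> card J * ln m" by (simp add: sum_subtractf)
  have "(\<Prod>i\<in>J. a i powr (1 / card J)) = exp ((\<Sum>i\<in>J. ln (a i)) / card J)"
  proof -
    have "a i powr (1 / card J) = exp (ln (a i) / card J)" if "i \<in> J" for i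
      using pos[OF that] by (simp add: powr_def)
    then show ?thesis using J by (simp add: exp_sum sum_divide_distrib)
  qed
  also have "\<dots> \<le> exp (ln m)" using * c by (simp add: field_simps)
  also have "\<dots> = m" using m by simp
  finally show ?thesis by (simp add: m_def)
qed

text \<open>Hoelder's inequality with \<open>card J\<close> equal exponents: once every row \<open>g i\<close> is divided by its sum, the
  inequality of the means can be applied in each column and the column bounds add up to 1.\<close>

lemma sum_prod_powr_le:
  fixes g :: "'i \<Rightarrow> 's \<Rightarrow> real"
  assumes "finite S" "finite J" "J \<noteq> {}" and g: "\<And>i s. 0 \<le> g i s"
  shows "(\<Sum>s\<in>S. \<Prod>i\<in>J. g i s powr (1 / card J)) \<le> (\<Prod>i\<in>J. (\<Sum>s\<in>S. g i s) powr (1 / card J))"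
proof -
  define G where "G i = (\<Sum>s\<in>S. g i s)" for i
  have G0: "0 \<le> G i" for i unfolding G_def using g by (intro sum_nonneg)
  have c: "0 < card J" using assms by (simp add: card_gt_0_iff)
  show ?thesis
  proof (cases "\<exists>i\<in>J. G i = 0")
    case True
    then obtain i where i: "i \<in> J" "G i = 0" by blast
    then have "g i s = 0" if "s \<in> S" for s
      using that assms(1) g unfolding G_def by (simp add: sum_nonneg_eq_0_iff)
    then have "(\<Sum>s\<in>S. \<Prod>j\<in>J. g j s powr (1 / card J)) = 0"
      using i assms by (intro sum.neutral ballI prod_zero) auto
    also have "0 \<le> (\<Prod>j\<in>J. G j powr (1 / card J))" by (intro prod_nonneg) auto
    finally show ?thesis by (simp add: G_def)
  next
    case False
    then have pos: "0 < G i" if "i \<in> J" for i using G0[of i] that by (metis le_less)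
    have "(\<Sum>s\<in>S. \<Prod>i\<in>J. g i s powr (1 / card J)) =
        (\<Sum>s\<in>S. (\<Prod>i\<in>J. (g i s / G i) powr (1 / card J)) * (\<Prod>i\<in>J. G i powr (1 / card J)))"
      using pos g by (intro sum.cong refl) (simp add: prod.distrib[symmetric] powr_mult[symmetric] less_imp_neq[symmetric] cong: prod.cong)
    also have "\<dots> \<le> (\<Sum>s\<in>S. ((\<Sum>i\<in>J. g i s / G i) / card J) * (\<Prod>i\<in>J. G i powr (1 / card J)))"
      by (intro sum_mono mult_right_mono prod_powr_le_mean prod_nonneg assms) (use g G0 in auto)
    also have "\<dots> = ((\<Sum>s\<in>S. \<Sum>i\<in>J. g i s / G i) / card J) * (\<Prod>i\<in>J. G i powr (1 / card J))"
      by (simp add: sum_distrib_right sum_divide_distrib)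
    also have "(\<Sum>s\<in>S. \<Sum>i\<in>J. g i s / G i) = (\<Sum>i\<in>J. G i / G i)"
      by (subst sum.swap) (simp only: sum_divide_distrib[symmetric], simp only: G_def)
    also have "(\<Sum>i\<in>J. G i / G i) = card J"
      using pos by (simp add: less_imp_neq[symmetric] cong: sum.cong)
    finally show ?thesis using c by (simp add: G_def)
  qed
qed

lemma sum_PiE_insert:
  fixes h :: "('g \<Rightarrow> 'a) \<Rightarrow> 'b::comm_monoid_add"
  assumes "x \<notin> S"
  shows "(\<Sum>w\<in>insert x S \<rightarrow>\<^sub>E (UNIV :: 'a set). h w) = (\<Sum>v\<in>S \<rightarrow>\<^sub>E UNIV. \<Sum>a\<in>UNIV. h (v(x := a)))"
proof -
  have "(\<Sum>w\<in>insert x S \<rightarrow>\<^sub>E (UNIV :: 'a set). h w) = (\<Sum>(a, v)\<in>UNIV \<times> (S \<rightarrow>\<^sub>E UNIV). h (v(x := a)))"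
    unfolding PiE_insert_eq
    by (subst sum.reindex[OF inj_combinator[OF assms]]) (simp add: case_prod_unfold)
  also have "\<dots> = (\<Sum>a\<in>UNIV. \<Sum>v\<in>S \<rightarrow>\<^sub>E UNIV. h (v(x := a)))"
    by (rule sum.cartesian_product[symmetric])
  also have "\<dots> = (\<Sum>v\<in>S \<rightarrow>\<^sub>E UNIV. \<Sum>a\<in>UNIV. h (v(x := a)))"
    by (rule sum.swap)
  finally show ?thesis .
qed

text \<open>A weighted form of Shearer's inequality. Summing over the value at one coordinate \<open>x\<close> affects only the
  factors whose domain contains \<open>x\<close>; there are exactly \<open>k\<close> of them, so Hoelder's inequality with exponent
  \<open>k\<close> moves the sum inside the product, and what remains is the same statement without \<open>x\<close>.\<close>

lemma sum_prod_restrict_powr_le: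
  fixes T :: "'i \<Rightarrow> 'g set" and f :: "'i \<Rightarrow> ('g \<Rightarrow> 'a::finite) \<Rightarrow> real"
  assumes "finite F" "finite I" "0 < k"
    and "\<And>i. i \<in> I \<Longrightarrow> T i \<subseteq> F" and "\<And>g. g \<in> F \<Longrightarrow> card {i\<in>I. g \<in> T i} = k"
    and "\<And>i w. 0 \<le> f i w"
  shows "(\<Sum>w\<in>F \<rightarrow>\<^sub>E UNIV. \<Prod>i\<in>I. f i (restrict w (T i)) powr (1 / k)) \<le>
    (\<Prod>i\<in>I. (\<Sum>v\<in>T i \<rightarrow>\<^sub>E UNIV. f i v) powr (1 / k))"
  using assms(1,4-6)
proof (induction F arbitrary: T f rule: finite_induct)
  case empty
  then have "T i = {}" if "i \<in> I" for i using that by blast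
  then show ?case by (simp add: restrict_def cong: prod.cong)
next
  case (insert x F)
  \<comment> \<open>the sets and weights that remain after summation over the coordinate \<open>x\<close>\<close>
  define T' where "T' i = T i - {x}" for i
  define f' where "f' i v = (if x \<in> T i then \<Sum>a\<in>UNIV. f i (v(x := a)) else f i v)" for i v
  define J where "J = {i\<in>I. x \<in> T i}"
  have J: "finite J" "card J = k" "J \<subseteq> I"
    using insert.prems(2)[of x] assms(2) by (auto simp: J_def)
  then have "J \<noteq> {}" using assms(3) by auto
  have f'0: "0 \<le> f' i w" for i w using insert.prems(3) by (auto simp: f'_def intro: sum_nonneg)
  have restr: "restrict (v(x := a)) (T i) = (if x \<in> T i then (restrict v (T' i))(x := a) else restrict v (T' i))" for v a i
    by (auto simp: restrict_def T'_def fun_eq_iff)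
  have inner: "(\<Sum>a\<in>UNIV. \<Prod>i\<in>I. f i (restrict (v(x := a)) (T i)) powr (1 / k)) \<le>
      (\<Prod>i\<in>I. f' i (restrict v (T' i)) powr (1 / k))" for v
  proof -
    let ?g = "\<lambda>i a. f i ((restrict v (T' i))(x := a))"
    let ?c = "\<Prod>i\<in>I - J. f i (restrict v (T' i)) powr (1 / k)"
    have split: "(\<Prod>i\<in>I. h i) = (\<Prod>i\<in>I - J. h i) * (\<Prod>i\<in>J. h i)" for h :: "'i \<Rightarrow> real"
      using prod.subset_diff[OF J(3) assms(2)] .
    have "(\<Sum>a\<in>UNIV. \<Prod>i\<in>I. f i (restrict (v(x := a)) (T i)) powr (1 / k)) =
        (\<Sum>a\<in>UNIV. ?c * (\<Prod>i\<in>J. ?g i a powr (1 / k)))"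
      unfolding split restr by (intro sum.cong arg_cong2[where f = "(*)"] prod.cong) (auto simp: J_def)
    also have "\<dots> = ?c * (\<Sum>a\<in>UNIV. \<Prod>i\<in>J. ?g i a powr (1 / k))" by (simp add: sum_distrib_left)
    also have "\<dots> \<le> ?c * (\<Prod>i\<in>J. (\<Sum>a\<in>UNIV. ?g i a) powr (1 / k))"
      using sum_prod_powr_le[of UNIV J ?g] J \<open>J \<noteq> {}\<close> insert.prems(3) by (intro mult_left_mono prod_nonneg) auto
    also have "\<dots> = (\<Prod>i\<in>I. f' i (restrict v (T' i)) powr (1 / k))"
      unfolding split by (intro arg_cong2[where f = "(*)"] prod.cong) (auto simp: J_def f'_def)
    finally show ?thesis .
  qed
  have total: "(\<Sum>v\<in>T' i \<rightarrow>\<^sub>E UNIV. f' i v) = (\<Sum>v\<in>T i \<rightarrow>\<^sub>E UNIV. f i v)" for i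
  proof (cases "x \<in> T i")
    case True
    then have e: "T i = insert x (T' i)" "x \<notin> T' i" by (auto simp: T'_def)
    show ?thesis unfolding e(1) sum_PiE_insert[OF e(2)] using True by (simp add: f'_def)
  next
    case False
    then have "T' i = T i" by (auto simp: T'_def)
    with False show ?thesis by (simp add: f'_def)
  qed
  have "(\<Sum>w\<in>insert x F \<rightarrow>\<^sub>E UNIV. \<Prod>i\<in>I. f i (restrict w (T i)) powr (1 / k)) =
      (\<Sum>v\<in>F \<rightarrow>\<^sub>E UNIV. \<Sum>a\<in>UNIV. \<Prod>i\<in>I. f i (restrict (v(x := a)) (T i)) powr (1 / k))"
    by (rule sum_PiE_insert[OF insert.hyps(2)])
  also have "\<dots> \<le> (\<Sum>v\<in>F \<rightarrow>\<^sub>E UNIV. \<Prod>i\<in>I. f' i (restrict v (T' i)) powr (1 / k))"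
    by (intro sum_mono inner)
  also have "\<dots> \<le> (\<Prod>i\<in>I. (\<Sum>v\<in>T' i \<rightarrow>\<^sub>E UNIV. f' i v) powr (1 / k))"
  proof (rule insert.IH)
    show "T' i \<subseteq> F" if "i \<in> I" for i using insert.prems(1)[OF that] by (auto simp: T'_def)
    show "card {i\<in>I. g \<in> T' i} = k" if "g \<in> F" for g
    proof -
      have "{i\<in>I. g \<in> T' i} = {i\<in>I. g \<in> T i}" using that insert.hyps by (auto simp: T'_def)
      then show ?thesis using insert.prems(2)[of g] that by simp
    qed
  qed (rule f'0)
  finally show ?case by (simp only: total)
qed

section \<open>Partition functions\<close>

definition birkhoff_sum :: "(('g::group_add \<Rightarrow> 'a::topological_space) \<Rightarrow>\<^sub>C real) \<Rightarrow> 'g set \<Rightarrow> ('g \<Rightarrow> 'a) \<Rightarrow> real" where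
  "birkhoff_sum \<phi> F x = (\<Sum>g\<in>F. apply_bcontfun \<phi> (shift g x))"

definition cylinder_sup where
  "cylinder_sup X \<phi> F w = (SUP x\<in>cylinder F w \<inter> X. birkhoff_sum \<phi> F x)"

lemma partition_function_eq:
  "partition_function X F \<phi> = (\<Sum>w\<in>language X F. exp (cylinder_sup X \<phi> F w))"
  by (simp add: partition_function_def cylinder_sup_def birkhoff_sum_def)

lemma shift_shift: "shift g (shift h x) = shift (g + h) x"
  by (simp add: shift_def add.assoc)

lemma abs_birkhoff_sum: "\<bar>birkhoff_sum \<phi> F x\<bar> \<le> card F * norm \<phi>"
proof -
  have "\<bar>birkhoff_sum \<phi> F x\<bar> \<le> (\<Sum>g\<in>F. norm \<phi>)"
    unfolding birkhoff_sum_def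
    by (rule order_trans[OF sum_abs]) (intro sum_mono, simp add: norm_bounded[where f = \<phi>, simplified real_norm_def])
  then show ?thesis by simp
qed

lemma birkhoff_sum_le: "birkhoff_sum \<phi> F x \<le> card F * norm \<phi>"
  and birkhoff_sum_ge: "- (card F * norm \<phi>) \<le> birkhoff_sum \<phi> F x"
  using abs_birkhoff_sum[of \<phi> F x] by linarith+

lemma bdd_above_birkhoff_sum: "bdd_above (birkhoff_sum \<phi> F ` Y)"
  by (rule bdd_aboveI2[of _ _ "card F * norm \<phi>"]) (rule birkhoff_sum_le)

lemma cylinder_sup_upper:
  "x \<in> X \<Longrightarrow> birkhoff_sum \<phi> F x \<le> cylinder_sup X \<phi> F (restrict x F)"
  unfolding cylinder_sup_def by (rule cSUP_upper[OF _ bdd_above_birkhoff_sum]) (auto simp: cylinder_def)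

lemma cylinder_sup_least:
  assumes "w \<in> language X F" "\<And>x. x \<in> X \<Longrightarrow> restrict x F = w \<Longrightarrow> birkhoff_sum \<phi> F x \<le> c"
  shows "cylinder_sup X \<phi> F w \<le> c"
  unfolding cylinder_sup_def
  by (rule cSUP_least) (use assms in \<open>auto simp: cylinder_def language_def\<close>)

lemma language_subset: "language X F \<subseteq> F \<rightarrow>\<^sub>E UNIV"
  by (auto simp: language_def)

lemma finite_language:
  fixes X :: "('g \<Rightarrow> 'a::finite) set"
  shows "finite F \<Longrightarrow> finite (language X F)"
  by (rule finite_subset[OF language_subset]) (auto intro: finite_PiE)

lemma partition_function_ge:
  fixes X :: "('g::group_add \<Rightarrow> 'a::{finite,topological_space}) set"
  assumes "finite F" "x \<in> X"
  shows "exp (birkhoff_sum \<phi> F x) \<le> partition_function X F \<phi>"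
proof -
  have w: "restrict x F \<in> language X F" unfolding language_def by (rule image_eqI[OF refl assms(2)])
  have "exp (birkhoff_sum \<phi> F x) \<le> exp (cylinder_sup X \<phi> F (restrict x F))"
    using cylinder_sup_upper[OF assms(2)] by simp
  also have "\<dots> \<le> partition_function X F \<phi>"
    unfolding partition_function_eq
    by (rule member_le_sum[OF w]) (simp_all add: finite_language assms(1))
  finally show ?thesis .
qed

lemma partition_function_le:
  fixes X :: "('g::group_add \<Rightarrow> 'a::{finite,topological_space}) set"
  assumes "finite F" "\<And>x. x \<in> X \<Longrightarrow> birkhoff_sum \<phi> F x \<le> c"
  shows "partition_function X F \<phi> \<le> real CARD('a) ^ card F * exp c"
proof -
  have "partition_function X F \<phi> \<le> (\<Sum>w\<in>language X F. exp c)"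
    unfolding partition_function_eq by (intro sum_mono) (auto intro!: cylinder_sup_least assms(2))
  also have "\<dots> = card (language X F) * exp c" by simp
  also have "\<dots> \<le> card (F \<rightarrow>\<^sub>E (UNIV :: 'a set)) * exp c"
    using assms(1) by (intro mult_right_mono of_nat_mono card_mono language_subset finite_PiE) auto
  also have "\<dots> = real CARD('a) ^ card F * exp c" using assms(1) by (simp add: card_funcsetE)
  finally show ?thesis .
qed

context
  fixes X :: "('g::group_add \<Rightarrow> 'a::{finite,topological_space}) set" and \<phi> :: "('g \<Rightarrow> 'a) \<Rightarrow>\<^sub>C real"
  assumes X: "X \<noteq> {}"
begin

lemma partition_function_pos: "finite F \<Longrightarrow> 0 < partition_function X F \<phi>"
  using X partition_function_ge[of F _ X \<phi>] by (meson ex_in_conv exp_gt_zero less_le_trans)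

lemma ln_partition_function_ge: "finite F \<Longrightarrow> x \<in> X \<Longrightarrow> birkhoff_sum \<phi> F x \<le> ln (partition_function X F \<phi>)"
  using partition_function_ge[of F x X \<phi>] partition_function_pos by (simp add: ln_ge_iff)

lemma ln_partition_function_le:
  assumes "finite F" "\<And>x. x \<in> X \<Longrightarrow> birkhoff_sum \<phi> F x \<le> c"
  shows "ln (partition_function X F \<phi>) \<le> card F * ln (real CARD('a)) + c"
proof -
  have "ln (partition_function X F \<phi>) \<le> ln (real CARD('a) ^ card F * exp c)"
    using partition_function_le[OF assms] partition_function_pos[OF assms(1)] by (simp add: card_gt_0_iff)
  then show ?thesis by (simp add: ln_mult ln_realpow card_gt_0_iff)
qed

lemma ln_partition_function_bound:
  assumes "finite F"
  shows "ln (partition_function X F \<phi>) \<le> card F * (ln (real CARD('a)) + norm \<phi>)"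
  using ln_partition_function_le[OF assms birkhoff_sum_le] by (simp add: algebra_simps)

lemma ln_partition_function_bound_below:
  assumes "finite F"
  shows "- (card F * norm \<phi>) \<le> ln (partition_function X F \<phi>)"
  using X ln_partition_function_ge[OF assms] birkhoff_sum_ge[of F \<phi>] by (meson ex_in_conv order_trans)

text \<open>The Birkhoff sum over \<open>F\<close> is \<open>1/k\<close> times the sum of those over the \<open>T i\<close>, so the weight of a pattern on \<open>F\<close>
  is at most the product of the \<open>k\<close>-th roots of the weights of its restrictions, and the covering inequality bounds the sum of
  these products over all patterns. For \<open>k = 1\<close> this is subadditivity; the case of larger \<open>k\<close> makes
  it unnecessary to tile \<open>F\<close> when proving that the pressure exists.\<close>

lemma ln_partition_function_cover:
  assumes F: "finite F" and I: "finite I" and k: "0 < k"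
    and T: "\<And>i. i \<in> I \<Longrightarrow> T i \<subseteq> F" and cover: "\<And>g. g \<in> F \<Longrightarrow> card {i\<in>I. g \<in> T i} = k"
  shows "ln (partition_function X F \<phi>) \<le> (\<Sum>i\<in>I. ln (partition_function X (T i) \<phi>)) / k"
proof -
  define E where "E i v = (if v \<in> language X (T i) then exp (cylinder_sup X \<phi> (T i) v) else 0)" for i v
  have fT: "finite (T i)" if "i \<in> I" for i using T[OF that] F finite_subset by blast
  have total: "(\<Sum>v\<in>T i \<rightarrow>\<^sub>E UNIV. E i v) = partition_function X (T i) \<phi>" if "i \<in> I" for i
    unfolding partition_function_eq
    by (rule sum.mono_neutral_cong_right) (use fT[OF that] language_subset in \<open>auto simp: E_def intro: finite_PiE\<close>)
  have step: "exp (cylinder_sup X \<phi> F w) \<le> (\<Prod>i\<in>I. E i (restrict w (T i)) powr (1 / k))"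
    if w: "w \<in> language X F" for w
  proof -
    obtain x0 where x0: "x0 \<in> X" "w = restrict x0 F" using w by (auto simp: language_def)
    have r: "restrict w (T i) = restrict x0 (T i)" if "i \<in> I" for i
      using T[OF that] by (auto simp: x0 restrict_def fun_eq_iff)
    have "cylinder_sup X \<phi> F w \<le> (\<Sum>i\<in>I. cylinder_sup X \<phi> (T i) (restrict w (T i))) / k"
    proof (rule cylinder_sup_least[OF w])
      fix x assume x: "x \<in> X" "restrict x F = w"
      have "(\<Sum>i\<in>I. birkhoff_sum \<phi> (T i) x) = (\<Sum>i\<in>I. \<Sum>g\<in>F. if g \<in> T i then apply_bcontfun \<phi> (shift g x) else 0)"
        unfolding birkhoff_sum_def
        by (intro sum.cong refl sum.mono_neutral_cong_left) (use F T in auto)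
      also have "\<dots> = (\<Sum>g\<in>F. \<Sum>i\<in>I. if g \<in> T i then apply_bcontfun \<phi> (shift g x) else 0)"
        by (rule sum.swap)
      also have "\<dots> = (\<Sum>g\<in>F. k * apply_bcontfun \<phi> (shift g x))"
        using cover I by (intro sum.cong refl) (simp add: sum.If_cases Int_def)
      also have "\<dots> = k * birkhoff_sum \<phi> F x" by (simp add: birkhoff_sum_def sum_distrib_left)
      finally have e: "birkhoff_sum \<phi> F x = (\<Sum>i\<in>I. birkhoff_sum \<phi> (T i) x) / k" using k by (simp add: field_simps)
      have "restrict w (T i) = restrict x (T i)" if "i \<in> I" for i
        using T[OF that] by (auto simp: x(2)[symmetric] restrict_def fun_eq_iff)
      then show "birkhoff_sum \<phi> F x \<le> (\<Sum>i\<in>I. cylinder_sup X \<phi> (T i) (restrict w (T i))) / k"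
        unfolding e using cylinder_sup_upper[OF x(1), of \<phi>] by (intro divide_right_mono sum_mono) auto
    qed
    then have "exp (cylinder_sup X \<phi> F w) \<le> exp (\<Sum>i\<in>I. cylinder_sup X \<phi> (T i) (restrict w (T i)) / k)"
      by (simp add: sum_divide_distrib)
    also have "\<dots> = (\<Prod>i\<in>I. exp (cylinder_sup X \<phi> (T i) (restrict w (T i)) / k))"
      by (rule exp_sum[OF I])
    also have "\<dots> = (\<Prod>i\<in>I. E i (restrict w (T i)) powr (1 / k))"
      using x0(1) r by (intro prod.cong) (auto simp: E_def language_def powr_def)
    finally show ?thesis .
  qed
  have "partition_function X F \<phi> \<le> (\<Sum>w\<in>language X F. \<Prod>i\<in>I. E i (restrict w (T i)) powr (1 / k))"
    unfolding partition_function_eq by (intro sum_mono step)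
  also have "\<dots> \<le> (\<Sum>w\<in>F \<rightarrow>\<^sub>E UNIV. \<Prod>i\<in>I. E i (restrict w (T i)) powr (1 / k))"
    using F by (intro sum_mono2 finite_PiE language_subset prod_nonneg) auto
  also have "\<dots> \<le> (\<Prod>i\<in>I. (\<Sum>v\<in>T i \<rightarrow>\<^sub>E UNIV. E i v) powr (1 / k))"
    by (rule sum_prod_restrict_powr_le[OF F I k T cover]) (auto simp: E_def)
  also have "\<dots> = (\<Prod>i\<in>I. exp (ln (partition_function X (T i) \<phi>) / k))"
    using partition_function_pos fT by (intro prod.cong) (auto simp: total powr_def less_imp_neq[symmetric])
  also have "\<dots> = exp (\<Sum>i\<in>I. ln (partition_function X (T i) \<phi>) / k)"
    by (rule exp_sum[OF I, symmetric])
  finally have "ln (partition_function X F \<phi>) \<le> (\<Sum>i\<in>I. ln (partition_function X (T i) \<phi>) / k)"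
    using partition_function_pos[OF F] by (simp add: ln_le_cancel_iff[symmetric, of _ "exp _"] del: ln_le_cancel_iff)
  then show ?thesis by (simp add: sum_divide_distrib)
qed

end

section \<open>Existence of the pressure\<close>

definition translate :: "'g::group_add set \<Rightarrow> 'g \<Rightarrow> 'g set" where
  "translate K g = (\<lambda>k. k + g) ` K"

lemma birkhoff_sum_translate:
  "birkhoff_sum \<phi> (translate K g) x = birkhoff_sum \<phi> K (shift g x)"
  unfolding birkhoff_sum_def translate_def shift_shift
  by (subst sum.reindex) (auto simp: inj_on_def)

lemma shift_subshift: "subshift X \<Longrightarrow> x \<in> X \<Longrightarrow> shift g x \<in> X"
  unfolding subshift_def by blast

lemma shift_0: "shift 0 x = x"
  by (simp add: shift_def)

text \<open>The patterns of \<open>x\<close> on \<open>K + g\<close> are those of \<open>shift g x\<close> on \<open>K\<close>, and \<open>X\<close> is shift-invariant.\<close>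

lemma partition_function_translate:
  fixes X :: "('g::group_add \<Rightarrow> 'a::{finite,topological_space}) set"
  assumes X: "subshift X"
  shows "partition_function X (translate K g) \<phi> = partition_function X K \<phi>"
proof -
  \<comment> \<open>transport of patterns from \<open>K\<close> to \<open>K + g\<close>\<close>
  define \<tau> where "\<tau> w = restrict (shift (- g) w) (translate K g)" for w :: "'g \<Rightarrow> 'a"
  have mem: "h \<in> translate K g \<longleftrightarrow> h - g \<in> K" for h
    unfolding translate_def by (metis (no_types, lifting) add_diff_cancel diff_add_cancel imageE image_eqI)
  have \<tau>: "\<tau> (restrict x K) = restrict (shift (- g) x) (translate K g)" for x
    by (auto simp: \<tau>_def restrict_def shift_def mem fun_eq_iff)
  have restr: "restrict y (translate K g) = \<tau> w \<longleftrightarrow> restrict (shift g y) K = w"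
    if w: "w \<in> K \<rightarrow>\<^sub>E UNIV" for y w
  proof
    assume *: "restrict y (translate K g) = \<tau> w"
    show "restrict (shift g y) K = w"
    proof
      fix k show "restrict (shift g y) K k = w k"
        using fun_cong[OF *, of "k + g"] w by (auto simp: \<tau>_def mem shift_def restrict_def PiE_def extensional_def)
    qed
  next
    assume "restrict (shift g y) K = w"
    then show "restrict y (translate K g) = \<tau> w" by (auto simp: \<tau> shift_shift shift_0)
  qed
  have inj: "inj_on \<tau> (language X K)"
  proof (rule inj_onI)
    fix v w assume v: "v \<in> language X K" and w: "w \<in> language X K" and e: "\<tau> v = \<tau> w"
    obtain x where x: "v = restrict x K" using v by (auto simp: language_def)
    have "restrict (shift (- g) x) (translate K g) = \<tau> w" using e by (simp add: x \<tau>)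
    then have "restrict (shift g (shift (- g) x)) K = w" using restr[OF subsetD[OF language_subset w]] by blast
    then show "v = w" by (simp add: x shift_shift shift_0)
  qed
  have img: "language X (translate K g) = \<tau> ` language X K"
  proof -
    have "shift (- g) ` X = X"
    proof
      show "X \<subseteq> shift (- g) ` X"
      proof
        fix x assume "x \<in> X"
        then show "x \<in> shift (- g) ` X"
          by (intro image_eqI[of _ _ "shift g x"]) (simp_all add: shift_shift shift_0 shift_subshift[OF X])
      qed
    qed (use shift_subshift[OF X] in blast)
    then have "language X (translate K g) = (\<lambda>x. restrict x (translate K g)) ` shift (- g) ` X"
      by (simp add: language_def)
    then show ?thesis by (simp add: language_def image_image \<tau>)
  qed
  have cyl: "cylinder_sup X \<phi> (translate K g) (\<tau> w) = cylinder_sup X \<phi> K w" if "w \<in> language X K" for w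
  proof -
    have w: "w \<in> K \<rightarrow>\<^sub>E UNIV" using that language_subset by blast
    have cimg: "shift g ` (cylinder (translate K g) (\<tau> w) \<inter> X) = cylinder K w \<inter> X"
    proof (intro equalityI subsetI)
      fix x assume "x \<in> cylinder K w \<inter> X"
      then show "x \<in> shift g ` (cylinder (translate K g) (\<tau> w) \<inter> X)"
        by (intro image_eqI[of _ _ "shift (- g) x"])
          (auto simp: cylinder_def restr[OF w] shift_shift shift_0 shift_subshift[OF X])
    qed (auto simp: cylinder_def restr[OF w] shift_subshift[OF X])
    have "birkhoff_sum \<phi> K ` (cylinder K w \<inter> X) =
        (\<lambda>x. birkhoff_sum \<phi> K (shift g x)) ` (cylinder (translate K g) (\<tau> w) \<inter> X)"
      by (subst cimg[symmetric]) (simp only: image_image)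
    then show ?thesis unfolding cylinder_sup_def birkhoff_sum_translate by (simp only:)
  qed
  show ?thesis
    unfolding partition_function_eq img by (subst sum.reindex[OF inj]) (simp add: cyl)
qed

text \<open>The numerator in the Folner condition.\<close>

definition defect :: "'g::group_add set \<Rightarrow> 'g set \<Rightarrow> real" where
  "defect D F = real (card (sym_diff {k + f | k f. k \<in> D \<and> f \<in> F} F))"

text \<open>The sets \<open>(K + g) \<inter> F\<close>, with \<open>g\<close> ranging over the translations for which they are nonempty, cover each
  point of \<open>F\<close> exactly \<open>card K\<close> times. A translate inside \<open>F\<close> contributes the value for \<open>K\<close>. Any
  other translate contains a point of \<open>F\<close> and a point outside \<open>F\<close> that differ by an element of
  \<open>K - K\<close>, so that the number of such translates is controlled by the defect of \<open>F\<close> with respect to \<open>K - K\<close>.\<close>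

lemma ln_partition_function_folner_le:
  fixes X :: "('g::group_add \<Rightarrow> 'a::{finite,topological_space}) set" and C :: real
  assumes X: "subshift X" and F: "finite F" and K: "finite K" "K \<noteq> {}"
    and C: "C = \<bar>ln (partition_function X K \<phi>)\<bar> + card K * (ln (real CARD('a)) + norm \<phi>)"
  shows "ln (partition_function X F \<phi>) \<le>
    card F * (ln (partition_function X K \<phi>) / card K) + defect {k' - k | k' k. k' \<in> K \<and> k \<in> K} F * (card K * C)"
proof -
  let ?D = "{k' - k | k' k. k' \<in> K \<and> k \<in> K}"
  let ?DF = "{d + f | d f. d \<in> ?D \<and> f \<in> F}"
  let ?z = "ln (partition_function X K \<phi>)"
  have X0: "X \<noteq> {}" using X by (simp add: subshift_def)
  define I where "I = (\<Union>k\<in>K. (\<lambda>f. - k + f) ` F)"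
  define T where "T g = translate K g \<inter> F" for g
  define Good where "Good = {g. translate K g \<subseteq> F}"
  have I_iff: "g \<in> I \<longleftrightarrow> (\<exists>k\<in>K. k + g \<in> F)" for g
  proof
    assume "g \<in> I"
    then obtain k f where kf: "k \<in> K" "f \<in> F" "g = - k + f" by (auto simp: I_def)
    then have "k + g = f" by (simp add: add.assoc[symmetric])
    then have "k + g \<in> F" using kf(2) by simp
    then show "\<exists>k\<in>K. k + g \<in> F" using kf(1) by blast
  next
    assume "\<exists>k\<in>K. k + g \<in> F"
    then obtain k where "k \<in> K" "k + g \<in> F" by blast
    moreover have "g = - k + (k + g)" by (simp add: add.assoc[symmetric])
    ultimately show "g \<in> I" unfolding I_def by blast
  qed
  have fI: "finite I" using F K by (simp add: I_def)
  have GI: "Good \<subseteq> I" using K(2) by (auto simp: Good_def I_iff translate_def)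
  have kpos: "0 < card K" using K by (simp add: card_gt_0_iff)
  have fD: "finite ?DF"
  proof -
    have "?DF = (\<lambda>(d, f). d + f) ` ((\<lambda>(k', k). k' - k) ` (K \<times> K) \<times> F)" by force
    then show ?thesis using F K by simp
  qed
  \<comment> \<open>translation by \<open>k' - k\<close> maps these points injectively into \<open>(D + F) - F\<close>\<close>
  have bad_card: "card {f\<in>F. (k' - k) + f \<notin> F} \<le> card (sym_diff ?DF F)" if "k \<in> K" "k' \<in> K" for k k'
  proof (rule card_inj_on_le[where f = "\<lambda>f. (k' - k) + f"])
    show "(\<lambda>f. (k' - k) + f) ` {f\<in>F. (k' - k) + f \<notin> F} \<subseteq> sym_diff ?DF F"
    proof
      fix y assume "y \<in> (\<lambda>f. (k' - k) + f) ` {f\<in>F. (k' - k) + f \<notin> F}"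
      then obtain f where f: "f \<in> F" "y = (k' - k) + f" "y \<notin> F" by blast
      moreover have "k' - k \<in> ?D" using that by blast
      ultimately have "y \<in> ?DF" by blast
      with f show "y \<in> sym_diff ?DF F" by blast
    qed
  qed (use fD F in \<open>auto simp: inj_on_def\<close>)
  have "I - Good \<subseteq> (\<Union>(k, k')\<in>K \<times> K. (\<lambda>f. - k + f) ` {f\<in>F. (k' - k) + f \<notin> F})"
  proof
    fix g assume g: "g \<in> I - Good"
    then obtain k k' where k: "k \<in> K" "k + g \<in> F" "k' \<in> K" "k' + g \<notin> F"
      by (auto simp: I_iff Good_def translate_def)
    have "(k' - k) + (k + g) = k' + g" by (simp add: add.assoc[symmetric])
    moreover have "g = - k + (k + g)" by (simp add: add.assoc[symmetric])
    ultimately have "g \<in> (\<lambda>f. - k + f) ` {f\<in>F. (k' - k) + f \<notin> F}"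
      using k by (metis (mono_tags, lifting) image_eqI mem_Collect_eq)
    with k show "g \<in> (\<Union>(k, k')\<in>K \<times> K. (\<lambda>f. - k + f) ` {f\<in>F. (k' - k) + f \<notin> F})" by blast
  qed
  then have "card (I - Good) \<le> card (\<Union>(k, k')\<in>K \<times> K. (\<lambda>f. - k + f) ` {f\<in>F. (k' - k) + f \<notin> F})"
    using F K by (intro card_mono) auto
  also have "\<dots> \<le> (\<Sum>(k, k')\<in>K \<times> K. card ((\<lambda>f. - k + f) ` {f\<in>F. (k' - k) + f \<notin> F}))"
    using K card_UN_le[of "K \<times> K" "\<lambda>(k, k'). (\<lambda>f. - k + f) ` {f\<in>F. (k' - k) + f \<notin> F}"]
    by (simp add: case_prod_unfold)
  also have "\<dots> \<le> (\<Sum>(k, k')\<in>K \<times> K. card (sym_diff ?DF F))"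
    using F bad_card by (intro sum_mono) (auto intro: order_trans[OF card_image_le])
  also have "\<dots> = card K * card K * card (sym_diff ?DF F)" by (simp add: card_cartesian_product)
  finally have bad_nat: "card (I - Good) \<le> card K * card K * card (sym_diff ?DF F)" .
  have bad: "real (card (I - Good)) \<le> card K * card K * defect ?D F"
  proof -
    from bad_nat have "real (card (I - Good)) \<le> real (card K * card K * card (sym_diff ?DF F))"
      by (rule of_nat_mono)
    then show ?thesis unfolding defect_def by (simp only: of_nat_mult)
  qed
  obtain k0 where k0: "k0 \<in> K" using K by blast
  have "card Good \<le> card F"
    by (rule card_inj_on_le[where f = "\<lambda>g. k0 + g"]) (use F k0 in \<open>auto simp: Good_def translate_def inj_on_def\<close>)
  moreover have "card F \<le> card I"
    by (rule card_inj_on_le[where f = "\<lambda>f. - k0 + f"]) (use fI k0 in \<open>auto simp: I_def inj_on_def\<close>)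
  moreover have "card I = card Good + card (I - Good)"
    using card_Diff_subset[OF finite_subset[OF GI fI] GI] card_mono[OF fI GI] by simp
  ultimately have good: "\<bar>real (card Good) - card F\<bar> \<le> card (I - Good)" by linarith
  have "ln (partition_function X F \<phi>) \<le> (\<Sum>g\<in>I. ln (partition_function X (T g) \<phi>)) / card K"
  proof (rule ln_partition_function_cover[OF X0 F fI kpos])
    fix f assume f: "f \<in> F"
    have "{g\<in>I. f \<in> T g} = (\<lambda>k. - k + f) ` K"
    proof (intro equalityI subsetI)
      fix g assume "g \<in> {g\<in>I. f \<in> T g}"
      then obtain k where "k \<in> K" "f = k + g" by (auto simp: T_def translate_def)
      then show "g \<in> (\<lambda>k. - k + f) ` K" by (intro image_eqI[of _ _ k]) (auto simp: add.assoc[symmetric])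
    next
      fix g assume "g \<in> (\<lambda>k. - k + f) ` K"
      then obtain k where k: "k \<in> K" "g = - k + f" by blast
      then have "f = k + g" by (simp add: add.assoc[symmetric])
      with k f show "g \<in> {g\<in>I. f \<in> T g}" by (auto simp: I_iff T_def translate_def)
    qed
    moreover have "inj_on (\<lambda>k. - k + f) K" by (auto simp: inj_on_def)
    ultimately show "card {g\<in>I. f \<in> T g} = card K" by (simp add: card_image)
  qed (auto simp: T_def)
  also have "(\<Sum>g\<in>I. ln (partition_function X (T g) \<phi>)) =
      (\<Sum>g\<in>I - Good. ln (partition_function X (T g) \<phi>)) + (\<Sum>g\<in>Good. ln (partition_function X (T g) \<phi>))"
    by (rule sum.subset_diff[OF GI fI])
  also have "(\<Sum>g\<in>Good. ln (partition_function X (T g) \<phi>)) = card Good * ?z"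
  proof -
    have "T g = translate K g" if "g \<in> Good" for g using that by (auto simp: T_def Good_def)
    then show ?thesis by (simp add: partition_function_translate[OF X] cong: sum.cong)
  qed
  also have "card Good * ?z \<le> card F * ?z + card (I - Good) * \<bar>?z\<bar>"
  proof -
    have "(real (card Good) - card F) * ?z \<le> \<bar>real (card Good) - card F\<bar> * \<bar>?z\<bar>"
      by (metis abs_ge_self abs_mult)
    also have "\<dots> \<le> card (I - Good) * \<bar>?z\<bar>" using good by (intro mult_right_mono) auto
    finally show ?thesis by (simp add: algebra_simps)
  qed
  also have "(\<Sum>g\<in>I - Good. ln (partition_function X (T g) \<phi>)) \<le>
      (\<Sum>g\<in>I - Good. card K * (ln (real CARD('a)) + norm \<phi>))"
  proof (rule sum_mono)
    fix g
    have "card (T g) \<le> card (translate K g)"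
      unfolding T_def translate_def using K by (intro card_mono) auto
    also have "\<dots> \<le> card K" unfolding translate_def by (rule card_image_le[OF K(1)])
    finally have "real (card (T g)) * (ln (real CARD('a)) + norm \<phi>) \<le> card K * (ln (real CARD('a)) + norm \<phi>)"
      by (intro mult_right_mono) (auto simp: Suc_le_eq card_gt_0_iff)
    moreover have "finite (T g)" using F by (simp add: T_def)
    ultimately show "ln (partition_function X (T g) \<phi>) \<le> card K * (ln (real CARD('a)) + norm \<phi>)"
      using ln_partition_function_bound[OF X0, of "T g" \<phi>] by linarith
  qed
  finally have "ln (partition_function X F \<phi>) \<le> (card F * ?z + card (I - Good) * C) / card K"
    using kpos by (simp add: C field_simps)
  also have "\<dots> \<le> (card F * ?z + (card K * card K * defect ?D F) * C) / card K"
  proof -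
    have "0 \<le> C" by (simp add: C Suc_le_eq card_gt_0_iff)
    then show ?thesis using bad by (intro divide_right_mono add_left_mono mult_right_mono) auto
  qed
  finally show ?thesis using kpos by (simp add: field_simps)
qed

text \<open>The limit is the infimum of \<open>ln Z\<^sub>K / |K|\<close> over all finite nonempty sets \<open>K\<close>: no term of the sequence
  lies below it, and the preceding estimate keeps the sequence eventually below any larger number.\<close>

theorem pressure_limit:
  fixes X :: "('g::group_add \<Rightarrow> 'a::{finite,topological_space}) set"
  assumes X: "subshift X" and ex: "\<exists>F :: nat \<Rightarrow> 'g set. folner_sequence F" and F: "folner_sequence F"
  shows "(\<lambda>n. ln (partition_function X (F n) \<phi>) / real (card (F n))) \<longlonglongrightarrow> pressure X \<phi>"
proof -
  have X0: "X \<noteq> {}" using X by (simp add: subshift_def)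
  let ?K = "{K :: 'g set. finite K \<and> K \<noteq> {}}"
  let ?z = "\<lambda>K. ln (partition_function X K \<phi>)"
  define p where "p = (INF K\<in>?K. ?z K / card K)"
  have bdd: "bdd_below ((\<lambda>K. ?z K / card K) ` ?K)"
  proof (rule bdd_belowI2)
    fix K assume "K \<in> ?K"
    then show "- norm \<phi> \<le> ?z K / card K"
      using ln_partition_function_bound_below[OF X0, of K \<phi>] by (simp add: field_simps card_gt_0_iff)
  qed
  have lim: "(\<lambda>n. ?z (F n) / real (card (F n))) \<longlonglongrightarrow> p" if F: "folner_sequence F" for F
  proof -
    have fin: "finite (F n)" and sub: "F n \<subset> F (Suc n)" for n using F by (auto simp: folner_sequence_def)
    have ne: "F n \<noteq> {}" if "1 \<le> n" for n using sub[of "n - 1"] that by auto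
    show ?thesis
    proof (rule order_tendstoI)
      fix a assume a: "a < p"
      have "a < ?z (F n) / real (card (F n))" if "1 \<le> n" for n
        using cINF_lower[OF bdd, of "F n"] fin ne[OF that] a by (auto simp: p_def)
      then show "\<forall>\<^sub>F n in sequentially. a < ?z (F n) / real (card (F n))"
        unfolding eventually_sequentially by blast
    next
      fix a assume "p < a"
      moreover have "{0} \<in> ?K" by simp
      then have "?K \<noteq> {}" by blast
      ultimately obtain K where K: "finite K" "K \<noteq> {}" "?z K / card K < a"
        unfolding p_def using cINF_less_iff[OF _ bdd, of a] by auto
      let ?D = "{k' - k | k' k. k' \<in> K \<and> k \<in> K}"
      define C where "C = \<bar>?z K\<bar> + card K * (ln (real CARD('a)) + norm \<phi>)"
      have "?D = (\<lambda>(k', k). k' - k) ` (K \<times> K)" by auto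
      then have "finite ?D" "?D \<noteq> {}" using K by auto
      then have "(\<lambda>n. defect ?D (F n) / real (card (F n))) \<longlonglongrightarrow> 0"
        using F unfolding folner_sequence_def defect_def by blast
      then have "(\<lambda>n. ?z K / card K + defect ?D (F n) / real (card (F n)) * (card K * C)) \<longlonglongrightarrow> ?z K / card K + 0 * (card K * C)"
        by (intro tendsto_intros)
      then have ev: "\<forall>\<^sub>F n in sequentially. ?z K / card K + defect ?D (F n) / real (card (F n)) * (card K * C) < a"
        using K(3) by (intro order_tendstoD) auto
      show "\<forall>\<^sub>F n in sequentially. ?z (F n) / real (card (F n)) < a"
        using ev eventually_ge_at_top[of 1]
      proof eventually_elim
        case (elim n)
        have "0 < card (F n)" using fin ne[OF elim(2)] by (simp add: card_gt_0_iff)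
        then have "?z (F n) / real (card (F n)) \<le> ?z K / card K + defect ?D (F n) / real (card (F n)) * (card K * C)"
          using ln_partition_function_folner_le[OF X fin K(1,2) C_def, of n] by (simp add: field_simps)
        with elim(1) show ?case by linarith
      qed
    qed
  qed
  have "pressure X \<phi> = p"
    unfolding pressure_def
  proof (rule the_equality)
    fix q assume "\<forall>F. folner_sequence F \<longrightarrow> (\<lambda>n. ?z (F n) / real (card (F n))) \<longlonglongrightarrow> q"
    then show "q = p" using ex lim LIMSEQ_unique by blast
  qed (use lim in blast)
  then show ?thesis using lim[OF F] by simp
qed

section \<open>Shift spaces inside the real line\<close>

text \<open>The base is \<open>b + 1\<close> although the digits are below \<open>b\<close>: the tail of the series is then less than 1, the
  leading digit is the integer part, and expansions are unique.\<close>

lemma digit_series_inj: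
  fixes c d :: "nat \<Rightarrow> nat" and b :: nat
  assumes b: "0 < b" and c: "\<And>n. c n < b" and d: "\<And>n. d n < b"
    and eq: "(\<Sum>n. real (c n) * (1 / (b + 1)) ^ n) = (\<Sum>n. real (d n) * (1 / (b + 1)) ^ n)"
  shows "c n = d n"
proof -
  define \<theta> where "\<theta> = 1 / (real b + 1)"
  define s where "s f = (\<Sum>n. real (f n) * \<theta> ^ n)" for f :: "nat \<Rightarrow> nat"
  have \<theta>: "0 < \<theta>" "\<theta> < 1" using b by (auto simp: \<theta>_def)
  have geo: "summable (\<lambda>n. real (b - 1) * \<theta> ^ n)"
    using \<theta> by (intro summable_mult summable_geometric) auto
  have bound: "real (f n) * \<theta> ^ n \<le> real (b - 1) * \<theta> ^ n" if "\<And>n. f n < b" for f n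
    using that[of n] \<theta> by (intro mult_right_mono) auto
  have sm: "summable (\<lambda>n. real (f n) * \<theta> ^ n)" if "\<And>n. f n < b" for f
    by (rule summable_comparison_test'[OF geo, of 0]) (use bound[OF that] \<theta> in auto)
  have split: "s f = real (f 0) + \<theta> * s (\<lambda>n. f (Suc n))" if "\<And>n. f n < b" for f
  proof -
    have "s f = real (f 0) * \<theta> ^ 0 + (\<Sum>n. real (f (Suc n)) * \<theta> ^ Suc n)"
      unfolding s_def using suminf_split_head[OF sm, of f] that by simp
    also have "(\<Sum>n. real (f (Suc n)) * \<theta> ^ Suc n) = (\<Sum>n. \<theta> * (real (f (Suc n)) * \<theta> ^ n))"
      by (simp add: algebra_simps)
    also have "\<dots> = \<theta> * s (\<lambda>n. f (Suc n))"
      unfolding s_def by (rule suminf_mult[OF sm]) (rule that)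
    finally show ?thesis by simp
  qed
  have tail: "0 \<le> \<theta> * s f" "\<theta> * s f < 1" if "\<And>n. f n < b" for f
  proof -
    have "s f \<le> (\<Sum>n. real (b - 1) * \<theta> ^ n)"
      unfolding s_def by (rule suminf_le[OF bound sm geo]) (rule that)+
    also have "\<dots> = real (b - 1) * (1 / (1 - \<theta>))"
      using \<theta> by (subst suminf_mult) (auto intro: summable_geometric simp: suminf_geometric)
    finally have "\<theta> * s f \<le> \<theta> * (real (b - 1) * (1 / (1 - \<theta>)))" using \<theta> by (intro mult_left_mono) auto
    also have "\<dots> = real (b - 1) / b"
    proof -
      have "1 - \<theta> = real b * \<theta>" using b by (simp add: \<theta>_def divide_simps)
      then show ?thesis using \<theta> b by simp
    qed
    also have "\<dots> < 1" using b by simp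
    finally show "\<theta> * s f < 1" .
    show "0 \<le> \<theta> * s f" unfolding s_def using \<theta> by (intro mult_nonneg_nonneg suminf_nonneg sm that) auto
  qed
  have "s c = s d" using eq by (simp add: s_def \<theta>_def add.commute)
  with c d show ?thesis
  proof (induction n arbitrary: c d)
    case (0 c d)
    have "\<lfloor>s f\<rfloor> = int (f 0)" if "\<And>n. f n < b" for f
      using split[of f] tail[of "\<lambda>n. f (Suc n)"] that by (intro floor_unique) auto
    then have "int (c 0) = int (d 0)" using 0 by metis
    then show ?case by simp
  next
    case (Suc n c d)
    have "\<lfloor>s f\<rfloor> = int (f 0)" if "\<And>n. f n < b" for f
      using split[of f] tail[of "\<lambda>n. f (Suc n)"] that by (intro floor_unique) auto
    then have "int (c 0) = int (d 0)" using Suc.prems by metis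
    then have "\<theta> * s (\<lambda>n. c (Suc n)) = \<theta> * s (\<lambda>n. d (Suc n))"
      using split[of c, OF Suc.prems(1)] split[of d, OF Suc.prems(2)] Suc.prems(3) by linarith
    then have "s (\<lambda>n. c (Suc n)) = s (\<lambda>n. d (Suc n))" using \<theta> by simp
    from Suc.IH[OF Suc.prems(1) Suc.prems(2) this] show ?case .
  qed
qed

lemma continuous_on_discrete_function:
  fixes f :: "'a::discrete_topology \<Rightarrow> 'b::topological_space"
  shows "continuous_on S f"
  by (auto simp: continuous_on_open_invariant open_discrete intro!: exI[of _ "f -` _ \<inter> S"])

text \<open>On a compact subshift the embedding is a homeomorphism onto its image. It serves to transfer the
  selection and uniqueness theorems for probability measures on the real line to shift spaces.\<close>

lemma ex_real_embedding:
  "\<exists>\<iota> :: ('g::countable \<Rightarrow> 'a::{finite,discrete_topology}) \<Rightarrow> real. continuous_on UNIV \<iota> \<and> inj \<iota>"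
proof -
  let ?b = "CARD('a)"
  obtain \<alpha> :: "'a \<Rightarrow> nat" where \<alpha>: "bij_betw \<alpha> UNIV {0..<?b}"
    using ex_bij_betw_finite_nat[of "UNIV :: 'a set"] by auto
  have less: "\<alpha> a < ?b" for a using bij_betwE[OF \<alpha>] by auto
  have b: "0 < ?b" by simp
  let ?t = "\<lambda>n (x :: 'g \<Rightarrow> 'a). real (\<alpha> (x (from_nat n))) * (1 / (?b + 1)) ^ n"
  let ?\<iota> = "\<lambda>x. \<Sum>n. ?t n x"
  have "uniform_limit UNIV (\<lambda>N x. \<Sum>n<N. ?t n x) ?\<iota> sequentially"
  proof (rule Weierstrass_m_test)
    show "norm (?t n x) \<le> real ?b * (1 / (?b + 1)) ^ n" for n x
      using less[of "x (from_nat n)"] by (auto simp: abs_mult intro!: mult_right_mono)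
    show "summable (\<lambda>n. real ?b * (1 / (?b + 1)) ^ n)"
      by (intro summable_mult summable_geometric) auto
  qed
  moreover have "continuous_on UNIV (\<lambda>x. \<Sum>n<N. ?t n x)" for N
    by (intro continuous_intros continuous_on_compose2[OF continuous_on_discrete_function[of UNIV "\<lambda>a. real (\<alpha> a)"]
          continuous_on_product_coordinates]) auto
  ultimately have "continuous_on UNIV ?\<iota>"
    by (intro uniform_limit_theorem[where F = sequentially]) auto
  moreover have "inj ?\<iota>"
  proof (rule injI)
    fix x y assume eq: "?\<iota> x = ?\<iota> y"
    have "\<alpha> (x (from_nat n)) = \<alpha> (y (from_nat n))" for n
      by (rule digit_series_inj[OF b less less eq])
    then have "x (from_nat n) = y (from_nat n)" for n
      using \<alpha> by (simp add: bij_betw_def inj_eq)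
    then show "x = y" by (metis ext from_nat_to_nat)
  qed
  ultimately show ?thesis by blast
qed

lemma compact_shift_space: "compact (UNIV :: ('g \<Rightarrow> 'a::{finite,discrete_topology}) set)"
proof -
  have "compact_space (euclidean :: 'a topology)"
    by (simp add: compact_space_def finite_imp_compact)
  then have "compact_space (product_topology (\<lambda>_ :: 'g. euclidean :: 'a topology) UNIV)"
    by (simp add: compact_space_product_topology)
  then show ?thesis by (simp add: euclidean_product_topology compact_space_def)
qed

lemma compact_subshift:
  fixes X :: "('g::group_add \<Rightarrow> 'a::{finite,discrete_topology}) set"
  assumes "subshift X" shows "compact X"
  using compact_Int_closed[OF compact_shift_space, of X] assms by (simp add: subshift_def)

lemma continuous_on_shift: "continuous_on S (shift g :: ('g::group_add \<Rightarrow> 'a::topological_space) \<Rightarrow> _)"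
  unfolding shift_def
  by (intro continuous_on_coordinatewise_then_product continuous_on_subset[OF continuous_on_product_coordinates]) auto

lemma bcontfun_shift_space:
  fixes f :: "('g \<Rightarrow> 'a::{finite,discrete_topology}) \<Rightarrow> real"
  assumes "continuous_on UNIV f"
  shows "apply_bcontfun (Bcontfun f) = f"
proof -
  have "bounded (range f)"
    using compact_continuous_image[OF assms compact_shift_space] by (rule compact_imp_bounded)
  then show ?thesis using assms by (intro Bcontfun_inverse) (simp add: bcontfun_def)
qed

section \<open>Invariant measures\<close>

definition prob_measures_on :: "('g \<Rightarrow> 'a::topological_space) set \<Rightarrow> ('g \<Rightarrow> 'a) measure set" where
  "prob_measures_on X = {\<nu>. sets \<nu> = sets (restrict_space borel X) \<and> emeasure \<nu> (space \<nu>) = 1}"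

lemma space_prob_measures_on: "\<nu> \<in> prob_measures_on X \<Longrightarrow> space \<nu> = X"
  using sets_eq_imp_space_eq[of \<nu> "restrict_space borel X"] by (simp add: prob_measures_on_def space_restrict_space)

lemma prob_space_on: "\<nu> \<in> prob_measures_on X \<Longrightarrow> prob_space \<nu>"
  by (auto simp: prob_measures_on_def intro: prob_spaceI)

lemma measurable_continuous_on:
  assumes "\<nu> \<in> prob_measures_on X" "continuous_on X f"
  shows "f \<in> borel_measurable \<nu>"
  using borel_measurable_continuous_on_restrict[OF assms(2)] assms(1)
  by (simp add: prob_measures_on_def cong: measurable_cong_sets)

lemma measurable_bcontfun:
  assumes "\<nu> \<in> prob_measures_on X"
  shows "apply_bcontfun \<phi> \<in> borel_measurable \<nu>"
  by (rule measurable_continuous_on[OF assms continuous_on_apply_bcontfun])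

lemma integrable_bcontfun:
  fixes \<phi> :: "('g \<Rightarrow> 'a::topological_space) \<Rightarrow>\<^sub>C real"
  assumes "\<nu> \<in> prob_measures_on X"
  shows "integrable \<nu> (apply_bcontfun \<phi>)"
proof -
  interpret prob_space \<nu> by (rule prob_space_on[OF assms])
  show ?thesis
    by (rule integrable_const_bound[where B = "norm \<phi>"]) (use norm_bounded[of \<phi>] measurable_bcontfun[OF assms] in auto)
qed

text \<open>The images of both measures on the real line have the same characteristic function, because its real and
  imaginary parts are integrals of continuous functions on the shift space. The inverse of the embedding is
  continuous on the compact image, hence measurable, and recovers the measures from their images.\<close>

lemma prob_measure_eqI:
  fixes X :: "('g::countable \<Rightarrow> 'a::{finite,discrete_topology}) set"
  assumes X: "compact X" "X \<noteq> {}"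
    and \<mu>: "\<mu> \<in> prob_measures_on X" and \<nu>: "\<nu> \<in> prob_measures_on X"
    and eq: "\<And>\<phi> :: ('g \<Rightarrow> 'a) \<Rightarrow>\<^sub>C real. (\<integral>x. apply_bcontfun \<phi> x \<partial>\<mu>) = (\<integral>x. apply_bcontfun \<phi> x \<partial>\<nu>)"
  shows "\<mu> = \<nu>"
proof -
  obtain \<iota> :: "('g \<Rightarrow> 'a) \<Rightarrow> real" where \<iota>: "continuous_on UNIV \<iota>" "inj \<iota>" using ex_real_embedding by blast
  obtain x0 where x0: "x0 \<in> X" using X by blast
  define j where "j t = (if t \<in> \<iota> ` X then inv \<iota> t else x0)" for t
  have \<iota>X: "continuous_on X \<iota>" using \<iota>(1) continuous_on_subset by blast
  have j\<iota>: "j (\<iota> x) = x" if "x \<in> X" for x using that \<iota>(2) by (auto simp: j_def)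
  have jX: "j t \<in> X" for t using \<iota>(2) x0 by (auto simp: j_def)
  have "j \<in> borel_measurable borel"
    unfolding j_def
  proof (rule borel_measurable_continuous_on_if)
    show "\<iota> ` X \<in> sets borel" using compact_continuous_image[OF \<iota>X X(1)] by (intro borel_closed compact_imp_closed)
    show "continuous_on (\<iota> ` X) (inv \<iota>)" by (rule continuous_on_inv[OF \<iota>X X(1)]) (simp add: \<iota>(2))
  qed simp
  then have j: "j \<in> borel \<rightarrow>\<^sub>M restrict_space borel X"
    by (intro measurable_restrict_space2) (use jX in auto)
  have pull_back: "distr (distr \<rho> borel \<iota>) (restrict_space borel X) j = \<rho>" if \<rho>: "\<rho> \<in> prob_measures_on X" for \<rho>
  proof -
    have s: "sets \<rho> = sets (restrict_space borel X)" using \<rho> by (simp add: prob_measures_on_def)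
    have "distr (distr \<rho> borel \<iota>) (restrict_space borel X) j = distr \<rho> (restrict_space borel X) (j \<circ> \<iota>)"
      by (rule distr_distr[OF j measurable_continuous_on[OF \<rho> \<iota>X]])
    also have "\<dots> = distr \<rho> \<rho> (\<lambda>x. x)"
      by (rule distr_cong) (use s space_prob_measures_on[OF \<rho>] j\<iota> in auto)
    finally show ?thesis by simp
  qed
  have rd: "real_distribution (distr \<rho> borel \<iota>)" if \<rho>: "\<rho> \<in> prob_measures_on X" for \<rho>
  proof -
    interpret prob_space \<rho> by (rule prob_space_on[OF \<rho>])
    show ?thesis
      using prob_space_distr[OF measurable_continuous_on[OF \<rho> \<iota>X]]
      by (simp add: real_distribution_def real_distribution_axioms_def)
  qed
  have int: "char (distr \<rho> borel \<iota>) t =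
      complex_of_real (\<integral>x. apply_bcontfun (Bcontfun (\<lambda>x. cos (t * \<iota> x))) x \<partial>\<rho>) +
      \<i> * complex_of_real (\<integral>x. apply_bcontfun (Bcontfun (\<lambda>x. sin (t * \<iota> x))) x \<partial>\<rho>)"
    if \<rho>: "\<rho> \<in> prob_measures_on X" for \<rho> t
  proof -
    have c: "continuous_on UNIV (\<lambda>x. cos (t * \<iota> x))"
      by (rule continuous_on_compose2[OF _ continuous_on_mult_left[OF \<iota>(1)], of UNIV cos])
        (auto intro: continuous_intros)
    have s: "continuous_on UNIV (\<lambda>x. sin (t * \<iota> x))"
      by (rule continuous_on_compose2[OF _ continuous_on_mult_left[OF \<iota>(1)], of UNIV sin])
        (auto intro: continuous_intros)
    have ic: "integrable \<rho> (\<lambda>x. cos (t * \<iota> x))" and ints: "integrable \<rho> (\<lambda>x. sin (t * \<iota> x))"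
      using integrable_bcontfun[OF \<rho>, of "Bcontfun (\<lambda>x. cos (t * \<iota> x))"]
        integrable_bcontfun[OF \<rho>, of "Bcontfun (\<lambda>x. sin (t * \<iota> x))"]
      by (simp_all only: bcontfun_shift_space[OF c] bcontfun_shift_space[OF s])
    have "char (distr \<rho> borel \<iota>) t = (CLINT x|\<rho>. iexp (t * \<iota> x))"
      unfolding char_def by (rule integral_distr[OF measurable_continuous_on[OF \<rho> \<iota>X]]) simp
    also have "\<dots> = (CLINT x|\<rho>. complex_of_real (cos (t * \<iota> x)) + \<i> * complex_of_real (sin (t * \<iota> x)))"
      by (simp only: exp_Euler cos_of_real sin_of_real of_real_mult[symmetric])
    also have "\<dots> = (CLINT x|\<rho>. complex_of_real (cos (t * \<iota> x))) + (CLINT x|\<rho>. \<i> * complex_of_real (sin (t * \<iota> x)))"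
      using ic ints by (intro Bochner_Integration.integral_add integrable_mult_right integrable_of_real)
    also have "\<dots> = complex_of_real (\<integral>x. cos (t * \<iota> x) \<partial>\<rho>) + \<i> * complex_of_real (\<integral>x. sin (t * \<iota> x) \<partial>\<rho>)"
      by simp
    finally show ?thesis by (simp only: bcontfun_shift_space[OF c] bcontfun_shift_space[OF s])
  qed
  have "char (distr \<mu> borel \<iota>) = char (distr \<nu> borel \<iota>)"
    by (rule ext) (simp only: int[OF \<mu>] int[OF \<nu>] eq)
  from Levy_uniqueness[OF rd[OF \<mu>] rd[OF \<nu>] this] show ?thesis
    using pull_back[OF \<mu>] pull_back[OF \<nu>] by metis
qed

section \<open>Limits of empirical measures\<close>

lemma infdist_zero_closed:
  fixes S :: "real set"
  assumes "closed S" "S \<noteq> {}" "min 1 (infdist t S) = 0"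
  shows "t \<in> S"
  using in_closed_iff_infdist_zero[OF assms(1,2)] assms(3) by (auto simp: min_def split: if_splits)

text \<open>Helly's selection theorem applies to the images of the empirical measures on the real line, since they all
  live on one compact set. The limit lives on the same set, as the truncated
  distance to it has integral 0, and can be pulled back. A continuous function on the shift
  space corresponds to one on the compact set, which the Tietze theorem extends to a test function on the line.\<close>

theorem empirical_measures_accumulate:
  fixes X :: "('g::{group_add,countable} \<Rightarrow> 'a::{finite,discrete_topology}) set" and x :: "nat \<Rightarrow> 'g \<Rightarrow> 'a"
  assumes X: "subshift X" and x: "\<And>n. x n \<in> X" and F: "\<And>n. finite (F n)" "\<And>n. F n \<noteq> {}"
  shows "\<exists>r \<nu>. strict_mono (r :: nat \<Rightarrow> nat) \<and> \<nu> \<in> prob_measures_on X \<and>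
    (\<forall>\<phi>. (\<lambda>n. birkhoff_sum \<phi> (F (r n)) (x (r n)) / card (F (r n))) \<longlonglongrightarrow> (\<integral>y. apply_bcontfun \<phi> y \<partial>\<nu>))"
proof -
  obtain \<iota> :: "('g \<Rightarrow> 'a) \<Rightarrow> real" where \<iota>: "continuous_on UNIV \<iota>" "inj \<iota>" using ex_real_embedding by blast
  note cX = compact_subshift[OF X]
  have \<iota>X: "continuous_on X \<iota>" using \<iota>(1) continuous_on_subset by blast
  let ?K = "\<iota> ` X"
  have K: "compact ?K" by (rule compact_continuous_image[OF \<iota>X cX])
  have clK: "closed ?K" using K by (rule compact_imp_closed)
  have K0: "?K \<noteq> {}" using x by blast
  have inv: "continuous_on ?K (inv \<iota>)" by (rule continuous_on_inv[OF \<iota>X cX]) (simp add: \<iota>(2))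
  define \<mu> where "\<mu> n = distr (measure_pmf (pmf_of_set (F n))) borel (\<lambda>g. \<iota> (shift g (x n)))" for n
  have rd: "real_distribution (\<mu> n)" for n
  proof -
    have "prob_space (\<mu> n)"
      unfolding \<mu>_def by (rule prob_space.prob_space_distr[OF measure_pmf.prob_space_axioms]) simp
    then show ?thesis by (simp add: real_distribution_def real_distribution_axioms_def \<mu>_def)
  qed
  have int_\<mu>: "(\<integral>t. f t \<partial>\<mu> n) = (\<Sum>g\<in>F n. f (\<iota> (shift g (x n)))) / card (F n)"
    if "f \<in> borel_measurable borel" for f :: "real \<Rightarrow> real" and n
    unfolding \<mu>_def using that F by (subst integral_distr) (auto simp: integral_pmf_of_set)
  obtain B where B: "\<And>t. t \<in> ?K \<Longrightarrow> \<bar>t\<bar> \<le> B" using compact_imp_bounded[OF K] by (auto simp: bounded_iff)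
  have in_K: "\<iota> (shift g (x n)) \<in> ?K" for g n using shift_subshift[OF X x] by blast
  have "tight \<mu>"
    unfolding tight_def
  proof (intro conjI allI impI rd)
    fix \<epsilon> :: real assume \<epsilon>: "0 < \<epsilon>"
    have "measure (\<mu> n) {- B - 1<..B + 1} = 1" for n
    proof -
      have "(\<lambda>g. \<iota> (shift g (x n))) -` {- B - 1<..B + 1} = UNIV" using B[OF in_K[of _ n]] by (auto simp: abs_le_iff) (smt (verit))+
      then show ?thesis unfolding \<mu>_def by (subst measure_distr) auto
    qed
    moreover have "0 \<le> B" using B[OF in_K[of 0 0]] by linarith
    ultimately show "\<exists>a b. a < b \<and> (\<forall>n. 1 - \<epsilon> < measure (\<mu> n) {a<..b})"
      using \<epsilon> by (intro exI[of _ "- B - 1"] exI[of _ "B + 1"]) auto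
  qed
  from tight_imp_convergent_subsubsequence[OF this, of id] obtain r M
    where r: "strict_mono (r :: nat \<Rightarrow> nat)" and M: "real_distribution M" and conv: "weak_conv_m (\<lambda>n. \<mu> (r n)) M"
    by (auto simp: strict_mono_def comp_def)
  interpret M: real_distribution M by (rule M)
  have lim: "(\<lambda>n. (\<Sum>g\<in>F (r n). f (\<iota> (shift g (x (r n))))) / card (F (r n))) \<longlonglongrightarrow> (\<integral>t. f t \<partial>M)"
    if f: "continuous_on UNIV f" "\<And>t. norm (f t) \<le> C" for f :: "real \<Rightarrow> real" and C
  proof -
    have "(\<lambda>n. \<integral>t. f t \<partial>\<mu> (r n)) \<longlonglongrightarrow> (\<integral>t. f t \<partial>M)"
      by (rule weak_conv_imp_integral_bdd_continuous_conv[OF rd M conv _ f(2)])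
        (use f(1) in \<open>simp add: continuous_on_eq_continuous_at\<close>)
    then show ?thesis using int_\<mu>[OF borel_measurable_continuous_onI[OF f(1)]] by simp
  qed
  have AE_K: "AE t in M. t \<in> ?K"
  proof -
    let ?f = "\<lambda>t. min 1 (infdist t ?K)"
    have f: "continuous_on UNIV ?f" by (intro continuous_intros)
    have fb: "norm (?f t) \<le> 1" for t by (simp add: infdist_nonneg)
    have "?f (\<iota> (shift g (x n))) = 0" for g n using in_K[of g n] by (simp add: infdist_zero)
    with lim[OF f fb] have "(\<integral>t. ?f t \<partial>M) = 0" by (simp add: LIMSEQ_const_iff)
    moreover have meas: "?f \<in> borel_measurable M" using borel_measurable_continuous_onI[OF f] by simp
    then have "integrable M ?f" by (rule M.integrable_const_bound[where B = 1, rotated]) (use fb in auto)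
    ultimately have "AE t in M. ?f t = 0"
      by (subst integral_nonneg_eq_0_iff_AE[symmetric]) (auto simp: infdist_nonneg)
    then show ?thesis by eventually_elim (rule infdist_zero_closed[OF clK K0])
  qed
  define j where "j t = (if t \<in> ?K then inv \<iota> t else x 0)" for t
  have jX: "j t \<in> X" for t using \<iota>(2) x by (auto simp: j_def)
  have "j \<in> borel_measurable borel"
    unfolding j_def by (rule borel_measurable_continuous_on_if[OF borel_closed[OF clK] inv]) simp
  then have j: "j \<in> M \<rightarrow>\<^sub>M restrict_space borel X"
    by (intro measurable_restrict_space2) (use jX in auto)
  define \<nu> where "\<nu> = distr M (restrict_space borel X) j"
  have \<nu>: "\<nu> \<in> prob_measures_on X"
    using prob_space.emeasure_space_1[OF M.prob_space_distr[OF j]] by (simp add: prob_measures_on_def \<nu>_def)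
  have main: "(\<lambda>n. birkhoff_sum \<phi> (F (r n)) (x (r n)) / card (F (r n))) \<longlonglongrightarrow> (\<integral>y. apply_bcontfun \<phi> y \<partial>\<nu>)" for \<phi>
  proof -
    have c: "continuous_on ?K (apply_bcontfun \<phi> \<circ> inv \<iota>)"
      by (rule continuous_on_compose[OF inv]) (rule continuous_on_apply_bcontfun)
    obtain f where f: "continuous_on UNIV f" "\<And>t. t \<in> ?K \<Longrightarrow> f t = (apply_bcontfun \<phi> \<circ> inv \<iota>) t"
      "\<And>t. t \<in> UNIV \<Longrightarrow> norm (f t) \<le> norm \<phi>"
      using Tietze[OF c, of UNIV "norm \<phi>"] clK norm_bounded[of \<phi>] by auto
    have "f (\<iota> (shift g (x n))) = apply_bcontfun \<phi> (shift g (x n))" for g n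
      using f(2)[OF in_K[of g n]] \<iota>(2) by simp
    with lim[OF f(1,3)] have l: "(\<lambda>n. birkhoff_sum \<phi> (F (r n)) (x (r n)) / card (F (r n))) \<longlonglongrightarrow> (\<integral>t. f t \<partial>M)"
      by (simp add: birkhoff_sum_def)
    have "(\<integral>y. apply_bcontfun \<phi> y \<partial>\<nu>) = (\<integral>t. apply_bcontfun \<phi> (j t) \<partial>M)"
      unfolding \<nu>_def using measurable_bcontfun[OF \<nu>, of \<phi>]
      by (intro integral_distr[OF j]) (simp add: \<nu>_def)
    also have "\<dots> = (\<integral>t. f t \<partial>M)"
    proof (rule integral_cong_AE)
      show "AE t in M. apply_bcontfun \<phi> (j t) = f t"
        using AE_K by eventually_elim (auto simp: j_def f(2))
      show "f \<in> borel_measurable M" using borel_measurable_continuous_onI[OF f(1)] by simp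
      show "(\<lambda>t. apply_bcontfun \<phi> (j t)) \<in> borel_measurable M"
        using measurable_compose[OF j, of "apply_bcontfun \<phi>" borel] measurable_bcontfun[OF \<nu>, of \<phi>]
        by (simp add: \<nu>_def)
    qed
    finally show ?thesis using l by simp
  qed
  show ?thesis using r \<nu> main by blast
qed

lemma invariant_measures_subset: "invariant_measures X \<subseteq> prob_measures_on X"
  by (auto simp: invariant_measures_def prob_measures_on_def)

lemma measurable_shift:
  assumes "subshift X" "\<nu> \<in> prob_measures_on X"
  shows "shift g \<in> \<nu> \<rightarrow>\<^sub>M restrict_space borel X"
proof (rule measurable_restrict_space2)
  show "shift g \<in> space \<nu> \<rightarrow> X" using shift_subshift[OF assms(1)] space_prob_measures_on[OF assms(2)] by auto
  show "shift g \<in> borel_measurable \<nu>" by (rule measurable_continuous_on[OF assms(2) continuous_on_shift])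
qed

lemma distr_shift_on:
  assumes "\<nu> \<in> prob_measures_on X"
  shows "distr \<nu> \<nu> (shift g) = distr \<nu> (restrict_space borel X) (shift g)"
  by (rule distr_cong) (use assms in \<open>auto simp: prob_measures_on_def\<close>)

lemma birkhoff_sum_shift_diff:
  assumes "finite F"
  shows "\<bar>birkhoff_sum \<phi> ((+) k ` F) x - birkhoff_sum \<phi> F x\<bar> \<le> norm \<phi> * defect {k} F"
proof -
  let ?A = "(+) k ` F"
  have "birkhoff_sum \<phi> ?A x - birkhoff_sum \<phi> F x = birkhoff_sum \<phi> (?A - F) x - birkhoff_sum \<phi> (F - ?A) x"
  proof -
    have "birkhoff_sum \<phi> ?A x = birkhoff_sum \<phi> (?A - F) x + birkhoff_sum \<phi> (?A \<inter> F) x"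
      unfolding birkhoff_sum_def using sum.Int_Diff[of ?A "\<lambda>g. apply_bcontfun \<phi> (shift g x)" F] assms by simp
    moreover have "birkhoff_sum \<phi> F x = birkhoff_sum \<phi> (F - ?A) x + birkhoff_sum \<phi> (?A \<inter> F) x"
      unfolding birkhoff_sum_def using sum.Int_Diff[of F "\<lambda>g. apply_bcontfun \<phi> (shift g x)" ?A] assms by (simp add: Int_commute)
    ultimately show ?thesis by simp
  qed
  also have "\<bar>\<dots>\<bar> \<le> card (?A - F) * norm \<phi> + card (F - ?A) * norm \<phi>"
    using abs_birkhoff_sum[of \<phi> "?A - F" x] abs_birkhoff_sum[of \<phi> "F - ?A" x] by linarith
  also have "\<dots> = norm \<phi> * card (sym_diff ?A F)"
    using assms by (subst card_Un_disjoint) (auto simp: algebra_simps)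
  finally have "\<bar>birkhoff_sum \<phi> ?A x - birkhoff_sum \<phi> F x\<bar> \<le> norm \<phi> * card (sym_diff ?A F)" .
  moreover have "{k' + f | k' f. k' \<in> {k} \<and> f \<in> F} = ?A" by auto
  ultimately show ?thesis unfolding defect_def by (simp only:)
qed

text \<open>Shifting an empirical measure over \<open>F\<close> by \<open>k\<close> gives the one over \<open>k + F\<close>; along a Folner sequence the
  difference of the two integrals of a continuous function tends to 0. An accumulation point therefore
  gives every continuous function the same integral as its shift, which determines the measure.\<close>

theorem ex_invariant_measure_of_folner:
  fixes X :: "('g::{group_add,countable} \<Rightarrow> 'a::{finite,discrete_topology}) set" and x :: "nat \<Rightarrow> 'g \<Rightarrow> 'a"
  assumes X: "subshift X" and x: "\<And>n. x n \<in> X" and F: "folner_sequence F" "\<And>n. F n \<noteq> {}"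
  shows "\<exists>r \<nu>. strict_mono (r :: nat \<Rightarrow> nat) \<and> \<nu> \<in> invariant_measures X \<and>
    (\<forall>\<phi>. (\<lambda>n. birkhoff_sum \<phi> (F (r n)) (x (r n)) / card (F (r n))) \<longlonglongrightarrow> (\<integral>y. apply_bcontfun \<phi> y \<partial>\<nu>))"
proof -
  have fin: "finite (F n)" for n using F by (simp add: folner_sequence_def)
  obtain r \<nu> where r: "strict_mono (r :: nat \<Rightarrow> nat)" and \<nu>: "\<nu> \<in> prob_measures_on X"
    and lim: "\<And>\<phi>. (\<lambda>n. birkhoff_sum \<phi> (F (r n)) (x (r n)) / card (F (r n))) \<longlonglongrightarrow> (\<integral>y. apply_bcontfun \<phi> y \<partial>\<nu>)"
    using empirical_measures_accumulate[where x = x and F = F, OF X x fin F(2)] by auto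
  have "distr \<nu> \<nu> (shift k) = \<nu>" for k
  proof (rule prob_measure_eqI[OF compact_subshift[OF X]])
    interpret prob_space \<nu> by (rule prob_space_on[OF \<nu>])
    note m = measurable_shift[OF X \<nu>, of k]
    show "X \<noteq> {}" using x by blast
    show "distr \<nu> \<nu> (shift k) \<in> prob_measures_on X"
      unfolding distr_shift_on[OF \<nu>] using prob_space.emeasure_space_1[OF prob_space_distr[OF m]]
      by (simp add: prob_measures_on_def)
    show "\<nu> \<in> prob_measures_on X" by (rule \<nu>)
    fix \<phi> :: "('g \<Rightarrow> 'a) \<Rightarrow>\<^sub>C real"
    define \<psi> where "\<psi> = Bcontfun (\<lambda>y. apply_bcontfun \<phi> (shift k y))"
    have "continuous_on UNIV (\<lambda>y. apply_bcontfun \<phi> (shift k y))"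
      by (rule continuous_on_compose2[OF continuous_on_apply_bcontfun[of UNIV] continuous_on_shift]) auto
    then have \<psi>: "apply_bcontfun \<psi> = (\<lambda>y. apply_bcontfun \<phi> (shift k y))"
      unfolding \<psi>_def by (rule bcontfun_shift_space)
    have "(\<integral>y. apply_bcontfun \<phi> y \<partial>distr \<nu> \<nu> (shift k)) = (\<integral>y. apply_bcontfun \<psi> y \<partial>\<nu>)"
      unfolding distr_shift_on[OF \<nu>] \<psi>
      using measurable_bcontfun[OF \<nu>, of \<phi>] \<nu>
      by (intro integral_distr[OF m]) (simp add: prob_measures_on_def cong: measurable_cong_sets)
    also have "\<dots> = (\<integral>y. apply_bcontfun \<phi> y \<partial>\<nu>)"
    proof -
      let ?d = "\<lambda>n. birkhoff_sum \<psi> (F (r n)) (x (r n)) / card (F (r n)) - birkhoff_sum \<phi> (F (r n)) (x (r n)) / card (F (r n))"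
      have sh: "birkhoff_sum \<psi> A y = birkhoff_sum \<phi> ((+) k ` A) y" for A y
        unfolding birkhoff_sum_def \<psi> shift_shift by (subst sum.reindex) auto
      have "(\<lambda>n. defect {k} (F n) / card (F n)) \<longlonglongrightarrow> 0"
        using F(1) unfolding folner_sequence_def defect_def by blast
      then have "(\<lambda>n. norm \<phi> * (defect {k} (F (r n)) / card (F (r n)))) \<longlonglongrightarrow> norm \<phi> * 0"
        using LIMSEQ_subseq_LIMSEQ[OF _ r] by (intro tendsto_intros) (fastforce simp: comp_def)
      then have bound_lim: "(\<lambda>n. norm \<phi> * (defect {k} (F (r n)) / card (F (r n)))) \<longlonglongrightarrow> 0" by simp
      have bound: "norm (?d n) \<le> norm \<phi> * (defect {k} (F (r n)) / card (F (r n)))" for n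
      proof -
        have "norm (?d n) = \<bar>birkhoff_sum \<phi> ((+) k ` F (r n)) (x (r n)) - birkhoff_sum \<phi> (F (r n)) (x (r n))\<bar> / card (F (r n))"
          by (simp add: sh diff_divide_distrib[symmetric])
        also have "\<dots> \<le> norm \<phi> * defect {k} (F (r n)) / card (F (r n))"
          by (intro divide_right_mono birkhoff_sum_shift_diff fin) auto
        finally show ?thesis by simp
      qed
      have "?d \<longlonglongrightarrow> 0"
        by (rule Lim_null_comparison[OF always_eventually bound_lim]) (use bound in blast)
      moreover have "?d \<longlonglongrightarrow> (\<integral>y. apply_bcontfun \<psi> y \<partial>\<nu>) - (\<integral>y. apply_bcontfun \<phi> y \<partial>\<nu>)"
        by (intro tendsto_diff lim)
      ultimately show ?thesis using LIMSEQ_unique by fastforce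
    qed
    finally show "(\<integral>y. apply_bcontfun \<phi> y \<partial>distr \<nu> \<nu> (shift k)) = (\<integral>y. apply_bcontfun \<phi> y \<partial>\<nu>)" .
  qed
  then have "\<nu> \<in> invariant_measures X" using \<nu> by (simp add: invariant_measures_def prob_measures_on_def)
  with r lim show ?thesis by blast
qed

section \<open>Pressure and ground state energy\<close>

text \<open>By invariance the integral of \<open>\<phi>\<close> is the integral of its average over \<open>F\<close>, and the Birkhoff sum of a point
  of \<open>X\<close> is at most the exponent of the summand of the partition function to which it belongs.\<close>

lemma integral_invariant_le:
  fixes X :: "('g::{group_add,countable} \<Rightarrow> 'a::{finite,discrete_topology}) set"
  assumes X: "subshift X" and \<nu>: "\<nu> \<in> invariant_measures X" and F: "finite F" "F \<noteq> {}"
  shows "(\<integral>y. apply_bcontfun \<phi> y \<partial>\<nu>) \<le> ln (partition_function X F \<phi>) / card F"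
proof -
  have X0: "X \<noteq> {}" using X by (simp add: subshift_def)
  have p: "\<nu> \<in> prob_measures_on X" using \<nu> invariant_measures_subset by blast
  interpret prob_space \<nu> by (rule prob_space_on[OF p])
  have sh: "integrable \<nu> (\<lambda>y. apply_bcontfun \<phi> (shift g y))"
    "(\<integral>y. apply_bcontfun \<phi> (shift g y) \<partial>\<nu>) = (\<integral>y. apply_bcontfun \<phi> y \<partial>\<nu>)" for g
  proof -
    have s: "sets \<nu> = sets (restrict_space borel X)" using p by (simp add: prob_measures_on_def)
    have m: "shift g \<in> \<nu> \<rightarrow>\<^sub>M \<nu>" using measurable_shift[OF X p, of g] s by (simp cong: measurable_cong_sets)
    have d: "distr \<nu> \<nu> (shift g) = \<nu>" using \<nu> by (simp add: invariant_measures_def)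
    show "integrable \<nu> (\<lambda>y. apply_bcontfun \<phi> (shift g y))"
      using integrable_bcontfun[OF p, of \<phi>] integrable_distr[OF m, of "apply_bcontfun \<phi>"] by (simp add: d)
    show "(\<integral>y. apply_bcontfun \<phi> (shift g y) \<partial>\<nu>) = (\<integral>y. apply_bcontfun \<phi> y \<partial>\<nu>)"
      using integral_distr[OF m measurable_bcontfun[OF p], of \<phi>] by (simp add: d)
  qed
  have "card F * (\<integral>y. apply_bcontfun \<phi> y \<partial>\<nu>) = (\<integral>y. birkhoff_sum \<phi> F y \<partial>\<nu>)"
    unfolding birkhoff_sum_def by (subst Bochner_Integration.integral_sum) (simp_all add: sh)
  also have "\<dots> \<le> (\<integral>y. ln (partition_function X F \<phi>) \<partial>\<nu>)"
  proof (rule integral_mono)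
    show "integrable \<nu> (birkhoff_sum \<phi> F)" unfolding birkhoff_sum_def by (intro Bochner_Integration.integrable_sum sh)
    fix y assume "y \<in> space \<nu>"
    then show "birkhoff_sum \<phi> F y \<le> ln (partition_function X F \<phi>)"
      using ln_partition_function_ge[OF X0 F(1)] space_prob_measures_on[OF p] by blast
  qed simp
  also have "\<dots> = ln (partition_function X F \<phi>)" by (simp add: prob_space)
  finally show ?thesis using F by (simp add: field_simps card_gt_0_iff)
qed

text \<open>Only the first set of a Folner sequence can be empty.\<close>

lemma folner_tail:
  assumes "folner_sequence F"
  shows "folner_sequence (\<lambda>n. F (Suc n))" "F (Suc n) \<noteq> {}"
proof -
  have mono: "F n \<subseteq> F (Suc n)" for n using assms by (auto simp: folner_sequence_def)
  have "(\<Union>n. F (Suc n)) = (\<Union>n. F n)" using mono by blast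
  moreover have "(\<lambda>n. real (card (sym_diff {k + f | k f. k \<in> K \<and> f \<in> F (Suc n)} (F (Suc n)))) / real (card (F (Suc n)))) \<longlonglongrightarrow> 0"
    if "finite K" "K \<noteq> {}" for K
    using that assms LIMSEQ_Suc unfolding folner_sequence_def by fast
  ultimately show "folner_sequence (\<lambda>n. F (Suc n))"
    using assms by (simp add: folner_sequence_def)
  show "F (Suc n) \<noteq> {}" using assms by (auto simp: folner_sequence_def)
qed

context
  fixes X :: "('g::{group_add,countable} \<Rightarrow> 'a::{finite,discrete_topology}) set"
  assumes amenable: "\<exists>F :: nat \<Rightarrow> 'g set. folner_sequence F" and X: "subshift X"
begin

lemma bdd_above_energy:
  fixes \<phi> :: "('g \<Rightarrow> 'a) \<Rightarrow>\<^sub>C real"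
  shows "bdd_above ((\<lambda>\<nu>. \<integral>x. apply_bcontfun \<phi> x \<partial>\<nu>) ` invariant_measures X)"
proof (rule bdd_aboveI2)
  fix \<nu> assume "\<nu> \<in> invariant_measures X"
  from integral_invariant_le[OF X this, of "{0}" \<phi>]
  show "(\<integral>x. apply_bcontfun \<phi> x \<partial>\<nu>) \<le> ln (partition_function X {0} \<phi>)" by simp
qed

text \<open>The measure is an accumulation point of the empirical measures of points with maximal Birkhoff sums. The
  first term accounts for the number of patterns, which is at most \<open>|A|\<^sup>|\<^sup>F\<^sup>|\<close>.\<close>

lemma ex_maximising_measure:
  assumes c: "0 \<le> c"
  shows "\<exists>\<nu>\<in>invariant_measures X. pressure X (c *\<^sub>R \<phi>) \<le> ln (real CARD('a)) + c * (\<integral>x. apply_bcontfun \<phi> x \<partial>\<nu>)"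
proof -
  obtain F0 :: "nat \<Rightarrow> 'g set" where F0: "folner_sequence F0" using amenable by blast
  define F where "F n = F0 (Suc n)" for n
  have F: "folner_sequence F" "\<And>n. F n \<noteq> {}" using folner_tail[OF F0] by (auto simp: F_def[abs_def])
  have fin: "finite (F n)" for n using F by (simp add: folner_sequence_def)
  have X0: "X \<noteq> {}" using X by (simp add: subshift_def)
  have "\<exists>x\<in>X. \<forall>y\<in>X. birkhoff_sum \<phi> (F n) y \<le> birkhoff_sum \<phi> (F n) x" for n
  proof (rule continuous_attains_sup[OF compact_subshift[OF X] X0])
    show "continuous_on X (birkhoff_sum \<phi> (F n))"
      unfolding birkhoff_sum_def
      by (intro continuous_on_sum continuous_on_compose2[OF continuous_on_apply_bcontfun[of UNIV] continuous_on_shift]) auto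
  qed
  then obtain x where x: "\<And>n. x n \<in> X" "\<And>n y. y \<in> X \<Longrightarrow> birkhoff_sum \<phi> (F n) y \<le> birkhoff_sum \<phi> (F n) (x n)"
    by metis
  obtain r \<nu> where r: "strict_mono (r :: nat \<Rightarrow> nat)" and \<nu>: "\<nu> \<in> invariant_measures X"
    and lim: "\<And>\<phi>. (\<lambda>n. birkhoff_sum \<phi> (F (r n)) (x (r n)) / card (F (r n))) \<longlonglongrightarrow> (\<integral>y. apply_bcontfun \<phi> y \<partial>\<nu>)"
    using ex_invariant_measure_of_folner[where x = x, OF X x(1) F] by auto
  have "ln (partition_function X (F n) (c *\<^sub>R \<phi>)) / real (card (F n)) \<le>
      ln (real CARD('a)) + c * (birkhoff_sum \<phi> (F n) (x n) / card (F n))" for n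
  proof -
    have "ln (partition_function X (F n) (c *\<^sub>R \<phi>)) \<le> card (F n) * ln (real CARD('a)) + c * birkhoff_sum \<phi> (F n) (x n)"
    proof (rule ln_partition_function_le[OF X0 fin])
      fix y assume "y \<in> X"
      have "birkhoff_sum (c *\<^sub>R \<phi>) (F n) y = c * birkhoff_sum \<phi> (F n) y"
        by (simp add: birkhoff_sum_def scaleR_bcontfun.rep_eq sum_distrib_left)
      then show "birkhoff_sum (c *\<^sub>R \<phi>) (F n) y \<le> c * birkhoff_sum \<phi> (F n) (x n)"
        using x(2)[OF \<open>y \<in> X\<close>] c by (simp add: mult_left_mono)
    qed
    moreover have "0 < card (F n)" using fin F(2) by (simp add: card_gt_0_iff)
    ultimately show ?thesis by (simp add: field_simps)
  qed
  moreover have "(\<lambda>n. ln (partition_function X (F (r n)) (c *\<^sub>R \<phi>)) / real (card (F (r n)))) \<longlonglongrightarrow> pressure X (c *\<^sub>R \<phi>)"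
    using LIMSEQ_subseq_LIMSEQ[OF pressure_limit[OF X amenable F(1)] r] by (simp add: comp_def)
  moreover have "(\<lambda>n. ln (real CARD('a)) + c * (birkhoff_sum \<phi> (F (r n)) (x (r n)) / card (F (r n)))) \<longlonglongrightarrow>
      ln (real CARD('a)) + c * (\<integral>y. apply_bcontfun \<phi> y \<partial>\<nu>)"
    by (intro tendsto_intros lim)
  ultimately have "pressure X (c *\<^sub>R \<phi>) \<le> ln (real CARD('a)) + c * (\<integral>y. apply_bcontfun \<phi> y \<partial>\<nu>)"
    by (intro LIMSEQ_le) auto
  with \<nu> show ?thesis by blast
qed

lemma ground_state_energy_le_pressure:
  assumes c: "0 < c"
  shows "ground_state_energy X \<phi> \<le> pressure X (c *\<^sub>R \<phi>) / c"
  unfolding ground_state_energy_def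
proof (rule cSUP_least)
  show "invariant_measures X \<noteq> {}" using ex_maximising_measure[of 0] by auto
  fix \<nu> assume \<nu>: "\<nu> \<in> invariant_measures X"
  obtain F :: "nat \<Rightarrow> 'g set" where F: "folner_sequence F" using amenable by blast
  note F' = folner_tail[OF F]
  have "c * (\<integral>x. apply_bcontfun \<phi> x \<partial>\<nu>) \<le> pressure X (c *\<^sub>R \<phi>)"
  proof (rule LIMSEQ_le_const[OF pressure_limit[OF X amenable F'(1)]], intro exI allI impI)
    fix n
    have "c * (\<integral>x. apply_bcontfun \<phi> x \<partial>\<nu>) = (\<integral>x. apply_bcontfun (c *\<^sub>R \<phi>) x \<partial>\<nu>)"
      by (simp add: scaleR_bcontfun.rep_eq)
    also have "\<dots> \<le> ln (partition_function X (F (Suc n)) (c *\<^sub>R \<phi>)) / real (card (F (Suc n)))"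
      by (rule integral_invariant_le[OF X \<nu> _ F'(2)]) (use F in \<open>simp add: folner_sequence_def\<close>)
    finally show "c * (\<integral>x. apply_bcontfun \<phi> x \<partial>\<nu>) \<le> ln (partition_function X (F (Suc n)) (c *\<^sub>R \<phi>)) / real (card (F (Suc n)))" .
  qed
  then show "(\<integral>x. apply_bcontfun \<phi> x \<partial>\<nu>) \<le> pressure X (c *\<^sub>R \<phi>) / c" using c by (simp add: field_simps)
qed

lemma pressure_le_ground_state_energy:
  assumes "0 \<le> c"
  shows "pressure X (c *\<^sub>R \<phi>) \<le> ln (real CARD('a)) + c * ground_state_energy X \<phi>"
proof -
  obtain \<nu> where \<nu>: "\<nu> \<in> invariant_measures X"
    "pressure X (c *\<^sub>R \<phi>) \<le> ln (real CARD('a)) + c * (\<integral>x. apply_bcontfun \<phi> x \<partial>\<nu>)"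
    using ex_maximising_measure[OF assms] by blast
  have "(\<integral>x. apply_bcontfun \<phi> x \<partial>\<nu>) \<le> ground_state_energy X \<phi>"
    unfolding ground_state_energy_def by (rule cSUP_upper[OF \<nu>(1) bdd_above_energy])
  then have "c * (\<integral>x. apply_bcontfun \<phi> x \<partial>\<nu>) \<le> c * ground_state_energy X \<phi>" by (rule mult_left_mono[OF _ assms])
  with \<nu>(2) show ?thesis by linarith
qed

theorem pressure_rescaled_limit:
  "(\<lambda>k. pressure X (real (Suc k) *\<^sub>R \<phi>) / real (Suc k)) \<longlonglongrightarrow> ground_state_energy X \<phi>"
proof (rule tendsto_sandwich)
  show "\<forall>\<^sub>F k in sequentially. ground_state_energy X \<phi> \<le> pressure X (real (Suc k) *\<^sub>R \<phi>) / real (Suc k)"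
    by (intro always_eventually allI ground_state_energy_le_pressure) simp
  show "\<forall>\<^sub>F k in sequentially. pressure X (real (Suc k) *\<^sub>R \<phi>) / real (Suc k) \<le>
      ln (real CARD('a)) / real (Suc k) + ground_state_energy X \<phi>"
  proof (intro always_eventually allI)
    fix k
    show "pressure X (real (Suc k) *\<^sub>R \<phi>) / real (Suc k) \<le> ln (real CARD('a)) / real (Suc k) + ground_state_energy X \<phi>"
      using pressure_le_ground_state_energy[of "real (Suc k)" \<phi>] by (simp add: field_simps del: of_nat_Suc)
  qed
  have "(\<lambda>k. ln (real CARD('a)) * inverse (real (Suc k)) + ground_state_energy X \<phi>) \<longlonglongrightarrow> ln (real CARD('a)) * 0 + ground_state_energy X \<phi>"
    by (intro tendsto_intros LIMSEQ_inverse_real_of_nat)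
  then show "(\<lambda>k. ln (real CARD('a)) / real (Suc k) + ground_state_energy X \<phi>) \<longlonglongrightarrow> ground_state_energy X \<phi>"
    by (simp add: divide_inverse)
qed simp

end

section \<open>Register programs and their execution on oracle machines\<close>

text \<open>\<open>While r p\<close> and \<open>Cond r p q\<close> test register \<open>r\<close> and decrement it when it is positive, before they run \<open>p\<close>. Test
  and decrement together are then a single step of a machine, and no separate decrement is needed. \<open>Put\<close> names
  the second of the two machine steps of \<open>Inc\<close> and has no execution rule.\<close>

datatype prog =
    Skip
  | Inc nat
  | Put nat
  | Seq prog prog
  | While nat prog
  | Cond nat prog prog
  | Query

inductive exec :: "(nat \<Rightarrow> nat) \<Rightarrow> prog \<Rightarrow> (nat \<Rightarrow> nat) \<Rightarrow> (nat \<Rightarrow> nat) \<Rightarrow> bool" for \<gamma> where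
  Skip: "exec \<gamma> Skip \<sigma> \<sigma>"
| Inc: "exec \<gamma> (Inc r) \<sigma> (\<sigma>(r := Suc (\<sigma> r)))"
| Seq: "exec \<gamma> p \<sigma> \<sigma>' \<Longrightarrow> exec \<gamma> q \<sigma>' \<sigma>'' \<Longrightarrow> exec \<gamma> (Seq p q) \<sigma> \<sigma>''"
| While_0: "\<sigma> r = 0 \<Longrightarrow> exec \<gamma> (While r p) \<sigma> \<sigma>"
| While_Suc: "\<sigma> r = Suc n \<Longrightarrow> exec \<gamma> p (\<sigma>(r := n)) \<sigma>' \<Longrightarrow> exec \<gamma> (While r p) \<sigma>' \<sigma>'' \<Longrightarrow>
    exec \<gamma> (While r p) \<sigma> \<sigma>''"
| Cond_0: "\<sigma> r = 0 \<Longrightarrow> exec \<gamma> q \<sigma> \<sigma>' \<Longrightarrow> exec \<gamma> (Cond r p q) \<sigma> \<sigma>'"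
| Cond_Suc: "\<sigma> r = Suc n \<Longrightarrow> exec \<gamma> p (\<sigma>(r := n)) \<sigma>' \<Longrightarrow> exec \<gamma> (Cond r p q) \<sigma> \<sigma>'"
| Query: "exec \<gamma> Query \<sigma> (\<sigma>(1 := \<gamma> (\<sigma> 1)))"

fun regs :: "prog \<Rightarrow> nat set" where
  "regs (Inc r) = {r}"
| "regs (Put r) = {r}"
| "regs (Seq p q) = regs p \<union> regs q"
| "regs (While r p) = insert r (regs p)"
| "regs (Cond r p q) = insert r (regs p \<union> regs q)"
| "regs _ = {}"

lemma finite_regs: "finite (regs p)"
  by (induction p) auto

text \<open>The stacks of pending programs that can occur between the moment \<open>p\<close> is about to run with \<open>ks\<close> pending
  and the moment \<open>ks\<close> itself is reached. There are finitely many of them, so they can serve as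
  the states of a machine and no addresses have to be assigned to instructions.\<close>

fun conts :: "prog \<Rightarrow> prog list \<Rightarrow> prog list set" where
  "conts (Inc r) ks = {Inc r # ks, Put r # ks}"
| "conts (Seq p q) ks = insert (Seq p q # ks) (conts p (q # ks) \<union> conts q ks)"
| "conts (While r p) ks = insert (While r p # ks) (conts p (While r p # ks))"
| "conts (Cond r p q) ks = insert (Cond r p q # ks) (conts p ks \<union> conts q ks)"
| "conts p ks = {p # ks}"

lemma finite_conts: "finite (conts p ks)"
  by (induction p ks rule: conts.induct) auto

lemma conts_self: "p # ks \<in> conts p ks"
  by (cases p) auto

definition stay :: "nat list \<Rightarrow> (nat \<times> move) list" where
  "stay rs = map (\<lambda>c. (c, Stay)) rs"

text \<open>Register \<open>r\<close> is kept on tape \<open>r\<close>. Tape \<open>N\<close> carries the return address of a query, as a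
  symbol: a machine has only one answer state, from which it has to find the place to
  continue. The guard in \<open>goto\<close> and the reduction modulo \<open>max 2 c\<close> make the machine well-formed
  for every numbering and every register index.\<close>

definition stack_action ::
    "nat \<Rightarrow> (prog list \<Rightarrow> nat) \<Rightarrow> nat \<Rightarrow> prog list \<Rightarrow> nat list \<Rightarrow> nat \<times> (nat \<times> move) list" where
  "stack_action N num c k rs =
    (let goto = (\<lambda>ks. if num ks < c then num ks else 0) in
     case k of
       [] \<Rightarrow> (0, stay rs)
     | Skip # ks \<Rightarrow> (goto ks, stay rs)
     | Inc r # ks \<Rightarrow> (goto (Put r # ks), (stay rs)[r := (rs ! r mod max 2 c, Left)])
     | Put r # ks \<Rightarrow> (goto ks, (stay rs)[r := (1, Stay)])
     | Seq p q # ks \<Rightarrow> (goto (p # q # ks), stay rs)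
     | While r p # ks \<Rightarrow>
         if rs ! r = 1 then (goto (p # While r p # ks), (stay rs)[r := (0, Right)])
         else (goto ks, stay rs)
     | Cond r p q # ks \<Rightarrow>
         if rs ! r = 1 then (goto (p # ks), (stay rs)[r := (0, Right)])
         else (goto (q # ks), stay rs)
     | Query # ks \<Rightarrow> (c, (stay rs)[N := (goto ks, Stay)]))"

text \<open>States below \<open>c\<close> are numbers of stacks, \<open>c\<close> is the query state and \<open>c + 1\<close> the answer state.\<close>

definition compiled :: "nat \<Rightarrow> (prog list \<Rightarrow> nat) \<Rightarrow> (nat \<Rightarrow> prog list) \<Rightarrow> nat \<Rightarrow> nat \<Rightarrow> otm" where
  "compiled N num dec c q0 =
    \<lparr>tapes = Suc N, symbols = max 2 c, states = c + 2, start = q0, halt = num [], query = c, answer = c + 1,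
     delta = (\<lambda>q rs.
       if q = c + 1 then (if rs ! N < c then rs ! N else 0, stay rs)
       else stack_action N num c (dec q) rs)\<rparr>"

lemma fst_set_stay_update:
  assumes "set rs \<subseteq> {..<m}" "fst a < m"
  shows "fst ` set ((stay rs)[r := a]) \<subseteq> {..<m}"
  using assms set_update_subset_insert[of "stay rs" r a] by (fastforce simp: stay_def)

lemma wf_compiled:
  assumes "2 \<le> Suc N" "num [] < c" "q0 < c"
  shows "wf_otm (compiled N num dec c q0)"
proof -
  let ?M = "compiled N num dec c q0"
  have L: "length (stay rs) = length rs" for rs by (simp add: stay_def)
  have *: "fst ` set (stay rs) \<subseteq> {..<max 2 c}" if "set rs \<subseteq> {..<max 2 c}" for rs
    using that by (fastforce simp: stay_def)
  have "fst (delta ?M q rs) < c + 2 \<and> length (snd (delta ?M q rs)) = Suc N \<and>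
      fst ` set (snd (delta ?M q rs)) \<subseteq> {..<max 2 c}"
    if rs: "length rs = Suc N" "set rs \<subseteq> {..<max 2 c}" for q rs
  proof (cases "q = c + 1")
    case True
    with rs *[OF rs(2)] show ?thesis by (simp add: compiled_def L)
  next
    case False
    show ?thesis
    proof (cases "dec q")
      case Nil
      with False rs *[OF rs(2)] show ?thesis by (simp add: compiled_def stack_action_def L)
    next
      case (Cons p ks)
      have upd: "fst ` set ((stay rs)[r := a]) \<subseteq> {..<max 2 c}" if "fst a < max 2 c" for r a
        by (rule fst_set_stay_update[OF rs(2) that])
      show ?thesis
        using False Cons rs(1) *[OF rs(2)] assms
        by (cases p) (simp_all add: compiled_def stack_action_def Let_def L upd)
    qed
  qed
  then show ?thesis
    using assms unfolding wf_otm_def by (auto simp: compiled_def Let_def simp del: image_subset_iff)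
qed

text \<open>The number is a block of ones with the head on its leftmost cell, or on a blank if the number is 0.
  The block may start anywhere, so that both changes of the number happen at its left end: a decrement erases the
  leftmost one, an increment prepends one. The answer to a query has this form.\<close>

definition holds :: "nat \<Rightarrow> tape \<Rightarrow> bool" where
  "holds n t \<longleftrightarrow> (\<exists>p. t = ((\<lambda>i. if p \<le> i \<and> i < p + int n then 1 else 0), p))"

lemma holds_unary: "holds n (unary n)"
  by (auto simp: holds_def unary_def)

lemma tape_number_holds:
  assumes "holds n t" shows "tape_number t = n"
proof -
  from assms obtain p where t: "t = ((\<lambda>i. if p \<le> i \<and> i < p + int n then 1 else 0), p)"
    by (auto simp: holds_def)
  then have "{i. fst t i = 1} = {p..<p + int n}" by auto
  then show ?thesis by (simp add: tape_number_def)
qed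

lemma holds_read: "holds n t \<Longrightarrow> read_tape t = (if n = 0 then 0 else 1)"
  by (auto simp: holds_def read_tape_def)

lemma holds_dec:
  assumes "holds (Suc n) t" shows "holds n (act (0, Right) t)"
proof -
  from assms obtain p where "t = ((\<lambda>i. if p \<le> i \<and> i < p + int (Suc n) then 1 else 0), p)"
    by (auto simp: holds_def)
  then have "act (0, Right) t = ((\<lambda>i. if p + 1 \<le> i \<and> i < (p + 1) + int n then 1 else 0), p + 1)"
    by (auto simp: fun_eq_iff)
  then show ?thesis unfolding holds_def by blast
qed

lemma holds_inc:
  assumes "holds n t" shows "holds (Suc n) (act (1, Stay) (act (read_tape t, Left) t))"
proof -
  from assms obtain p where "t = ((\<lambda>i. if p \<le> i \<and> i < p + int n then 1 else 0), p)"
    by (auto simp: holds_def)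
  then have "act (1, Stay) (act (read_tape t, Left) t) =
      ((\<lambda>i. if p - 1 \<le> i \<and> i < (p - 1) + int (Suc n) then 1 else 0), p - 1)"
    by (auto simp: fun_eq_iff read_tape_def)
  then show ?thesis unfolding holds_def by blast
qed

lemma act_read: "act (read_tape t, Stay) t = t"
  by (cases t) (auto simp: read_tape_def)

lemma map2_act_stay: "map2 act (stay (map read_tape ts)) ts = ts"
  by (rule nth_equalityI) (auto simp: stay_def act_read)

lemma map2_act_stay_update:
  "r < length ts \<Longrightarrow> map2 act ((stay (map read_tape ts))[r := a]) ts = ts[r := act a (ts ! r)]"
  by (rule nth_equalityI) (auto simp: stay_def act_read nth_list_update)

declare otm_step.simps [simp del]

text \<open>A set \<open>S\<close> of stacks is numbered by \<open>num\<close>, with inverse \<open>dec\<close>; \<open>N\<close> bounds the registers in use.\<close>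

locale compile =
  fixes N :: nat and num :: "prog list \<Rightarrow> nat" and dec c q0 and S :: "prog list set"
    and \<gamma> :: "nat \<Rightarrow> nat" and M
  assumes N: "2 \<le> N"
    and num: "\<And>k. k \<in> S \<Longrightarrow> num k < c \<and> dec (num k) = k"
    and nil: "[] \<in> S"
    and M: "M = compiled N num dec c q0"
begin

definition reach where "reach a b \<longleftrightarrow> (\<exists>t. (otm_step M \<gamma> ^^ t) a = b)"

lemma reach_refl: "reach a a"
  unfolding reach_def by (rule exI[of _ 0]) simp

lemma reach_trans:
  assumes "reach a b" "reach b d" shows "reach a d"
proof -
  obtain t u where "(otm_step M \<gamma> ^^ t) a = b" "(otm_step M \<gamma> ^^ u) b = d"
    using assms by (auto simp: reach_def)
  then have "(otm_step M \<gamma> ^^ (u + t)) a = d" by (simp add: funpow_add)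
  then show ?thesis unfolding reach_def by blast
qed

lemma reach_step:
  assumes "otm_step M \<gamma> a = a'" "reach a' b" shows "reach a b"
proof -
  obtain t where "(otm_step M \<gamma> ^^ t) a' = b" using assms(2) by (auto simp: reach_def)
  then have "(otm_step M \<gamma> ^^ Suc t) a = b" using assms(1) by (simp add: funpow_swap1)
  then show ?thesis unfolding reach_def by blast
qed

definition rep where "rep \<sigma> ts \<longleftrightarrow> length ts = Suc N \<and> (\<forall>r<N. holds (\<sigma> r) (ts ! r))"

lemma num_eq_iff: "k \<in> S \<Longrightarrow> num k = num [] \<longleftrightarrow> k = []"
  using num nil by metis

lemma step_num:
  assumes "k \<in> S" "k \<noteq> []"
  shows "otm_step M \<gamma> (num k, ts) =
    (let (q', as) = delta M (num k) (map read_tape ts) in (q', map2 act as ts))"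
  using assms num[of k] num_eq_iff[of k] by (simp add: M compiled_def Let_def otm_step.simps)

lemma delta_num: "k \<in> S \<Longrightarrow> delta M (num k) rs = stack_action N num c k rs"
  using num[of k] by (simp add: M compiled_def)

lemma rep_update: "rep \<sigma> ts \<Longrightarrow> r < N \<Longrightarrow> holds n t \<Longrightarrow> rep (\<sigma>(r := n)) (ts[r := t])"
  by (auto simp: rep_def nth_list_update)

lemma rep_len: "rep \<sigma> ts \<Longrightarrow> length ts = Suc N" by (simp add: rep_def)
lemma rep_nth: "rep \<sigma> ts \<Longrightarrow> r < N \<Longrightarrow> holds (\<sigma> r) (ts ! r)" by (simp add: rep_def)

text \<open>By induction on the execution of \<open>p\<close>, for an arbitrary stack \<open>ks\<close> of pending programs: the sequential
  composition and the loop need the statement for longer stacks.\<close>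

lemma reach_exec:
  assumes "exec \<gamma> p \<sigma> \<sigma>'" "regs p \<subseteq> {..<N}" "conts p ks \<subseteq> S" "ks \<in> S" "rep \<sigma> ts"
  shows "\<exists>ts'. rep \<sigma>' ts' \<and> reach (num (p # ks), ts) (num ks, ts')"
  using assms
proof (induction arbitrary: ks ts rule: exec.induct)
  case (Skip \<sigma>)
  then have "otm_step M \<gamma> (num (Skip # ks), ts) = (num ks, ts)"
    by (simp add: step_num delta_num stack_action_def num map2_act_stay)
  from reach_step[OF this reach_refl] Skip.prems show ?case by blast
next
  case (Inc r \<sigma>)
  note h = rep_nth[OF \<open>rep \<sigma> ts\<close>, of r] and len = rep_len[OF \<open>rep \<sigma> ts\<close>]
  have r: "r < N" using Inc by simp
  have rd: "read_tape (ts ! r) < 2" using holds_read[OF h[OF r]] by simp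
  have 1: "otm_step M \<gamma> (num (Inc r # ks), ts) =
    (num (Put r # ks), ts[r := act (read_tape (ts ! r), Left) (ts ! r)])" (is "_ = (_, ?t)")
    using Inc r rd len by (simp add: step_num delta_num stack_action_def num map2_act_stay_update)
  have 2: "otm_step M \<gamma> (num (Put r # ks), ?t) =
    (num ks, ts[r := act (1, Stay) (act (read_tape (ts ! r), Left) (ts ! r))])"
    using Inc r len by (simp add: step_num delta_num stack_action_def num map2_act_stay_update)
  show ?case using rep_update[OF \<open>rep \<sigma> ts\<close> r holds_inc[OF h[OF r]]]
      reach_step[OF 1 reach_step[OF 2 reach_refl]] by blast
next
  case (Seq p \<sigma> \<sigma>' q \<sigma>'')
  have S: "q # ks \<in> S" using Seq.prems conts_self[of q ks] by auto
  have S': "p # q # ks \<in> S" using Seq.prems conts_self[of p "q # ks"] by auto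
  have 1: "otm_step M \<gamma> (num (Seq p q # ks), ts) = (num (p # q # ks), ts)"
    using Seq.prems S' by (simp add: step_num delta_num stack_action_def num map2_act_stay)
  obtain ts' where 2: "rep \<sigma>' ts'" "reach (num (p # q # ks), ts) (num (q # ks), ts')"
    using Seq.IH(1)[of "q # ks" ts] Seq.prems S by auto
  then obtain ts'' where 3: "rep \<sigma>'' ts''" "reach (num (q # ks), ts') (num ks, ts'')"
    using Seq.IH(2)[of ks ts'] Seq.prems by auto
  show ?case using 3(1) reach_step[OF 1 reach_trans[OF 2(2) 3(2)]] by blast
next
  case (While_0 \<sigma> r p)
  have r: "r < N" using While_0 by simp
  note h = rep_nth[OF \<open>rep \<sigma> ts\<close> r] and len = rep_len[OF \<open>rep \<sigma> ts\<close>]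
  have "otm_step M \<gamma> (num (While r p # ks), ts) = (num ks, ts)"
    using While_0 r len holds_read[OF h] by (simp add: step_num delta_num stack_action_def num map2_act_stay)
  from reach_step[OF this reach_refl] While_0.prems show ?case by blast
next
  case (While_Suc \<sigma> r n p \<sigma>' \<sigma>'')
  have r: "r < N" using While_Suc by simp
  note h = rep_nth[OF \<open>rep \<sigma> ts\<close> r] and len = rep_len[OF \<open>rep \<sigma> ts\<close>]
  let ?ks = "While r p # ks" and ?ts = "ts[r := act (0, Right) (ts ! r)]"
  have S: "?ks \<in> S" using While_Suc.prems by auto
  have S': "p # ?ks \<in> S" using While_Suc.prems conts_self[of p ?ks] by auto
  have 1: "otm_step M \<gamma> (num ?ks, ts) = (num (p # ?ks), ?ts)"
    using While_Suc.prems While_Suc.hyps r len holds_read[OF h] S S'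
    by (simp add: step_num delta_num stack_action_def num map2_act_stay_update)
  have "rep (\<sigma>(r := n)) ?ts"
    using rep_update[OF \<open>rep \<sigma> ts\<close> r holds_dec] h While_Suc.hyps by simp
  from While_Suc.IH(1)[OF _ _ S this] obtain ts'
    where 2: "rep \<sigma>' ts'" "reach (num (p # ?ks), ?ts) (num ?ks, ts')"
    using While_Suc.prems by auto
  from While_Suc.IH(2)[OF While_Suc.prems(1-3) 2(1)] obtain ts''
    where 3: "rep \<sigma>'' ts''" "reach (num ?ks, ts') (num ks, ts'')" by blast
  show ?case using 3(1) reach_step[OF 1 reach_trans[OF 2(2) 3(2)]] by blast
next
  case (Cond_0 \<sigma> r q \<sigma>' p)
  have r: "r < N" using Cond_0 by simp
  note h = rep_nth[OF \<open>rep \<sigma> ts\<close> r] and len = rep_len[OF \<open>rep \<sigma> ts\<close>]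
  have S: "q # ks \<in> S" using Cond_0.prems conts_self[of q ks] by auto
  have 1: "otm_step M \<gamma> (num (Cond r p q # ks), ts) = (num (q # ks), ts)"
    using Cond_0.prems Cond_0.hyps S r len holds_read[OF h]
    by (simp add: step_num delta_num stack_action_def num map2_act_stay)
  obtain ts' where 2: "rep \<sigma>' ts'" "reach (num (q # ks), ts) (num ks, ts')"
    using Cond_0.IH[of ks ts] Cond_0.prems by auto
  show ?case using 2(1) reach_step[OF 1 2(2)] by blast
next
  case (Cond_Suc \<sigma> r n p \<sigma>' q)
  have r: "r < N" using Cond_Suc by simp
  note h = rep_nth[OF \<open>rep \<sigma> ts\<close> r] and len = rep_len[OF \<open>rep \<sigma> ts\<close>]
  let ?ts = "ts[r := act (0, Right) (ts ! r)]"
  have S: "p # ks \<in> S" using Cond_Suc.prems conts_self[of p ks] by auto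
  have 1: "otm_step M \<gamma> (num (Cond r p q # ks), ts) = (num (p # ks), ?ts)"
    using Cond_Suc.prems Cond_Suc.hyps S r len holds_read[OF h]
    by (simp add: step_num delta_num stack_action_def num map2_act_stay_update)
  have "rep (\<sigma>(r := n)) ?ts"
    using rep_update[OF \<open>rep \<sigma> ts\<close> r holds_dec] h Cond_Suc.hyps by simp
  from Cond_Suc.IH[OF _ _ Cond_Suc.prems(3) this] obtain ts'
    where 2: "rep \<sigma>' ts'" "reach (num (p # ks), ?ts) (num ks, ts')"
    using Cond_Suc.prems by auto
  show ?case using 2(1) reach_step[OF 1 2(2)] by blast
next
  case (Query \<sigma>)
  note len = rep_len[OF \<open>rep \<sigma> ts\<close>]
  have c: "num [] < c" "num ks < c" using num nil Query by auto
  let ?ts = "ts[N := act (num ks, Stay) (ts ! N)]"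
  let ?ts' = "?ts[1 := unary (\<gamma> (\<sigma> 1))]"
  have 1: "otm_step M \<gamma> (num (Query # ks), ts) = (c, ?ts)"
    using Query len c by (simp add: step_num delta_num stack_action_def num map2_act_stay_update)
  have "tape_number (?ts ! 1) = \<sigma> 1"
    using tape_number_holds[OF rep_nth[OF \<open>rep \<sigma> ts\<close>, of 1]] N by simp
  then have 2: "otm_step M \<gamma> (c, ?ts) = (c + 1, ?ts')"
    using c by (simp add: M compiled_def Let_def otm_step.simps)
  have "read_tape (?ts' ! N) = num ks"
    using N len by (cases "ts ! N") (simp add: read_tape_def)
  then have 3: "otm_step M \<gamma> (c + 1, ?ts') = (num ks, ?ts')"
    using c len map2_act_stay[of ?ts'] by (simp add: M compiled_def Let_def otm_step.simps)
  have "rep (\<sigma>(1 := \<gamma> (\<sigma> 1))) ?ts'"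
  proof (rule rep_update)
    show "rep \<sigma> ?ts" using Query by (auto simp: rep_def)
  qed (use N in \<open>auto simp: holds_unary\<close>)
  then show ?case using reach_step[OF 1 reach_step[OF 2 reach_step[OF 3 reach_refl]]] by blast
qed

end

text \<open>Number the stacks that \<open>p\<close> can give rise to and take a tape for each register of \<open>p\<close>.\<close>

theorem exec_imp_otm:
  fixes f :: "(nat \<Rightarrow> nat) \<Rightarrow> nat \<Rightarrow> nat"
  assumes "\<And>\<gamma> n. \<gamma> \<in> A \<Longrightarrow> \<exists>\<sigma>. exec \<gamma> p ((\<lambda>_. 0)(0 := n)) \<sigma> \<and> \<sigma> 0 = f \<gamma> n"
  shows "\<exists>M. wf_otm M \<and> (\<forall>\<gamma>\<in>A. \<forall>n. otm_outputs M \<gamma> n (f \<gamma> n))"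
proof -
  define S where "S = insert [] (conts p [])"
  have fin: "finite S" by (simp add: S_def finite_conts)
  obtain num where bij: "bij_betw num S {0..<card S}"
    using ex_bij_betw_finite_nat[OF fin] by auto
  obtain m where m: "\<And>r. r \<in> regs p \<Longrightarrow> r \<le> m"
    using finite_regs[of p] finite_nat_set_iff_bounded_le by auto
  define N where "N = m + 2"
  define M where "M = compiled N num (inv_into S num) (card S) (num [p])"
  have S: "[] \<in> S" "[p] \<in> S" using conts_self[of p "[]"] by (auto simp: S_def)
  have num: "num k < card S \<and> inv_into S num (num k) = k" if "k \<in> S" for k
    using bij that by (auto simp: bij_betw_def inv_into_f_f)
  have "otm_outputs M \<gamma> n (f \<gamma> n)" if \<gamma>: "\<gamma> \<in> A" for \<gamma> n
  proof -
    interpret compile N num "inv_into S num" "card S" "num [p]" S \<gamma> M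
      by unfold_locales (use num S in \<open>auto simp: N_def M_def\<close>)
    obtain \<sigma> where \<sigma>: "exec \<gamma> p ((\<lambda>_. 0)(0 := n)) \<sigma>" "\<sigma> 0 = f \<gamma> n"
      using assms[OF \<gamma>] by blast
    have "rep ((\<lambda>_. 0)(0 := n)) (unary n # replicate N (unary 0))"
      by (auto simp: rep_def nth_Cons holds_unary split: nat.splits)
    moreover have "regs p \<subseteq> {..<N}" using m by (force simp: N_def)
    moreover have "conts p [] \<subseteq> S" by (auto simp: S_def)
    ultimately obtain ts where ts: "rep \<sigma> ts"
      "reach (num [p], unary n # replicate N (unary 0)) (num [], ts)"
      using reach_exec[OF \<sigma>(1), of "[]"] S by blast
    have "tape_number (ts ! 0) = f \<gamma> n"
      using tape_number_holds[OF rep_nth[OF ts(1), of 0]] \<sigma>(2) by (simp add: N_def)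
    with ts(2) show ?thesis
      unfolding otm_outputs_def otm_init_def reach_def
      by (auto simp: M_def compiled_def Let_def)
  qed
  moreover have "wf_otm M"
    unfolding M_def by (rule wf_compiled) (use num S in \<open>auto simp: N_def\<close>)
  ultimately show ?thesis by blast
qed

section \<open>Functionals computed by register programs\<close>

lemma exec_eq: "exec \<gamma> p \<sigma> \<sigma>' \<Longrightarrow> \<sigma>' = \<tau> \<Longrightarrow> exec \<gamma> p \<sigma> \<tau>"
  by simp

text \<open>The states of a loop that counts \<open>r\<close> down are given as a function of the current value of \<open>r\<close>.\<close>

lemma exec_While_down:
  assumes "\<And>i. f i r = i" and "\<And>i. i < n \<Longrightarrow> exec \<gamma> p ((f (Suc i))(r := i)) (f i)"
  shows "exec \<gamma> (While r p) (f n) (f 0)"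
  using assms(2)
proof (induction n)
  case 0
  show ?case using assms(1) by (intro exec.While_0) simp
next
  case (Suc n)
  show ?case
  proof (rule exec.While_Suc[where n = n and \<sigma>' = "f n"])
    show "exec \<gamma> p ((f (Suc n))(r := n)) (f n)" using Suc.prems by blast
    show "exec \<gamma> (While r p) (f n) (f 0)" using Suc.IH Suc.prems less_SucI by blast
  qed (rule assms(1))
qed

definition clear :: "nat \<Rightarrow> prog" where "clear r = While r Skip"
definition move_to :: "nat \<Rightarrow> nat \<Rightarrow> prog" where "move_to r s = While r (Inc s)"
definition copy_to :: "nat \<Rightarrow> nat \<Rightarrow> nat \<Rightarrow> prog" where
  "copy_to r s t = Seq (While r (Seq (Inc s) (Inc t))) (move_to t r)"

lemma exec_clear: "exec \<gamma> (clear r) \<sigma> (\<sigma>(r := 0))"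
proof -
  have "exec \<gamma> (While r Skip) (\<sigma>(r := \<sigma> r)) (\<sigma>(r := 0))"
    by (rule exec_While_down[where f = "\<lambda>i. \<sigma>(r := i)"]) (auto intro: exec_eq[OF exec.Skip])
  then show ?thesis by (simp add: clear_def)
qed

lemma exec_move_to:
  assumes "r \<noteq> s"
  shows "exec \<gamma> (move_to r s) \<sigma> (\<sigma>(r := 0, s := \<sigma> s + \<sigma> r))"
proof -
  have "exec \<gamma> (While r (Inc s)) (\<sigma>(r := \<sigma> r, s := \<sigma> s + \<sigma> r - \<sigma> r)) (\<sigma>(r := 0, s := \<sigma> s + \<sigma> r - 0))"
    by (rule exec_While_down[where f = "\<lambda>i. \<sigma>(r := i, s := \<sigma> s + \<sigma> r - i)"])
      (use assms in \<open>auto intro!: exec_eq[OF exec.Inc] ext\<close>)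
  then show ?thesis by (simp add: move_to_def)
qed

lemma exec_copy_to:
  assumes "r \<noteq> s" "r \<noteq> t" "s \<noteq> t" "\<sigma> t = 0"
  shows "exec \<gamma> (copy_to r s t) \<sigma> (\<sigma>(s := \<sigma> s + \<sigma> r))"
  unfolding copy_to_def
proof (rule exec.Seq)
  let ?f = "\<lambda>i. \<sigma>(r := i, s := \<sigma> s + \<sigma> r - i, t := \<sigma> r - i)"
  have "exec \<gamma> (While r (Seq (Inc s) (Inc t))) (?f (\<sigma> r)) (?f 0)"
  proof (rule exec_While_down[where f = ?f])
    fix i assume "i < \<sigma> r"
    then show "exec \<gamma> (Seq (Inc s) (Inc t)) ((?f (Suc i))(r := i)) (?f i)"
      by (intro exec.Seq[OF exec.Inc] exec_eq[OF exec.Inc] ext) (use assms in auto)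
  qed (use assms in auto)
  moreover have "?f (\<sigma> r) = \<sigma>" using assms by auto
  ultimately show "exec \<gamma> (While r (Seq (Inc s) (Inc t))) \<sigma> (?f 0)" by simp
  show "exec \<gamma> (move_to t r) (?f 0) (\<sigma>(s := \<sigma> s + \<sigma> r))"
    by (rule exec_eq[OF exec_move_to]) (use assms in auto)
qed

text \<open>The arguments are in registers \<open>b + 1\<close> and \<open>b + 2\<close>. The first loop leaves \<open>m\<close> in \<open>b\<close> and \<open>m + n\<close> in \<open>b + 2\<close>; the
  second adds the numbers \<open>m + n, \<dots>, 1\<close> to \<open>b\<close>, that is, the triangle number of the Cantor pairing.\<close>

definition encode_pair :: "nat \<Rightarrow> prog" where
  "encode_pair b =
    Seq (While (b + 1) (Seq (Inc b) (Inc (b + 2))))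
      (While (b + 2) (Seq (Seq (Inc b) (While (b + 2) (Seq (Inc b) (Inc (b + 3)))))
        (move_to (b + 3) (b + 2))))"

lemma exec_encode_pair:
  assumes "\<And>i. i \<ge> b + 3 \<Longrightarrow> \<sigma> i = 0" "\<sigma> b = 0"
  shows "exec \<gamma> (encode_pair b) \<sigma> (\<sigma>(b := prod_encode (\<sigma> (b+1), \<sigma> (b+2)), b + 1 := 0, b + 2 := 0))"
  unfolding encode_pair_def
proof (rule exec.Seq)
  define m n where "m = \<sigma> (b+1)" and "n = \<sigma> (b+2)"
  let ?f = "\<lambda>i. \<sigma>(b + 1 := i, b := m - i, b + 2 := n + m - i)"
  have "exec \<gamma> (While (b + 1) (Seq (Inc b) (Inc (b + 2)))) (?f m) (?f 0)"
    by (rule exec_While_down[where f = ?f])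
      (auto intro!: exec.Seq[OF exec.Inc] exec_eq[OF exec.Inc] ext)
  moreover have "?f m = \<sigma>" using assms by (auto simp: m_def n_def)
  ultimately show "exec \<gamma> (While (b + 1) (Seq (Inc b) (Inc (b + 2)))) \<sigma> (?f 0)" by simp
  let ?P = "Seq (Seq (Inc b) (While (b + 2) (Seq (Inc b) (Inc (b + 3))))) (move_to (b + 3) (b + 2))"
  let ?g = "\<lambda>i. \<sigma>(b := m + triangle (n + m) - triangle i, b + 1 := 0, b + 2 := i)"
  have "exec \<gamma> (While (b + 2) ?P) (?g (n + m)) (?g 0)"
  proof (rule exec_While_down[where f = ?g])
    fix k assume k: "k < n + m"
    \<comment> \<open>what has been added to \<open>b\<close> when \<open>Suc k\<close> is still to be added\<close>
    define B where "B = m + triangle (n + m) - triangle (Suc k)"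
    have "triangle (Suc k) \<le> triangle (n + m)"
      using k unfolding triangle_def by (intro div_le_mono mult_le_mono) auto
    then have B: "B + Suc k = m + triangle (n + m) - triangle k" by (simp add: B_def)
    let ?h = "\<lambda>i. \<sigma>(b := B + 1 + k - i, b + 1 := 0, b + 2 := i, b + 3 := k - i)"
    have "exec \<gamma> (While (b + 2) (Seq (Inc b) (Inc (b + 3)))) (?h k) (?h 0)"
      by (rule exec_While_down[where f = ?h])
        (auto intro!: exec.Seq[OF exec.Inc] exec_eq[OF exec.Inc] ext)
    moreover have "exec \<gamma> (Inc b) ((?g (Suc k))(b + 2 := k)) (?h k)"
      by (rule exec_eq[OF exec.Inc]) (use assms in \<open>auto simp: B_def\<close>)
    moreover have "exec \<gamma> (move_to (b + 3) (b + 2)) (?h 0) (?g k)"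
      by (rule exec_eq[OF exec_move_to]) (use assms B in auto)
    ultimately show "exec \<gamma> ?P ((?g (Suc k))(b + 2 := k)) (?g k)"
      by (blast intro: exec.Seq)
  qed auto
  moreover have "?g (n + m) = ?f 0" by auto
  moreover have "?g 0 = \<sigma>(b := prod_encode (\<sigma> (b+1), \<sigma> (b+2)), b + 1 := 0, b + 2 := 0)"
    by (auto simp: prod_encode_def m_def n_def add.commute)
  ultimately show "exec \<gamma> (While (b + 2) ?P) (?f 0)
      (\<sigma>(b := prod_encode (\<sigma> (b+1), \<sigma> (b+2)), b + 1 := 0, b + 2 := 0))" by simp
qed

text \<open>Decoding walks through all pairs in the order of their codes, one step for each unit of the argument.\<close>

definition decode_pair :: "nat \<Rightarrow> prog" where
  "decode_pair b = While b (Cond (b + 2) (Inc (b + 1)) (Seq (Inc (b + 2)) (move_to (b + 1) (b + 2))))"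

lemma prod_decode_Suc:
  "prod_decode (Suc c) = (case prod_decode c of (u, 0) \<Rightarrow> (0, Suc u) | (u, Suc v) \<Rightarrow> (Suc u, v))"
proof -
  obtain u v where c: "prod_decode c = (u, v)" by fastforce
  then have e: "c = prod_encode (u, v)" by (metis prod_decode_inverse)
  show ?thesis
  proof (cases v)
    case 0
    then have "Suc c = prod_encode (0, Suc u)" using e by (simp add: prod_encode_def)
    then show ?thesis using 0 c by (simp del: prod_decode_inverse)
  next
    case (Suc w)
    then have "Suc c = prod_encode (Suc u, w)" using e by (simp add: prod_encode_def)
    then show ?thesis using Suc c by (simp del: prod_decode_inverse)
  qed
qed

lemma exec_decode_pair:
  assumes "\<And>i. i > b \<Longrightarrow> \<sigma> i = 0"
  shows "exec \<gamma> (decode_pair b) \<sigma>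
    (\<sigma>(b := 0, b + 1 := fst (prod_decode (\<sigma> b)), b + 2 := snd (prod_decode (\<sigma> b))))"
proof -
  let ?f = "\<lambda>i. \<sigma>(b := i, b + 1 := fst (prod_decode (\<sigma> b - i)), b + 2 := snd (prod_decode (\<sigma> b - i)))"
  have "exec \<gamma> (decode_pair b) (?f (\<sigma> b)) (?f 0)"
    unfolding decode_pair_def
  proof (rule exec_While_down[where f = ?f])
    fix i assume i: "i < \<sigma> b"
    obtain u v where c: "prod_decode (\<sigma> b - Suc i) = (u, v)" by fastforce
    have s: "\<sigma> b - i = Suc (\<sigma> b - Suc i)" using i by simp
    let ?g = "(?f (Suc i))(b := i)"
    show "exec \<gamma> (Cond (b + 2) (Inc (b + 1)) (Seq (Inc (b + 2)) (move_to (b + 1) (b + 2)))) ?g (?f i)"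
    proof (cases v)
      case 0
      have "exec \<gamma> (Seq (Inc (b + 2)) (move_to (b + 1) (b + 2))) ?g (?f i)"
        by (rule exec.Seq[OF exec.Inc exec_eq[OF exec_move_to]])
          (auto simp: s c prod_decode_Suc 0 fun_eq_iff)
      then show ?thesis by (intro exec.Cond_0) (auto simp: c 0)
    next
      case (Suc w)
      have "exec \<gamma> (Inc (b + 1)) (?g(b + 2 := w)) (?f i)"
        by (rule exec_eq[OF exec.Inc]) (auto simp: s c prod_decode_Suc Suc fun_eq_iff)
      then show ?thesis by (intro exec.Cond_Suc) (auto simp: c Suc)
    qed
  qed auto
  moreover have "?f (\<sigma> b) = \<sigma>" using assms by (auto simp: prod_decode_def prod_decode_aux.simps)
  ultimately show ?thesis by simp
qed

text \<open>Register \<open>b\<close> is both argument and result. The registers above it are scratch space, zero before and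
  after the run, so that programs can be nested by moving \<open>b\<close> upwards. Register 1 is reserved for
  queries, and register 0, the input and output tape, is used only by \<open>oracle_computable_otm\<close>; hence \<open>b \<ge> 2\<close>.\<close>

definition computes :: "(nat \<Rightarrow> nat) set \<Rightarrow> prog \<Rightarrow> nat \<Rightarrow> ((nat \<Rightarrow> nat) \<Rightarrow> nat \<Rightarrow> nat) \<Rightarrow> bool" where
  "computes A p b F \<longleftrightarrow>
    (\<forall>\<gamma>\<in>A. \<forall>\<sigma>. \<sigma> 1 = 0 \<longrightarrow> (\<forall>i>b. \<sigma> i = 0) \<longrightarrow> exec \<gamma> p \<sigma> (\<sigma>(b := F \<gamma> (\<sigma> b))))"

text \<open>The set \<open>A\<close> contains the oracles for which a functional has to be computed: for other
  oracles a search may fail to end.\<close>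

definition oracle_computable :: "(nat \<Rightarrow> nat) set \<Rightarrow> ((nat \<Rightarrow> nat) \<Rightarrow> nat \<Rightarrow> nat) \<Rightarrow> bool" where
  "oracle_computable A F \<longleftrightarrow> (\<forall>b\<ge>2. \<exists>p. computes A p b F)"

lemma computesI:
  assumes "\<And>\<gamma> \<sigma>. \<gamma> \<in> A \<Longrightarrow> \<sigma> 1 = 0 \<Longrightarrow> \<forall>i>b. \<sigma> i = 0 \<Longrightarrow> exec \<gamma> p \<sigma> (\<sigma>(b := F \<gamma> (\<sigma> b)))"
  shows "computes A p b F"
  using assms by (simp add: computes_def)

lemma computesD:
  assumes "computes A p b F" "\<gamma> \<in> A" "\<sigma> 1 = 0" "\<And>i. i > b \<Longrightarrow> \<sigma> i = 0"
  shows "exec \<gamma> p \<sigma> (\<sigma>(b := F \<gamma> (\<sigma> b)))"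
  using assms by (simp add: computes_def)

lemma oracle_computableI: "(\<And>b. 2 \<le> b \<Longrightarrow> \<exists>p. computes A p b F) \<Longrightarrow> oracle_computable A F"
  by (simp add: oracle_computable_def)

lemma oracle_computableE: "oracle_computable A F \<Longrightarrow> 2 \<le> b \<Longrightarrow> \<exists>p. computes A p b F"
  by (simp add: oracle_computable_def)

theorem oracle_computable_otm:
  assumes "oracle_computable A F"
  shows "\<exists>M. wf_otm M \<and> (\<forall>\<gamma>\<in>A. \<forall>n. otm_outputs M \<gamma> n (F \<gamma> n))"
proof -
  obtain p where "computes A p 2 F" using oracle_computableE[OF assms, of 2] by auto
  note p = computesD[OF this]
  show ?thesis
  proof (rule exec_imp_otm)
    fix \<gamma> n assume \<gamma>: "\<gamma> \<in> A"
    let ?s = "(\<lambda>_. 0 :: nat)"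
    have "exec \<gamma> (move_to 0 2) (?s(0 := n)) (?s(2 := n))"
      by (rule exec_eq[OF exec_move_to]) auto
    moreover have "exec \<gamma> p (?s(2 := n)) (?s(2 := F \<gamma> n))"
      by (rule exec_eq[OF p[OF \<gamma>]]) auto
    moreover have "exec \<gamma> (move_to 2 0) (?s(2 := F \<gamma> n)) (?s(0 := F \<gamma> n))"
      by (rule exec_eq[OF exec_move_to]) auto
    ultimately have "exec \<gamma> (Seq (move_to 0 2) (Seq p (move_to 2 0))) (?s(0 := n)) (?s(0 := F \<gamma> n))"
      by (blast intro: exec.Seq)
    then show "\<exists>\<sigma>. exec \<gamma> (Seq (move_to 0 2) (Seq p (move_to 2 0))) (?s(0 := n)) \<sigma> \<and> \<sigma> 0 = F \<gamma> n"
      by (intro exI[of _ "?s(0 := F \<gamma> n)"]) simp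
  qed
qed

section \<open>Basic closure properties\<close>

named_theorems comp_intros

lemma oc_id [comp_intros]: "oracle_computable A (\<lambda>\<gamma> x. x)"
  by (rule oracle_computableI, rule exI[of _ Skip], rule computesI, rule exec_eq[OF exec.Skip]) simp

lemma oc_zero: "oracle_computable A (\<lambda>\<gamma> x. 0)"
  by (rule oracle_computableI) (auto intro: computesI exec_clear)

lemma oc_comp:
  assumes "oracle_computable A F" "oracle_computable A G"
  shows "oracle_computable A (\<lambda>\<gamma> x. F \<gamma> (G \<gamma> x))"
proof (rule oracle_computableI)
  fix b :: nat assume b: "2 \<le> b"
  obtain p where "computes A p b F"
    using oracle_computableE[OF assms(1) b] by blast
  note p = computesD[OF this]
  obtain q where "computes A q b G"
    using oracle_computableE[OF assms(2) b] by blast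
  note q = computesD[OF this]
  have "computes A (Seq q p) b (\<lambda>\<gamma> x. F \<gamma> (G \<gamma> x))"
    by (rule computesI, rule exec.Seq[OF q exec_eq[OF p]]) (use b in auto)
  then show "\<exists>p. computes A p b (\<lambda>\<gamma> x. F \<gamma> (G \<gamma> x))" ..
qed

lemma oc_Suc [comp_intros]:
  assumes "oracle_computable A F"
  shows "oracle_computable A (\<lambda>\<gamma> x. Suc (F \<gamma> x))"
proof -
  have "oracle_computable A (\<lambda>\<gamma> x. Suc x)"
    by (rule oracle_computableI) (auto intro: computesI exec.Inc)
  from oc_comp[OF this assms] show ?thesis .
qed

lemma oc_const [comp_intros]: "oracle_computable A (\<lambda>\<gamma> x. c)"
  by (induction c) (auto intro: oc_zero oc_Suc)

lemma oc_oracle [comp_intros]: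
  assumes "oracle_computable A F"
  shows "oracle_computable A (\<lambda>\<gamma> x. \<gamma> (F \<gamma> x))"
proof -
  have "oracle_computable A (\<lambda>\<gamma> x. \<gamma> x)"
  proof (rule oracle_computableI)
    fix b :: nat assume b: "2 \<le> b"
    have run: "exec \<gamma> (Seq (move_to b 1) (Seq Query (move_to 1 b))) \<sigma> (\<sigma>(b := \<gamma> (\<sigma> b)))"
      if "\<sigma> 1 = 0" for \<gamma> \<sigma>
      by (rule exec.Seq[OF exec_move_to exec.Seq[OF exec.Query exec_eq[OF exec_move_to]]])
        (use b that in auto)
    show "\<exists>p. computes A p b (\<lambda>\<gamma> x. \<gamma> x)"
    by (rule exI, rule computesI, rule run)
  qed
  from oc_comp[OF this assms] show ?thesis .
qed

lemma oc_pair [comp_intros]: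
  assumes "oracle_computable A F" "oracle_computable A G"
  shows "oracle_computable A (\<lambda>\<gamma> x. prod_encode (F \<gamma> x, G \<gamma> x))"
proof (rule oracle_computableI)
  fix b :: nat assume b: "2 \<le> b"
  have "2 \<le> b + 1" "2 \<le> b + 2" using b by auto
  obtain p where "computes A p (b + 1) F"
    using oracle_computableE[OF assms(1) \<open>2 \<le> b + 1\<close>] by blast
  note p = computesD[OF this]
  obtain q where "computes A q (b + 2) G"
    using oracle_computableE[OF assms(2) \<open>2 \<le> b + 2\<close>] by blast
  note q = computesD[OF this]
  let ?p = "Seq (copy_to b (b + 1) (b + 2)) (Seq p (Seq (copy_to b (b + 2) (b + 3)) (Seq q
     (Seq (clear b) (encode_pair b)))))"
  have run: "exec \<gamma> ?p \<sigma> (\<sigma>(b := prod_encode (F \<gamma> (\<sigma> b), G \<gamma> (\<sigma> b))))"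
    if "\<gamma> \<in> A" "\<sigma> 1 = 0" "\<forall>i>b. \<sigma> i = 0" for \<gamma> \<sigma>
  proof (intro exec.Seq)
    let ?x = "\<sigma> b"
    let ?s1 = "\<sigma>(b + 1 := ?x)"
    let ?s2 = "\<sigma>(b + 1 := F \<gamma> ?x)"
    let ?s3 = "?s2(b + 2 := ?x)"
    let ?s4 = "?s2(b + 2 := G \<gamma> ?x)"
    show "exec \<gamma> (copy_to b (b + 1) (b + 2)) \<sigma> ?s1"
      by (rule exec_eq[OF exec_copy_to]) (use that in auto)
    show "exec \<gamma> p ?s1 ?s2"
      by (rule exec_eq[OF p]) (use that b in auto)
    show "exec \<gamma> (copy_to b (b + 2) (b + 3)) ?s2 ?s3"
      by (rule exec_eq[OF exec_copy_to]) (use that in auto)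
    show "exec \<gamma> q ?s3 ?s4"
      by (rule exec_eq[OF q]) (use that b in auto)
    show "exec \<gamma> (clear b) ?s4 (?s4(b := 0))" by (rule exec_clear)
    show "exec \<gamma> (encode_pair b) (?s4(b := 0)) (\<sigma>(b := prod_encode (F \<gamma> ?x, G \<gamma> ?x)))"
      by (rule exec_eq[OF exec_encode_pair]) (use that in \<open>auto simp: fun_eq_iff\<close>)
  qed
  show "\<exists>p. computes A p b (\<lambda>\<gamma> x. prod_encode (F \<gamma> x, G \<gamma> x))"
    by (rule exI, rule computesI, rule run)
qed

definition pfst :: "nat \<Rightarrow> nat" where "pfst x = fst (prod_decode x)"
definition psnd :: "nat \<Rightarrow> nat" where "psnd x = snd (prod_decode x)"

lemma pfst_encode [simp]: "pfst (prod_encode (a, b)) = a" by (simp add: pfst_def)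
lemma psnd_encode [simp]: "psnd (prod_encode (a, b)) = b" by (simp add: psnd_def)

lemma oc_pfst [comp_intros]:
  assumes "oracle_computable A F"
  shows "oracle_computable A (\<lambda>\<gamma> x. pfst (F \<gamma> x))"
proof -
  have "oracle_computable A (\<lambda>\<gamma> x. pfst x)"
  proof (rule oracle_computableI)
    fix b :: nat
    have run: "exec \<gamma> (Seq (decode_pair b) (Seq (clear (b + 2)) (move_to (b + 1) b))) \<sigma> (\<sigma>(b := pfst (\<sigma> b)))"
      if "\<forall>i>b. \<sigma> i = 0" for \<gamma> \<sigma>
      by (rule exec.Seq[OF exec_decode_pair exec.Seq[OF exec_clear exec_eq[OF exec_move_to]]])
        (use that in \<open>auto simp: pfst_def fun_eq_iff\<close>)
    show "\<exists>p. computes A p b (\<lambda>\<gamma> x. pfst x)"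
    by (rule exI, rule computesI, rule run)
  qed
  from oc_comp[OF this assms] show ?thesis .
qed

lemma oc_psnd [comp_intros]:
  assumes "oracle_computable A F"
  shows "oracle_computable A (\<lambda>\<gamma> x. psnd (F \<gamma> x))"
proof -
  have "oracle_computable A (\<lambda>\<gamma> x. psnd x)"
  proof (rule oracle_computableI)
    fix b :: nat
    have run: "exec \<gamma> (Seq (decode_pair b) (Seq (clear (b + 1)) (move_to (b + 2) b))) \<sigma> (\<sigma>(b := psnd (\<sigma> b)))"
      if "\<forall>i>b. \<sigma> i = 0" for \<gamma> \<sigma>
      by (rule exec.Seq[OF exec_decode_pair exec.Seq[OF exec_clear exec_eq[OF exec_move_to]]])
        (use that in \<open>auto simp: psnd_def fun_eq_iff\<close>)
    show "\<exists>p. computes A p b (\<lambda>\<gamma> x. psnd x)"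
    by (rule exI, rule computesI, rule run)
  qed
  from oc_comp[OF this assms] show ?thesis .
qed

lemma oc_funpow_raw:
  assumes "oracle_computable A G"
  shows "oracle_computable A (\<lambda>\<gamma> x. (G \<gamma> ^^ pfst x) (psnd x))"
proof (rule oracle_computableI)
  fix b :: nat assume b: "2 \<le> b"
  have "2 \<le> b + 2" using b by auto
  obtain p where "computes A p (b + 2) G"
    using oracle_computableE[OF assms(1) \<open>2 \<le> b + 2\<close>] by blast
  note p = computesD[OF this]
  let ?p = "Seq (decode_pair b) (Seq (While (b + 1) p) (move_to (b + 2) b))"
  have run: "exec \<gamma> ?p \<sigma> (\<sigma>(b := (G \<gamma> ^^ pfst (\<sigma> b)) (psnd (\<sigma> b))))"
    if "\<gamma> \<in> A" "\<sigma> 1 = 0" "\<forall>i>b. \<sigma> i = 0" for \<gamma> \<sigma>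
  proof (intro exec.Seq)
    define n y where "n = pfst (\<sigma> b)" and "y = psnd (\<sigma> b)"
    let ?f = "\<lambda>i. \<sigma>(b := 0, b + 1 := i, b + 2 := (G \<gamma> ^^ (n - i)) y)"
    show "exec \<gamma> (decode_pair b) \<sigma> (?f n)"
      by (rule exec_eq[OF exec_decode_pair]) (use that in \<open>auto simp: n_def y_def pfst_def psnd_def\<close>)
    show "exec \<gamma> (While (b + 1) p) (?f n) (?f 0)"
    proof (rule exec_While_down[where f = ?f])
      fix i assume "i < n"
      then have "n - i = Suc (n - Suc i)" by simp
      then show "exec \<gamma> p ((?f (Suc i))(b + 1 := i)) (?f i)"
        by (intro exec_eq[OF p[OF that(1)]]) (use b that in auto)
    qed auto
    show "exec \<gamma> (move_to (b + 2) b) (?f 0) (\<sigma>(b := (G \<gamma> ^^ pfst (\<sigma> b)) (psnd (\<sigma> b))))"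
      by (rule exec_eq[OF exec_move_to]) (use that in \<open>auto simp: n_def y_def fun_eq_iff\<close>)
  qed
  show "\<exists>p. computes A p b (\<lambda>\<gamma> x. (G \<gamma> ^^ pfst x) (psnd x))"
    by (rule exI, rule computesI, rule run)
qed

text \<open>Iteration until a test vanishes is the only unbounded loop; minimisation is derived from it.\<close>

lemma oc_while_raw:
  assumes "oracle_computable A G" "oracle_computable A T"
    and ex: "\<And>\<gamma> x. \<gamma> \<in> A \<Longrightarrow> \<exists>n. T \<gamma> ((G \<gamma> ^^ n) x) = 0"
  shows "oracle_computable A (\<lambda>\<gamma> x. (G \<gamma> ^^ (LEAST n. T \<gamma> ((G \<gamma> ^^ n) x) = 0)) x)"
proof (rule oracle_computableI)
  fix b :: nat assume b: "2 \<le> b"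
  have "2 \<le> b + 1" using b by auto
  obtain p where "computes A p b G"
    using oracle_computableE[OF assms(1) b] by blast
  note p = computesD[OF this]
  obtain q where "computes A q (b + 1) T"
    using oracle_computableE[OF assms(2) \<open>2 \<le> b + 1\<close>] by blast
  note q = computesD[OF this]
  let ?t = "Seq (copy_to b (b + 1) (b + 2)) q"
  let ?body = "Seq (clear (b + 1)) (Seq p ?t)"
  let ?p = "Seq ?t (While (b + 1) ?body)"
  have run: "exec \<gamma> ?p \<sigma> (\<sigma>(b := (G \<gamma> ^^ (LEAST n. T \<gamma> ((G \<gamma> ^^ n) (\<sigma> b)) = 0)) (\<sigma> b)))"
    if "\<gamma> \<in> A" "\<sigma> 1 = 0" "\<forall>i>b. \<sigma> i = 0" for \<gamma> \<sigma>
  proof (rule exec.Seq)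
    let ?x = "\<sigma> b"
    let ?y = "\<lambda>n. (G \<gamma> ^^ n) ?x"
    let ?f = "\<lambda>n. \<sigma>(b := ?y n, b + 1 := T \<gamma> (?y n))"
    define L where "L = (LEAST n. T \<gamma> (?y n) = 0)"
    have L0: "T \<gamma> (?y L) = 0" unfolding L_def by (rule LeastI_ex[OF ex[OF that(1)]])
    have Lpos: "T \<gamma> (?y n) \<noteq> 0" if "n < L" for n
      using that unfolding L_def by (rule not_less_Least)
    have t: "exec \<gamma> ?t (\<sigma>(b := ?y n)) (?f n)" for n
      by (rule exec.Seq[OF exec_copy_to exec_eq[OF q[OF that(1)]]]) (use b that in auto)
    from t[of 0] show "exec \<gamma> ?t \<sigma> (?f 0)" by simp
    have "exec \<gamma> (While (b + 1) ?body) (?f (L - n)) (?f L)" if "n \<le> L" for n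
      using that
    proof (induction n)
      case 0
      show ?case using L0 by (auto intro!: exec.While_0)
    next
      case (Suc n)
      define k where "k = L - Suc n"
      have k: "L - n = Suc k" "k < L" using Suc by (auto simp: k_def)
      obtain m where m: "T \<gamma> (?y k) = Suc m" using Lpos[OF k(2)] not0_implies_Suc by blast
      have "exec \<gamma> (clear (b + 1)) ((?f k)(b + 1 := m)) (\<sigma>(b := ?y k))"
        by (rule exec_eq[OF exec_clear]) (use \<open>\<forall>i>b. \<sigma> i = 0\<close> in auto)
      moreover have "exec \<gamma> p (\<sigma>(b := ?y k)) (\<sigma>(b := ?y (Suc k)))"
        by (rule exec_eq[OF p[OF \<open>\<gamma> \<in> A\<close>]]) (use b \<open>\<sigma> 1 = 0\<close> \<open>\<forall>i>b. \<sigma> i = 0\<close> in auto)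
      ultimately have 1: "exec \<gamma> ?body ((?f k)(b + 1 := m)) (?f (Suc k))"
        using t[of "Suc k"] by (blast intro: exec.Seq)
      have 2: "exec \<gamma> (While (b + 1) ?body) (?f (Suc k)) (?f L)"
        using Suc.IH[OF Suc_leD[OF Suc.prems]] unfolding k(1) .
      show ?case
        unfolding k_def[symmetric] by (rule exec.While_Suc[OF _ 1 2]) (simp add: m)
    qed
    from this[of L] have "exec \<gamma> (While (b + 1) ?body) (?f 0) (?f L)" by simp
    moreover have "?f L = \<sigma>(b := ?y L)" using that L0 by auto
    ultimately show "exec \<gamma> (While (b + 1) ?body) (?f 0) (\<sigma>(b := ?y (LEAST n. T \<gamma> (?y n) = 0)))"
      by (simp add: L_def)
  qed
  show "\<exists>p. computes A p b (\<lambda>\<gamma> x. (G \<gamma> ^^ (LEAST n. T \<gamma> ((G \<gamma> ^^ n) x) = 0)) x)"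
    by (rule exI, rule computesI, rule run)
qed

section \<open>Recursion, arithmetic and search\<close>

lemma oc_cong:
  assumes "oracle_computable A F" "\<And>\<gamma> x. \<gamma> \<in> A \<Longrightarrow> F \<gamma> x = G \<gamma> x"
  shows "oracle_computable A G"
  using assms by (simp add: oracle_computable_def computes_def)

text \<open>The functionals have one argument \<open>x\<close>, which plays the role of a context. The step function of a recursion needs the context, the
  counter and the previous value, which are passed as nested pairs: this is what the
  third premise expresses. With this convention the closure rules apply to any term by
  resolution alone. The proof iterates a step on the coded triple.\<close>

lemma oc_rec [comp_intros]:
  assumes "oracle_computable A a" "oracle_computable A n"
    and "oracle_computable A (\<lambda>\<gamma> p. g \<gamma> (pfst p) (pfst (psnd p)) (psnd (psnd p)))"
  shows "oracle_computable A (\<lambda>\<gamma> x. rec_nat (a \<gamma> x) (g \<gamma> x) (n \<gamma> x))"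
proof -
  let ?S = "\<lambda>\<gamma> p. prod_encode (pfst p, prod_encode (Suc (pfst (psnd p)), g \<gamma> (pfst p) (pfst (psnd p)) (psnd (psnd p))))"
  have "oracle_computable A ?S" by (intro comp_intros assms)
  note F = oc_funpow_raw[OF this]
  have "oracle_computable A (\<lambda>\<gamma> x. prod_encode (n \<gamma> x, prod_encode (x, prod_encode (0, a \<gamma> x))))"
    by (intro comp_intros assms)
  from oc_psnd[OF oc_psnd[OF oc_comp[OF F this]]]
  have *: "oracle_computable A (\<lambda>\<gamma> x. psnd (psnd ((?S \<gamma> ^^ n \<gamma> x) (prod_encode (x, prod_encode (0, a \<gamma> x))))))"
    by simp
  have "(?S \<gamma> ^^ m) (prod_encode (x, prod_encode (0, y))) = prod_encode (x, prod_encode (m, rec_nat y (g \<gamma> x) m))"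
    for m y \<gamma> x by (induction m) auto
  with * show ?thesis by simp
qed

lemma oc_pred [comp_intros]:
  assumes "oracle_computable A a"
  shows "oracle_computable A (\<lambda>\<gamma> x. a \<gamma> x - 1)"
proof -
  have "m - 1 = rec_nat 0 (\<lambda>i r. i) m" for m :: nat by (cases m) auto
  then show ?thesis by (simp only:) (intro comp_intros assms)
qed

lemma oc_add [comp_intros]:
  assumes "oracle_computable A a" "oracle_computable A b"
  shows "oracle_computable A (\<lambda>\<gamma> x. a \<gamma> x + b \<gamma> x)"
proof -
  have "m + k = rec_nat m (\<lambda>i r. Suc r) k" for m k :: nat by (induction k) auto
  then show ?thesis by (simp only:) (intro comp_intros assms)
qed

lemma oc_minus [comp_intros]:
  assumes "oracle_computable A a" "oracle_computable A b"
  shows "oracle_computable A (\<lambda>\<gamma> x. a \<gamma> x - b \<gamma> x)"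
proof -
  have "m - k = rec_nat m (\<lambda>i r. r - 1) k" for m k :: nat by (induction k) auto
  then have e: "(\<lambda>\<gamma> x. a \<gamma> x - b \<gamma> x) = (\<lambda>\<gamma> x. rec_nat (a \<gamma> x) (\<lambda>i r. r - 1) (b \<gamma> x))" by blast
  show ?thesis unfolding e by (intro comp_intros assms)
qed

lemma oc_mult [comp_intros]:
  assumes "oracle_computable A a" "oracle_computable A b"
  shows "oracle_computable A (\<lambda>\<gamma> x. a \<gamma> x * b \<gamma> x)"
proof -
  have "m * k = rec_nat 0 (\<lambda>i r. r + m) k" for m k :: nat by (induction k) auto
  then have e: "(\<lambda>\<gamma> x. a \<gamma> x * b \<gamma> x) = (\<lambda>\<gamma> x. rec_nat 0 (\<lambda>i r. r + a \<gamma> x) (b \<gamma> x))" by simp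
  have "oracle_computable A (\<lambda>\<gamma> x. a \<gamma> (pfst x))"
    by (rule oc_comp[OF assms(1)]) (intro comp_intros)
  then show ?thesis unfolding e by (intro comp_intros assms)
qed

lemma oc_power [comp_intros]:
  assumes "oracle_computable A a" "oracle_computable A b"
  shows "oracle_computable A (\<lambda>\<gamma> x. a \<gamma> x ^ b \<gamma> x)"
proof -
  have "m ^ k = rec_nat 1 (\<lambda>i r. r * m) k" for m k :: nat by (induction k) auto
  then have e: "(\<lambda>\<gamma> x. a \<gamma> x ^ b \<gamma> x) = (\<lambda>\<gamma> x. rec_nat 1 (\<lambda>i r. r * a \<gamma> x) (b \<gamma> x))" by simp
  have "oracle_computable A (\<lambda>\<gamma> x. a \<gamma> (pfst x))"
    by (rule oc_comp[OF assms(1)]) (intro comp_intros)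
  then show ?thesis unfolding e by (intro comp_intros assms)
qed

definition oracle_decidable :: "(nat \<Rightarrow> nat) set \<Rightarrow> ((nat \<Rightarrow> nat) \<Rightarrow> nat \<Rightarrow> bool) \<Rightarrow> bool" where
  "oracle_decidable A P \<longleftrightarrow> oracle_computable A (\<lambda>\<gamma> x. of_bool (P \<gamma> x))"

lemma od_comp:
  assumes "oracle_decidable A P" "oracle_computable A G"
  shows "oracle_decidable A (\<lambda>\<gamma> x. P \<gamma> (G \<gamma> x))"
  using assms unfolding oracle_decidable_def by (rule oc_comp)

lemma od_is_zero:
  assumes "oracle_computable A a"
  shows "oracle_decidable A (\<lambda>\<gamma> x. a \<gamma> x = 0)"
proof -
  have "of_bool (m = 0) = rec_nat (Suc 0) (\<lambda>i r. 0) m" for m :: nat by (cases m) auto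
  then show ?thesis unfolding oracle_decidable_def by (simp only:) (intro comp_intros assms)
qed

lemma od_not [comp_intros]:
  assumes "oracle_decidable A P"
  shows "oracle_decidable A (\<lambda>\<gamma> x. \<not> P \<gamma> x)"
proof -
  have "oracle_decidable A (\<lambda>\<gamma> x. of_bool (P \<gamma> x) = (0::nat))"
    by (rule od_is_zero) (use assms in \<open>simp only: oracle_decidable_def\<close>)
  then show ?thesis by (simp only: of_bool_eq_0_iff)
qed

lemma od_conj [comp_intros]:
  assumes "oracle_decidable A P" "oracle_decidable A Q"
  shows "oracle_decidable A (\<lambda>\<gamma> x. P \<gamma> x \<and> Q \<gamma> x)"
  using assms unfolding oracle_decidable_def of_bool_conj by (rule oc_mult)

lemma od_disj [comp_intros]:
  assumes "oracle_decidable A P" "oracle_decidable A Q"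
  shows "oracle_decidable A (\<lambda>\<gamma> x. P \<gamma> x \<or> Q \<gamma> x)"
  using od_not[OF od_conj[OF od_not[OF assms(1)] od_not[OF assms(2)]]]
  by (simp only: de_Morgan_conj not_not)

lemma od_le [comp_intros]:
  assumes "oracle_computable A a" "oracle_computable A b"
  shows "oracle_decidable A (\<lambda>\<gamma> x. a \<gamma> x \<le> b \<gamma> x)"
  using od_is_zero[OF oc_minus[OF assms]] by (simp only: diff_is_0_eq)

lemma od_less [comp_intros]:
  assumes "oracle_computable A a" "oracle_computable A b"
  shows "oracle_decidable A (\<lambda>\<gamma> x. a \<gamma> x < b \<gamma> x)"
  using od_not[OF od_le[OF assms(2,1)]] by (simp only: not_le)

lemma od_eq [comp_intros]:
  fixes a b :: "(nat \<Rightarrow> nat) \<Rightarrow> nat \<Rightarrow> nat"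
  assumes "oracle_computable A a" "oracle_computable A b"
  shows "oracle_decidable A (\<lambda>\<gamma> x. a \<gamma> x = b \<gamma> x)"
  using od_conj[OF od_le[OF assms] od_le[OF assms(2,1)]] by (simp only: eq_iff)

lemma oc_if [comp_intros]:
  assumes "oracle_decidable A P" "oracle_computable A a" "oracle_computable A b"
  shows "oracle_computable A (\<lambda>\<gamma> x. if P \<gamma> x then a \<gamma> x else b \<gamma> x)"
proof -
  have "oracle_computable A (\<lambda>\<gamma> x. of_bool (P \<gamma> x) * a \<gamma> x + of_bool (\<not> P \<gamma> x) * b \<gamma> x)"
    using assms(1) od_not[OF assms(1)] unfolding oracle_decidable_def by (intro comp_intros assms)
  then show ?thesis by (rule oc_cong) auto
qed

text \<open>The context of the body is the pair of the outer context and the bound variable.\<close>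

lemma od_ball [comp_intros]:
  assumes "oracle_computable A n" "oracle_decidable A (\<lambda>\<gamma> p. P \<gamma> (pfst p) (psnd p))"
  shows "oracle_decidable A (\<lambda>\<gamma> x. \<forall>y<n \<gamma> x. P \<gamma> x y)"
proof -
  have *: "of_bool (\<forall>y<m. P \<gamma> x y) = rec_nat (1::nat) (\<lambda>i r. if P \<gamma> x i then r else 0) m" for m \<gamma> x
    by (induction m) (auto simp: less_Suc_eq)
  have "oracle_computable A (\<lambda>\<gamma> p. prod_encode (pfst p, pfst (psnd p)))" by (intro comp_intros)
  from od_comp[OF assms(2) this]
  have d: "oracle_decidable A (\<lambda>\<gamma> p. P \<gamma> (pfst p) (pfst (psnd p)))" by simp
  show ?thesis unfolding oracle_decidable_def * by (intro comp_intros assms d)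
qed

text \<open>The loop increments a candidate until some number up to the candidate has the property. In
  this form the test is monotone, and the number of rounds is the least solution.\<close>

lemma oc_Least [comp_intros]:
  assumes "oracle_decidable A (\<lambda>\<gamma> p. P \<gamma> (pfst p) (psnd p))"
    and ex: "\<And>\<gamma> x. \<gamma> \<in> A \<Longrightarrow> \<exists>m. P \<gamma> x m"
  shows "oracle_computable A (\<lambda>\<gamma> x. LEAST m. P \<gamma> x m)"
proof -
  let ?G = "\<lambda>\<gamma> :: nat \<Rightarrow> nat. \<lambda>y. prod_encode (pfst y, Suc (psnd y))"
  have G: "oracle_computable A ?G" by (intro comp_intros)
  have it: "(?G \<gamma> ^^ n) y = prod_encode (pfst y, psnd y + n)" for \<gamma> n y
    by (induction n) (auto simp: pfst_def psnd_def)
  let ?init = "\<lambda>\<gamma> x. prod_encode (x, 0)"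
  have ex': "\<exists>n. of_bool (\<forall>m<Suc (psnd ((?G \<gamma> ^^ n) y)). \<not> P \<gamma> (pfst ((?G \<gamma> ^^ n) y)) m) = (0::nat)"
    if \<gamma>: "\<gamma> \<in> A" for \<gamma> y
  proof -
    obtain m where "P \<gamma> (pfst y) m" using ex[OF \<gamma>] by blast
    then show ?thesis by (intro exI[of _ m]) (auto simp: it intro!: exI[of _ m])
  qed
  have "oracle_decidable A (\<lambda>\<gamma> y. \<forall>m<Suc (psnd y). \<not> P \<gamma> (pfst y) m)"
  proof -
    have "oracle_computable A (\<lambda>\<gamma> p. prod_encode (pfst (pfst p), psnd p))" by (intro comp_intros)
    from od_comp[OF assms(1) this]
    have "oracle_decidable A (\<lambda>\<gamma> p. P \<gamma> (pfst (pfst p)) (psnd p))" by simp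
    then show ?thesis by (intro comp_intros)
  qed
  then have T2: "oracle_computable A (\<lambda>\<gamma> y. of_bool (\<forall>m<Suc (psnd y). \<not> P \<gamma> (pfst y) m))"
    by (simp add: oracle_decidable_def)
  have I: "oracle_computable A ?init" by (intro comp_intros)
  from oc_psnd[OF oc_comp[OF oc_while_raw[OF G T2 ex'] I]]
  have "oracle_computable A (\<lambda>\<gamma> x. LEAST n. \<exists>m\<le>n. P \<gamma> x m)"
    by (simp add: it less_Suc_eq_le del: of_bool_eq_0_iff) (simp add: of_bool_eq_0_iff)
  moreover have "(LEAST n. \<exists>m\<le>n. P \<gamma> x m) = (LEAST m. P \<gamma> x m)" if "\<gamma> \<in> A" for \<gamma> x
  proof (rule Least_equality)
    show "\<exists>m\<le>LEAST m. P \<gamma> x m. P \<gamma> x m" using LeastI_ex[OF ex[OF that]] by blast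
    fix y assume "\<exists>m\<le>y. P \<gamma> x m"
    then show "(LEAST m. P \<gamma> x m) \<le> y" using Least_le le_trans by metis
  qed
  ultimately show ?thesis by (rule oc_cong) auto
qed

lemma oc_div [comp_intros]:
  assumes "oracle_computable A a" "oracle_computable A b"
  shows "oracle_computable A (\<lambda>\<gamma> x. a \<gamma> x div b \<gamma> x)"
proof -
  have *: "oracle_computable A (\<lambda>\<gamma> x. a \<gamma> (pfst x))" "oracle_computable A (\<lambda>\<gamma> x. b \<gamma> (pfst x))"
    by (rule oc_comp[OF assms(1)] oc_comp[OF assms(2)], intro comp_intros)+
  have "oracle_computable A (\<lambda>\<gamma> x. LEAST q. b \<gamma> x = 0 \<or> a \<gamma> x < b \<gamma> x * Suc q)"
  proof (intro comp_intros *)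
    fix \<gamma> x
    show "\<exists>m. b \<gamma> x = 0 \<or> a \<gamma> x < b \<gamma> x * Suc m"
      by (cases "b \<gamma> x") (auto intro!: exI[of _ "a \<gamma> x"])
  qed
  moreover have "(LEAST q. n = 0 \<or> m < n * Suc q) = m div n" for m n :: nat
  proof (cases "n = 0")
    case False
    show ?thesis
    proof (rule Least_equality)
      show "n = 0 \<or> m < n * Suc (m div n)"
        using False by (metis dividend_less_times_div mult_Suc_right add.commute neq0_conv)
      fix y assume "n = 0 \<or> m < n * Suc y"
      then show "m div n \<le> y"
        using False by (metis less_mult_imp_div_less less_Suc_eq_le mult.commute)
    qed
  qed (auto intro: Least_equality)
  ultimately show ?thesis by (simp only:)
qed

lemma oc_mod [comp_intros]:
  assumes "oracle_computable A a" "oracle_computable A b"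
  shows "oracle_computable A (\<lambda>\<gamma> x. a \<gamma> x mod b \<gamma> x)"
proof -
  have "oracle_computable A (\<lambda>\<gamma> x. a \<gamma> x - b \<gamma> x * (a \<gamma> x div b \<gamma> x))"
    by (intro comp_intros assms)
  then show ?thesis by (simp add: minus_mult_div_eq_mod)
qed

lemma oc_sum [comp_intros]:
  assumes "oracle_computable A n" "oracle_computable A (\<lambda>\<gamma> p. f \<gamma> (pfst p) (psnd p))"
  shows "oracle_computable A (\<lambda>\<gamma> x. \<Sum>i<n \<gamma> x. f \<gamma> x i)"
proof -
  have *: "(\<Sum>i<m. f \<gamma> x i) = rec_nat 0 (\<lambda>i r. r + f \<gamma> x i) m" for m \<gamma> x
    by (induction m) auto
  have "oracle_computable A (\<lambda>\<gamma> p. prod_encode (pfst p, pfst (psnd p)))" by (intro comp_intros)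
  from oc_comp[OF assms(2) this]
  have "oracle_computable A (\<lambda>\<gamma> p. f \<gamma> (pfst p) (pfst (psnd p)))" by simp
  then show ?thesis unfolding * by (intro comp_intros assms)
qed

section \<open>Coded lists\<close>

definition hdc :: "nat \<Rightarrow> nat" where "hdc c = pfst (c - 1)"
definition tlc :: "nat \<Rightarrow> nat" where "tlc c = psnd (c - 1)"
definition consc :: "nat \<Rightarrow> nat \<Rightarrow> nat" where "consc x c = Suc (prod_encode (x, c))"
definition nthc :: "nat \<Rightarrow> nat \<Rightarrow> nat" where "nthc c i = hdc (rec_nat c (\<lambda>_. tlc) i)"
definition lengthc :: "nat \<Rightarrow> nat" where "lengthc c = length (list_decode c)"

lemma prod_decode_0: "prod_decode 0 = (0, 0)"
  by (simp add: prod_decode_def prod_decode_aux.simps)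

lemma list_decode_tlc: "list_decode (tlc c) = tl (list_decode c)"
  by (cases c) (auto simp: tlc_def psnd_def prod_decode_0 split: prod.splits)

lemma list_decode_drop: "list_decode (rec_nat c (\<lambda>_. tlc) i) = drop i (list_decode c)"
  by (induction i) (auto simp: list_decode_tlc drop_Suc tl_drop)

lemma hdc_decode: "hdc c = (case list_decode c of [] \<Rightarrow> 0 | x # _ \<Rightarrow> x)"
  by (cases c) (auto simp: hdc_def pfst_def prod_decode_0 split: prod.splits)

lemma nthc_eq: "nthc c i = (if i < length (list_decode c) then list_decode c ! i else 0)"
proof (cases "i < length (list_decode c)")
  case True
  then have "drop i (list_decode c) = list_decode c ! i # drop (Suc i) (list_decode c)"
    by (simp add: Cons_nth_drop_Suc)
  with True show ?thesis unfolding nthc_def hdc_decode list_decode_drop by simp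
next
  case False
  then show ?thesis unfolding nthc_def hdc_decode list_decode_drop by simp
qed

lemma list_decode_consc: "list_decode (consc x c) = x # list_decode c"
  by (simp add: consc_def)

lemma nthc_consc_0 [simp]: "nthc (consc x c) 0 = x"
  and nthc_consc_Suc [simp]: "nthc (consc x c) (Suc i) = nthc c i"
  by (auto simp: nthc_eq list_decode_consc)

lemma nthc_tlc: "nthc (tlc c) i = nthc c (Suc i)"
  by (auto simp: nthc_eq list_decode_tlc nth_tl)

lemma nthc_0: "nthc c 0 = hdc c"
  by (simp add: nthc_def)

lemma nthc_zero [simp]: "nthc 0 i = 0"
  by (simp add: nthc_eq)

lemma oc_hdc [comp_intros]: "oracle_computable A a \<Longrightarrow> oracle_computable A (\<lambda>\<gamma> x. hdc (a \<gamma> x))"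
  unfolding hdc_def by (intro comp_intros)
lemma oc_tlc [comp_intros]: "oracle_computable A a \<Longrightarrow> oracle_computable A (\<lambda>\<gamma> x. tlc (a \<gamma> x))"
  unfolding tlc_def by (intro comp_intros)
lemma oc_consc [comp_intros]: "oracle_computable A a \<Longrightarrow> oracle_computable A b \<Longrightarrow>
    oracle_computable A (\<lambda>\<gamma> x. consc (a \<gamma> x) (b \<gamma> x))"
  unfolding consc_def by (intro comp_intros)
lemma oc_nthc [comp_intros]: "oracle_computable A a \<Longrightarrow> oracle_computable A b \<Longrightarrow>
    oracle_computable A (\<lambda>\<gamma> x. nthc (a \<gamma> x) (b \<gamma> x))"
  unfolding nthc_def by (intro comp_intros)

lemma oc_lengthc [comp_intros]:
  assumes "oracle_computable A a"
  shows "oracle_computable A (\<lambda>\<gamma> x. lengthc (a \<gamma> x))"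
proof -
  have z: "rec_nat c (\<lambda>_. tlc) n = 0 \<longleftrightarrow> length (list_decode c) \<le> n" for c n
    by (metis list_decode_drop drop_eq_Nil list_decode.simps(1) list_decode_eq)
  have "oracle_computable A (\<lambda>\<gamma> c. LEAST n. rec_nat c (\<lambda>_. tlc) n = 0)"
    by (intro comp_intros) (auto simp: z)
  moreover have "(LEAST n. rec_nat c (\<lambda>_. tlc) n = 0) = lengthc c" for c
    unfolding z lengthc_def by (rule Least_equality) auto
  ultimately have "oracle_computable A (\<lambda>\<gamma> c. lengthc c)" by simp
  from oc_comp[OF this assms] show ?thesis .
qed

text \<open>Tuples of fixed length \<open>K\<close>, whose components can be treated one at a time.\<close>

definition tup :: "(nat \<Rightarrow> nat) \<Rightarrow> nat \<Rightarrow> nat" where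
  "tup f K = list_encode (map f [0..<K])"

lemma nthc_tup [simp]: "i < K \<Longrightarrow> nthc (tup f K) i = f i"
  by (simp add: tup_def nthc_eq)

lemma oc_tup [comp_intros]:
  assumes "\<And>i. oracle_computable A (\<lambda>\<gamma> x. F \<gamma> x i)"
  shows "oracle_computable A (\<lambda>\<gamma> x. tup (F \<gamma> x) K)"
proof -
  have "oracle_computable A (\<lambda>\<gamma> x. list_encode (map (F \<gamma> x) is))" for "is"
    by (induction "is") (auto intro!: comp_intros assms)
  then show ?thesis by (simp add: tup_def)
qed

text \<open>An arbitrary function on a finite set is computable; this covers the transition table of a machine.\<close>

lemma oc_finite_table:
  fixes h :: "nat \<Rightarrow> nat"
  assumes "finite D" "oracle_computable A a"
  shows "oracle_computable A (\<lambda>\<gamma> x. if a \<gamma> x \<in> D then h (a \<gamma> x) else 0)"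
  using assms(1)
proof induction
  case empty
  show ?case by (simp add: oc_const)
next
  case (insert d D)
  have "oracle_computable A (\<lambda>\<gamma> x. if a \<gamma> x = d then h d else if a \<gamma> x \<in> D then h (a \<gamma> x) else 0)"
    by (intro comp_intros assms insert.IH)
  then show ?case by (rule oc_cong) auto
qed

section \<open>Simulating a machine with a computed oracle\<close>

text \<open>A tape is coded by the number of its ones, the cells to the left of the head, nearest first, the scanned
  symbol, and the cells to the right. Lists stand for the infinite halves, as cells beyond the
  end of a list are blank. The number of ones is carried along because a tape is read off by counting.\<close>

definition tape_code :: "nat \<Rightarrow> nat \<Rightarrow> nat \<Rightarrow> nat \<Rightarrow> nat" where
  "tape_code w l c r = prod_encode (w, prod_encode (l, prod_encode (c, r)))"

definition tc_ones :: "nat \<Rightarrow> nat" where "tc_ones t = pfst t"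
definition tc_left :: "nat \<Rightarrow> nat" where "tc_left t = pfst (psnd t)"
definition tc_cur :: "nat \<Rightarrow> nat" where "tc_cur t = pfst (psnd (psnd t))"
definition tc_right :: "nat \<Rightarrow> nat" where "tc_right t = psnd (psnd (psnd t))"

lemma tc_simps [simp]:
  "tc_ones (tape_code w l c r) = w" "tc_left (tape_code w l c r) = l"
  "tc_cur (tape_code w l c r) = c" "tc_right (tape_code w l c r) = r"
  by (auto simp: tape_code_def tc_ones_def tc_left_def tc_cur_def tc_right_def)

definition tape_coded :: "tape \<Rightarrow> nat \<Rightarrow> bool" where
  "tape_coded t c \<longleftrightarrow> finite {i. fst t i = 1} \<and> tc_ones c = tape_number t \<and> tc_cur c = read_tape t \<and>
     (\<forall>j. fst t (snd t - 1 - int j) = nthc (tc_left c) j) \<and>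
     (\<forall>j. fst t (snd t + 1 + int j) = nthc (tc_right c) j)"

fun move_code :: "move \<Rightarrow> nat" where
  "move_code Left = 0" | "move_code Stay = 1" | "move_code Right = 2"

definition act_code :: "nat \<Rightarrow> nat \<Rightarrow> nat \<Rightarrow> nat" where
  "act_code b d t =
    (let w = tc_ones t + (if b = 1 then 1 else 0) - (if tc_cur t = 1 then 1 else 0) in
     if d = 0 then tape_code w (tlc (tc_left t)) (hdc (tc_left t)) (consc b (tc_right t))
     else if d = 1 then tape_code w (tc_left t) b (tc_right t)
     else tape_code w (consc b (tc_left t)) (hdc (tc_right t)) (tlc (tc_right t)))"

lemma card_ones_upd:
  fixes f :: "int \<Rightarrow> nat"
  assumes "finite {i. f i = 1}"
  shows "finite {i. (f(h := b)) i = 1}"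
    and "card {i. (f(h := b)) i = 1} = card {i. f i = 1} + (if b = 1 then 1 else 0) - (if f h = 1 then 1 else 0)"
proof -
  have e: "{i. (f(h := b)) i = 1} = (if b = 1 then insert h else id) ({i. f i = 1} - {h})"
    by auto
  show "finite {i. (f(h := b)) i = 1}" using assms unfolding e by auto
  show "card {i. (f(h := b)) i = 1} = card {i. f i = 1} + (if b = 1 then 1 else 0) - (if f h = 1 then 1 else 0)"
    unfolding e using assms by (auto simp: card_insert_if card_Diff_singleton_if card_gt_0_iff Suc_leI)
qed

lemma tape_coded_act:
  assumes "tape_coded t c"
  shows "tape_coded (act (b, d) t) (act_code b (move_code d) c)"
proof -
  obtain f h where t: "t = (f, h)" by (cases t)
  have fin: "finite {i. f i = 1}" and w: "tc_ones c = card {i. f i = 1}" and cur: "tc_cur c = f h"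
    and L: "\<And>j. f (h - 1 - int j) = nthc (tc_left c) j" and R: "\<And>j. f (h + 1 + int j) = nthc (tc_right c) j"
    using assms by (auto simp: tape_coded_def t tape_number_def read_tape_def)
  note ones = card_ones_upd[OF fin, of h b]
  have L0: "f (h - 1) = hdc (tc_left c)" using L[of 0] by (simp add: nthc_0)
  have R0: "f (h + 1) = hdc (tc_right c)" using R[of 0] by (simp add: nthc_0)
  have L': "f (h - 2 - int j) = nthc (tlc (tc_left c)) j" for j
    using L[of "Suc j"] by (simp add: nthc_tlc algebra_simps)
  have R': "f (2 + h + int j) = nthc (tlc (tc_right c)) j" for j
    using R[of "Suc j"] by (simp add: nthc_tlc algebra_simps)
  show ?thesis
  proof (cases d)
    case Left
    have "(f(h := b)) (h - 1 + 1 + int j) = nthc (consc b (tc_right c)) j" for j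
      using R by (cases j) (auto simp: algebra_simps)
    then show ?thesis
      using ones L0 L' by (auto simp: tape_coded_def act_code_def Let_def t Left tape_number_def read_tape_def w cur)
  next
    case Stay
    then show ?thesis
      using ones L R by (auto simp: tape_coded_def act_code_def Let_def t tape_number_def read_tape_def w cur)
  next
    case Right
    have "(f(h := b)) (h + 1 - 1 - int j) = nthc (consc b (tc_left c)) j" for j
      using L by (cases j) (auto simp: algebra_simps)
    then show ?thesis
      using ones R0 R' by (auto simp: tape_coded_def act_code_def Let_def t Right tape_number_def read_tape_def w cur)
  qed
qed

definition unary_code :: "nat \<Rightarrow> nat" where
  "unary_code n = tape_code n 0 (if n = 0 then 0 else 1) (rec_nat 0 (\<lambda>_ r. consc 1 r) (n - 1))"

lemma nthc_ones: "nthc (rec_nat 0 (\<lambda>_ r. consc 1 r) n) j = (if j < n then 1 else 0)"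
proof (induction n arbitrary: j)
  case (Suc n)
  then show ?case by (cases j) auto
qed simp

lemma tape_coded_unary: "tape_coded (unary n) (unary_code n)"
proof -
  have "finite {i. fst (unary n) i = 1}"
    by (rule finite_subset[of _ "{0..<int n}"]) (auto simp: unary_def split: if_splits)
  then show ?thesis
    using tape_number_holds[OF holds_unary, of n]
    by (auto simp: tape_coded_def unary_code_def nthc_ones[unfolded One_nat_def] unary_def read_tape_def)
qed

lemma oc_tape_code [comp_intros]:
  assumes "oracle_computable A w" "oracle_computable A l" "oracle_computable A c" "oracle_computable A r"
  shows "oracle_computable A (\<lambda>\<gamma> x. tape_code (w \<gamma> x) (l \<gamma> x) (c \<gamma> x) (r \<gamma> x))"
  unfolding tape_code_def by (intro comp_intros assms)

lemma oc_tc [comp_intros]: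
  assumes "oracle_computable A t"
  shows "oracle_computable A (\<lambda>\<gamma> x. tc_ones (t \<gamma> x))" "oracle_computable A (\<lambda>\<gamma> x. tc_left (t \<gamma> x))"
    "oracle_computable A (\<lambda>\<gamma> x. tc_cur (t \<gamma> x))" "oracle_computable A (\<lambda>\<gamma> x. tc_right (t \<gamma> x))"
  unfolding tc_ones_def tc_left_def tc_cur_def tc_right_def by (intro comp_intros assms)+

lemma oc_act_code [comp_intros]:
  assumes "oracle_computable A b" "oracle_computable A d" "oracle_computable A t"
  shows "oracle_computable A (\<lambda>\<gamma> x. act_code (b \<gamma> x) (d \<gamma> x) (t \<gamma> x))"
  unfolding act_code_def Let_def by (intro comp_intros assms)

lemma oc_unary_code [comp_intros]:
  assumes "oracle_computable A n"
  shows "oracle_computable A (\<lambda>\<gamma> x. unary_code (n \<gamma> x))"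
  unfolding unary_code_def by (intro comp_intros assms)

definition scan_codes :: "otm \<Rightarrow> nat set" where
  "scan_codes M = (\<lambda>(q, rs). prod_encode (q, list_encode rs)) `
     ({..<states M} \<times> {rs. set rs \<subseteq> {..<symbols M} \<and> length rs = tapes M})"

lemma finite_scan_codes: "finite (scan_codes M)"
  unfolding scan_codes_def by (intro finite_imageI finite_cartesian_product finite_lists_length_eq) auto

definition delta_code :: "otm \<Rightarrow> nat \<Rightarrow> nat \<times> (nat \<times> move) list" where
  "delta_code M z = delta M (pfst z) (list_decode (psnd z))"

definition on_scan :: "otm \<Rightarrow> (nat \<Rightarrow> nat) \<Rightarrow> nat \<Rightarrow> nat" where
  "on_scan M h z = (if z \<in> scan_codes M then h z else 0)"

lemma oc_on_scan [comp_intros]: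
  "oracle_computable A a \<Longrightarrow> oracle_computable A (\<lambda>\<gamma> x. on_scan M h (a \<gamma> x))"
  unfolding on_scan_def by (rule oc_finite_table[OF finite_scan_codes])

definition step_code :: "otm \<Rightarrow> (nat \<Rightarrow> nat) \<Rightarrow> nat \<Rightarrow> nat" where
  "step_code M \<gamma> C =
    (if pfst C = halt M then C
     else if pfst C = query M then
       prod_encode (answer M, tup (\<lambda>i. if i = 1 then unary_code (\<gamma> (tc_ones (nthc (psnd C) 1)))
                                       else nthc (psnd C) i) (tapes M))
     else prod_encode
       (on_scan M (\<lambda>z. fst (delta_code M z)) (prod_encode (pfst C, tup (\<lambda>i. tc_cur (nthc (psnd C) i)) (tapes M))),
        tup (\<lambda>i. act_code
            (on_scan M (\<lambda>z. fst (snd (delta_code M z) ! i)) (prod_encode (pfst C, tup (\<lambda>i. tc_cur (nthc (psnd C) i)) (tapes M))))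
            (on_scan M (\<lambda>z. move_code (snd (snd (delta_code M z) ! i))) (prod_encode (pfst C, tup (\<lambda>i. tc_cur (nthc (psnd C) i)) (tapes M))))
            (nthc (psnd C) i)) (tapes M)))"

definition config_coded :: "otm \<Rightarrow> nat \<times> tape list \<Rightarrow> nat \<Rightarrow> bool" where
  "config_coded M C c \<longleftrightarrow> fst C < states M \<and> length (snd C) = tapes M \<and> pfst c = fst C \<and>
     (\<forall>i<tapes M. range (fst (snd C ! i)) \<subseteq> {..<symbols M} \<and> tape_coded (snd C ! i) (nthc (psnd c) i))"

text \<open>A machine step becomes an arithmetical operation on codes. The invariant that states and symbols stay within the bounds of
  the machine makes the finite part \<open>scan_codes\<close> of the transition function sufficient.\<close>

lemma config_coded_step:
  assumes wf: "wf_otm M" and C: "config_coded M C c"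
  shows "config_coded M (otm_step M \<gamma> C) (step_code M \<gamma> c)"
proof -
  obtain q ts where Cq: "C = (q, ts)" by (cases C)
  have q: "q < states M" and len: "length ts = tapes M" and cq: "pfst c = q"
    and sym: "\<And>i j. i < tapes M \<Longrightarrow> fst (ts ! i) j < symbols M"
    and tc: "\<And>i. i < tapes M \<Longrightarrow> tape_coded (ts ! i) (nthc (psnd c) i)"
    using C by (auto simp: config_coded_def Cq)
  have M: "2 \<le> tapes M" "2 \<le> symbols M" "answer M < states M"
    using wf by (auto simp: wf_otm_def)
  consider "q = halt M" | "q \<noteq> halt M" "q = query M" | "q \<noteq> halt M" "q \<noteq> query M" by blast
  then show ?thesis
  proof cases
    case 1
    then show ?thesis using C by (simp add: otm_step.simps step_code_def Cq cq)
  next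
    case 2
    have "tc_ones (nthc (psnd c) (Suc 0)) = tape_number (ts ! Suc 0)"
      using tc[of 1] M by (simp add: tape_coded_def)
    moreover have "range (fst (unary n)) \<subseteq> {..<symbols M}" for n
      using M by (auto simp: unary_def)
    ultimately show ?thesis
      using 2 M len sym tc tape_coded_unary
      by (auto simp: config_coded_def otm_step.simps step_code_def Cq cq nth_list_update)
  next
    case 3
    define rs where "rs = map read_tape ts"
    define z where "z = prod_encode (q, list_encode rs)"
    have "map (\<lambda>i. tc_cur (nthc (psnd c) i)) [0..<tapes M] = rs"
      using tc len by (auto simp: rs_def tape_coded_def list_eq_iff_nth_eq)
    then have z: "prod_encode (pfst c, tup (\<lambda>i. tc_cur (nthc (psnd c) i)) (tapes M)) = z"
      by (simp add: tup_def z_def cq)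
    have "\<forall>i<tapes M. read_tape (ts ! i) < symbols M"
      using sym by (simp add: read_tape_def)
    then have "\<forall>t\<in>set ts. read_tape t < symbols M"
      using len by (metis in_set_conv_nth)
    then have rs: "set rs \<subseteq> {..<symbols M}" "length rs = tapes M"
      using len by (simp_all add: rs_def image_subset_iff)
    then have zin: "z \<in> scan_codes M" using q unfolding scan_codes_def z_def by (intro rev_image_eqI[of "(q, rs)"]) auto
    obtain q' as where d: "delta M q rs = (q', as)" by fastforce
    have dz: "delta_code M z = (q', as)" by (simp add: delta_code_def z_def d)
    have wfd: "q' < states M" "length as = tapes M" "fst ` set as \<subseteq> {..<symbols M}"
      using wf q rs d unfolding wf_otm_def by (metis fst_conv snd_conv)+
    have step: "otm_step M \<gamma> C = (q', map2 act as ts)"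
      using 3 d by (simp add: Cq otm_step.simps rs_def)
    have code: "step_code M \<gamma> c = prod_encode (q', tup (\<lambda>i. act_code (fst (as ! i)) (move_code (snd (as ! i))) (nthc (psnd c) i)) (tapes M))"
      using 3 unfolding step_code_def z by (simp add: cq on_scan_def zin dz)
    have "range (fst (act (as ! i) (ts ! i))) \<subseteq> {..<symbols M}" if "i < tapes M" for i
    proof -
      have "fst (as ! i) < symbols M" using wfd that by (metis image_subset_iff lessThan_iff nth_mem)
      then show ?thesis using sym[OF that] by (cases "as ! i"; cases "ts ! i") auto
    qed
    moreover have "tape_coded (act (as ! i) (ts ! i)) (act_code (fst (as ! i)) (move_code (snd (as ! i))) (nthc (psnd c) i))"
      if "i < tapes M" for i
      using tape_coded_act[OF tc[OF that], of "fst (as ! i)" "snd (as ! i)"] by simp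
    ultimately show ?thesis
      unfolding step code using wfd len by (auto simp: config_coded_def)
  qed
qed

definition init_code :: "otm \<Rightarrow> nat \<Rightarrow> nat" where
  "init_code M n = prod_encode (start M, tup (\<lambda>i. if i = 0 then unary_code n else unary_code 0) (tapes M))"

lemma config_coded_init:
  assumes "wf_otm M"
  shows "config_coded M (otm_init M n) (init_code M n)"
proof -
  have "range (fst (unary n)) \<subseteq> {..<symbols M}" for n
    using assms by (auto simp: unary_def wf_otm_def)
  then show ?thesis using assms tape_coded_unary
    by (auto simp: config_coded_def otm_init_def init_code_def wf_otm_def nth_Cons split: nat.splits)
qed

lemma config_coded_run:
  assumes "wf_otm M"
  shows "config_coded M ((otm_step M \<gamma> ^^ t) (otm_init M n)) (rec_nat (init_code M n) (\<lambda>_. step_code M \<gamma>) t)"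
  by (induction t) (auto intro: config_coded_init config_coded_step assms)

lemma otm_halted_stays:
  "(otm_step M \<gamma> ^^ t) a = (halt M, ts) \<Longrightarrow> (otm_step M \<gamma> ^^ (k + t)) a = (halt M, ts)"
  by (induction k) (auto simp: otm_step.simps)

lemma otm_outputs_unique:
  assumes "otm_outputs M \<gamma> n m" "otm_outputs M \<gamma> n m'"
  shows "m = m'"
proof -
  obtain t ts t' ts' where 1: "(otm_step M \<gamma> ^^ t) (otm_init M n) = (halt M, ts)" "tape_number (ts ! 0) = m"
    and 2: "(otm_step M \<gamma> ^^ t') (otm_init M n) = (halt M, ts')" "tape_number (ts' ! 0) = m'"
    using assms by (auto simp: otm_outputs_def)
  from otm_halted_stays[OF 1(1), of t'] otm_halted_stays[OF 2(1), of t] have "ts = ts'"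
    by (simp add: add.commute)
  with 1 2 show ?thesis by simp
qed

text \<open>A machine is run with the oracle \<open>\<Gamma> \<gamma> x\<close> in place of \<open>\<gamma>\<close>: a query step evaluates \<open>\<Gamma>\<close>. The number of steps is found by a search
  for a halting configuration, which succeeds by the third assumption.\<close>

theorem oc_simulate:
  assumes wf: "wf_otm M"
    and \<Gamma>: "oracle_computable A (\<lambda>\<gamma> p. \<Gamma> \<gamma> (pfst p) (psnd p))"
    and total: "\<And>\<gamma> x n. \<gamma> \<in> A \<Longrightarrow> \<exists>m. otm_outputs M (\<Gamma> \<gamma> x) n m"
  obtains R where "oracle_computable A (\<lambda>\<gamma> p. R \<gamma> (pfst p) (psnd p))"
    and "\<And>\<gamma> x n. \<gamma> \<in> A \<Longrightarrow> otm_outputs M (\<Gamma> \<gamma> x) n (R \<gamma> x n)"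
proof -
  let ?run = "\<lambda>\<gamma> x n. rec_nat (init_code M n) (\<lambda>_. step_code M (\<Gamma> \<gamma> x))"
  let ?T = "\<lambda>\<gamma> x n. LEAST t. pfst (?run \<gamma> x n t) = halt M"
  let ?R = "\<lambda>\<gamma> x n. tc_ones (nthc (psnd (?run \<gamma> x n (?T \<gamma> x n))) 0)"
  have halts: "\<exists>t. pfst (?run \<gamma> x n t) = halt M" if \<gamma>: "\<gamma> \<in> A" for \<gamma> x n
  proof -
    obtain t ts where "(otm_step M (\<Gamma> \<gamma> x) ^^ t) (otm_init M n) = (halt M, ts)"
      using total[OF \<gamma>, of x n] by (auto simp: otm_outputs_def)
    then show ?thesis using config_coded_run[OF wf, where \<gamma> = "\<Gamma> \<gamma> x" and t = t and n = n]
      by (auto simp: config_coded_def intro!: exI[of _ t])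
  qed
  have G: "oracle_computable A (\<lambda>\<gamma> x. \<Gamma> \<gamma> (f \<gamma> x) (g \<gamma> x))"
    if f: "oracle_computable A f" and g: "oracle_computable A g" for f g
  proof -
    have "oracle_computable A (\<lambda>\<gamma> x. prod_encode (f \<gamma> x, g \<gamma> x))" by (intro comp_intros f g)
    from oc_comp[OF \<Gamma> this] show ?thesis by simp
  qed
  show ?thesis
  proof
    have run: "oracle_computable A (\<lambda>\<gamma> x. ?run \<gamma> (f \<gamma> x) (g \<gamma> x) (h \<gamma> x))"
      if f: "oracle_computable A f" and g: "oracle_computable A g" and h: "oracle_computable A h" for f g h
    proof -
      have f': "oracle_computable A (\<lambda>\<gamma> x. f \<gamma> (pfst x))" by (rule oc_comp[OF f]) (intro comp_intros)
      show ?thesis unfolding step_code_def init_code_def by (intro comp_intros G f' f g h)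
    qed
    have T: "oracle_computable A (\<lambda>\<gamma> p. ?T \<gamma> (pfst p) (psnd p))"
      by (intro comp_intros run halts)
    show "oracle_computable A (\<lambda>\<gamma> p. ?R \<gamma> (pfst p) (psnd p))"
      by (intro comp_intros run T)
    fix \<gamma> x n assume \<gamma>: "\<gamma> \<in> A"
    obtain q ts where qts: "(otm_step M (\<Gamma> \<gamma> x) ^^ ?T \<gamma> x n) (otm_init M n) = (q, ts)" by fastforce
    have cc: "config_coded M (q, ts) (?run \<gamma> x n (?T \<gamma> x n))"
      using config_coded_run[OF wf, where \<gamma> = "\<Gamma> \<gamma> x" and t = "?T \<gamma> x n" and n = n] by (simp only: qts)
    have "pfst (?run \<gamma> x n (?T \<gamma> x n)) = halt M" by (rule LeastI_ex[OF halts[OF \<gamma>]])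
    with cc have "q = halt M" by (simp add: config_coded_def)
    moreover have "tape_number (ts ! 0) = ?R \<gamma> x n"
      using cc wf by (auto simp: config_coded_def tape_coded_def wf_otm_def)
    ultimately show "otm_outputs M (\<Gamma> \<gamma> x) n (?R \<gamma> x n)"
      using qts unfolding otm_outputs_def by blast
  qed
qed

text \<open>The output does not depend on the oracle, so the machine can be simulated with the constant oracle 0.\<close>

corollary oc_turing_computable:
  assumes "turing_computable c" "oracle_computable A a"
  shows "oracle_computable A (\<lambda>\<gamma> x. c (a \<gamma> x))"
proof -
  obtain M where M: "wf_otm M" "\<And>\<gamma> n. otm_outputs M \<gamma> n (c n)"
    using assms(1) by (auto simp: turing_computable_def)
  have "oracle_computable A (\<lambda>\<gamma> p. (\<lambda>_ _ _. 0 :: nat) \<gamma> (pfst p) (psnd p))" by (simp add: oc_const)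
  from oc_simulate[OF M(1) this] M(2) obtain R
    where R: "oracle_computable A (\<lambda>\<gamma> p. R \<gamma> (pfst p) (psnd p))"
      "\<And>\<gamma> x n. \<gamma> \<in> A \<Longrightarrow> otm_outputs M (\<lambda>_. 0) n (R \<gamma> x n)" by blast
  have "oracle_computable A (\<lambda>\<gamma> x. prod_encode (0, a \<gamma> x))" by (intro comp_intros assms)
  from oc_comp[OF R(1) this] have "oracle_computable A (\<lambda>\<gamma> x. R \<gamma> 0 (a \<gamma> x))" by simp
  then show ?thesis
    by (rule oc_cong) (use R(2) M(2) otm_outputs_unique in blast)
qed

section \<open>Comparison of tables\<close>

definition int_pos :: "nat \<Rightarrow> nat" where "int_pos m = (if m mod 2 = 0 then m div 2 else 0)"
definition int_neg :: "nat \<Rightarrow> nat" where "int_neg m = (if m mod 2 = 0 then 0 else Suc (m div 2))"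

text \<open>Integers and rationals are handled through differences of natural numbers, so that the comparison of
  rationals becomes one of natural numbers.\<close>

lemma int_decode_eq_diff: "int_decode m = int (int_pos m) - int (int_neg m)"
  by (auto simp: int_decode_def sum_decode_def int_pos_def int_neg_def even_iff_mod_2_eq_zero)

lemma int_pos_neg: "int_pos m = 0 \<or> int_neg m = 0"
  by (simp add: int_pos_def int_neg_def)

text \<open>The number coded by \<open>n\<close> is \<open>(rat_pos n - rat_neg n) / rat_den n\<close> with a positive denominator. A
  negative denominator exchanges the two parts of the numerator, and denominator 0 codes the number 0.\<close>

definition rat_pos :: "nat \<Rightarrow> nat" where
  "rat_pos n = (if 0 < int_pos (psnd n) then int_pos (pfst n) else if 0 < int_neg (psnd n) then int_neg (pfst n) else 0)"
definition rat_neg :: "nat \<Rightarrow> nat" where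
  "rat_neg n = (if 0 < int_pos (psnd n) then int_neg (pfst n) else if 0 < int_neg (psnd n) then int_pos (pfst n) else 0)"
definition rat_den :: "nat \<Rightarrow> nat" where
  "rat_den n = (if 0 < int_pos (psnd n) then int_pos (psnd n) else if 0 < int_neg (psnd n) then int_neg (psnd n) else 1)"

lemma rat_den_pos: "0 < rat_den n"
  by (simp add: rat_den_def)

lemma nat_to_rat_surj_eq: "nat_to_rat_surj n = (of_nat (rat_pos n) - of_nat (rat_neg n)) / of_nat (rat_den n)"
proof -
  have "nat_to_rat_surj n = of_int (int_decode (pfst n)) / of_int (int_decode (psnd n))"
    by (simp add: nat_to_rat_surj_def pfst_def psnd_def Fract_of_int_quotient split: prod.splits)
  then show ?thesis
    using int_pos_neg[of "psnd n"]
    by (auto simp: int_decode_eq_diff rat_pos_def rat_neg_def rat_den_def field_simps)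
qed

lemma oc_rat [comp_intros]:
  assumes "oracle_computable A a"
  shows "oracle_computable A (\<lambda>\<gamma> x. rat_pos (a \<gamma> x))" "oracle_computable A (\<lambda>\<gamma> x. rat_neg (a \<gamma> x))"
    "oracle_computable A (\<lambda>\<gamma> x. rat_den (a \<gamma> x))"
  unfolding rat_pos_def rat_neg_def rat_den_def int_pos_def int_neg_def by (intro comp_intros assms)+

lemma scaled_rat_le_iff:
  "of_nat k * nat_to_rat_surj q \<le> of_nat k' * nat_to_rat_surj q' \<longleftrightarrow>
    k * rat_pos q * rat_den q' + k' * rat_neg q' * rat_den q \<le> k' * rat_pos q' * rat_den q + k * rat_neg q * rat_den q'"
proof -
  let ?D = "of_nat (rat_den q) :: rat" and ?D' = "of_nat (rat_den q') :: rat"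
  have D: "?D > 0" "?D' > 0" using rat_den_pos by auto
  have "of_nat k * nat_to_rat_surj q \<le> of_nat k' * nat_to_rat_surj q' \<longleftrightarrow>
    of_nat k * (of_nat (rat_pos q) - of_nat (rat_neg q)) * ?D' \<le> of_nat k' * (of_nat (rat_pos q') - of_nat (rat_neg q')) * ?D"
    unfolding nat_to_rat_surj_eq using D by (simp add: field_simps)
  also have "\<dots> \<longleftrightarrow> (of_nat (k * rat_pos q * rat_den q' + k' * rat_neg q' * rat_den q) :: rat) \<le>
      of_nat (k' * rat_pos q' * rat_den q + k * rat_neg q * rat_den q')"
    by (simp add: algebra_simps)
  finally show ?thesis by (simp only: of_nat_le_iff)
qed

lemma od_scaled_rat_le [comp_intros]:
  assumes "oracle_computable A k" "oracle_computable A q" "oracle_computable A k'" "oracle_computable A q'"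
  shows "oracle_decidable A (\<lambda>\<gamma> x. of_nat (k \<gamma> x) * nat_to_rat_surj (q \<gamma> x) \<le> of_nat (k' \<gamma> x) * nat_to_rat_surj (q' \<gamma> x))"
  unfolding scaled_rat_le_iff by (intro comp_intros assms)

lemma od_scaled_rat_eq [comp_intros]:
  assumes "oracle_computable A k" "oracle_computable A q" "oracle_computable A q'"
  shows "oracle_decidable A (\<lambda>\<gamma> x. of_nat (k \<gamma> x) * nat_to_rat_surj (q \<gamma> x) = nat_to_rat_surj (q' \<gamma> x))"
  using od_conj[OF od_scaled_rat_le[OF assms(1,2) oc_const[of A 1] assms(3)] od_scaled_rat_le[OF oc_const[of A 1] assms(3,1,2)]]
  by (simp add: eq_iff conj_commute)

lemma od_rat_le [comp_intros]:
  assumes "oracle_computable A q" "oracle_computable A q'"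
  shows "oracle_decidable A (\<lambda>\<gamma> x. nat_to_rat_surj (q \<gamma> x) \<le> nat_to_rat_surj (q' \<gamma> x))"
  using od_scaled_rat_le[OF oc_const[of A 1] assms(1) oc_const[of A 1] assms(2)] by simp

definition digit :: "nat \<Rightarrow> nat \<Rightarrow> nat \<Rightarrow> nat" where
  "digit b y i = y div b ^ i mod b"

lemma ex_digits:
  assumes "\<And>i. v i < b"
  shows "\<exists>y<b ^ N. \<forall>i<N. digit b y i = v i"
proof (induction N)
  case (Suc N)
  then obtain y where y: "y < b ^ N" "\<And>i. i < N \<Longrightarrow> digit b y i = v i" by auto
  have b: "0 < b" using assms[of 0] by simp
  let ?y = "y + v N * b ^ N"
  have "?y < b ^ N + v N * b ^ N" using y by simp
  also have "\<dots> = Suc (v N) * b ^ N" by simp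
  also have "\<dots> \<le> b * b ^ N" using assms[of N] by (intro mult_le_mono) auto
  finally have "?y < b ^ Suc N" by simp
  moreover have "digit b ?y i = v i" if "i < Suc N" for i
  proof (cases "i = N")
    case True
    then show ?thesis using y b assms[of N] by (simp add: digit_def)
  next
    case False
    then have "i < N" using that by simp
    then obtain d where d: "N = Suc d + i" by (metis add.commute less_imp_Suc_add add_Suc_right)
    have "?y = y + (v N * b ^ Suc d) * b ^ i" by (simp add: d power_add)
    then have "?y div b ^ i = y div b ^ i + v N * b ^ Suc d"
      using b by (simp only: div_mult_self1) simp
    then have "digit b ?y i = digit b y i"
      by (simp add: digit_def mult.left_commute)
    with y(2)[OF \<open>i < N\<close>] show ?thesis by simp
  qed
  ultimately show ?case by blast
qed auto

text \<open>The entry that the table \<open>c\<close> assigns to the pattern with digit \<open>v i\<close> at position \<open>i\<close>, as a code of a rational.\<close>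

definition table_val :: "nat \<Rightarrow> nat \<Rightarrow> (nat \<Rightarrow> nat) \<Rightarrow> nat" where
  "table_val b c v = nthc (psnd c) (\<Sum>j<lengthc (pfst c). v (nthc (pfst c) j) * b ^ j)"

lemma table_val_decode:
  fixes \<alpha> :: "'a::finite \<Rightarrow> nat"
  assumes "valid_table TYPE('a) (decode_table c)" "\<And>y. \<alpha> y < CARD('a)"
  shows "table_fun e \<alpha> (decode_table c) x = nat_to_rat_surj (table_val CARD('a) c (\<lambda>i. \<alpha> (x (e i))))"
proof -
  let ?is = "list_decode (pfst c)" and ?qs = "list_decode (psnd c)"
  have d: "decode_table c = (?is, map nat_to_rat_surj ?qs)"
    by (simp add: decode_table_def pfst_def psnd_def split: prod.splits)
  let ?h = "horner_sum (\<lambda>i. \<alpha> (x (e i))) CARD('a) ?is"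
  have len: "length ?qs = CARD('a) ^ length ?is" using assms(1) by (simp add: d)
  have "?h < length ?qs"
    unfolding len by (rule horner_sum_less_power) (rule assms(2))
  moreover have "?h = (\<Sum>j<lengthc (pfst c). \<alpha> (x (e (nthc (pfst c) j))) * CARD('a) ^ j)"
    by (simp add: horner_sum_eq_sum lengthc_def nthc_eq atLeast0LessThan)
  ultimately show ?thesis by (simp add: d table_val_def nthc_eq)
qed

lemma pfst_le: "pfst x \<le> x" and psnd_le: "psnd x \<le> x"
  using le_prod_encode_1[of "pfst x" "psnd x"] le_prod_encode_2[of "psnd x" "pfst x"]
  by (simp_all add: pfst_def psnd_def)

lemma nthc_le: "nthc c i \<le> c"
proof -
  have tl: "tlc d \<le> d" for d using psnd_le[of "d - 1"] by (simp add: tlc_def)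
  have "rec_nat c (\<lambda>_. tlc) i \<le> c" by (induction i) (auto intro: le_trans[OF tl])
  moreover have "hdc d \<le> d" for d using pfst_le[of "d - 1"] by (simp add: hdc_def)
  ultimately show ?thesis unfolding nthc_def using le_trans by blast
qed

lemma table_val_cong:
  assumes "\<And>i. i \<le> c \<Longrightarrow> v i = w i"
  shows "table_val b c v = table_val b c w"
proof -
  have "nthc (pfst c) j \<le> c" for j using nthc_le pfst_le le_trans by blast
  then show ?thesis unfolding table_val_def using assms by simp
qed

text \<open>The tables \<open>c\<close> and \<open>c'\<close> mention only positions up to \<open>c + c'\<close>, since list entries are bounded by the code of the list. Every
  pattern on these positions is the digit sequence of some \<open>y\<close> below the bound, so a bounded quantifier suffices to
  compare the two tables as functions, even if they refer to different finite sets.\<close>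

definition table_scaled :: "nat \<Rightarrow> nat \<Rightarrow> nat \<Rightarrow> nat \<Rightarrow> bool" where
  "table_scaled b k c c' \<longleftrightarrow> (\<forall>y<b ^ Suc (c + c').
     of_nat k * nat_to_rat_surj (table_val b c (digit b y)) = nat_to_rat_surj (table_val b c' (digit b y)))"

lemma oc_table_val_digit [comp_intros]:
  assumes "oracle_computable A c" "oracle_computable A y"
  shows "oracle_computable A (\<lambda>\<gamma> x. table_val b (c \<gamma> x) (digit b (y \<gamma> x)))"
proof -
  have *: "oracle_computable A (\<lambda>\<gamma> p. table_val b (pfst p) (digit b (psnd p)))"
    unfolding table_val_def digit_def by (intro comp_intros)
  have "oracle_computable A (\<lambda>\<gamma> x. prod_encode (c \<gamma> x, y \<gamma> x))" by (intro comp_intros assms)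
  from oc_comp[OF * this] show ?thesis by simp
qed

lemma od_table_scaled [comp_intros]:
  assumes "oracle_computable A k" "oracle_computable A c" "oracle_computable A c'"
  shows "oracle_decidable A (\<lambda>\<gamma> x. table_scaled b (k \<gamma> x) (c \<gamma> x) (c' \<gamma> x))"
proof -
  have *: "oracle_decidable A (\<lambda>\<gamma> p. table_scaled b (pfst p) (pfst (psnd p)) (psnd (psnd p)))"
    unfolding table_scaled_def by (intro comp_intros)
  have "oracle_computable A (\<lambda>\<gamma> x. prod_encode (k \<gamma> x, prod_encode (c \<gamma> x, c' \<gamma> x)))" by (intro comp_intros assms)
  from od_comp[OF * this] show ?thesis by simp
qed

lemma table_scaled_iff:
  fixes e :: "nat \<Rightarrow> 'g" and \<alpha> :: "'a::finite \<Rightarrow> nat"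
  assumes e: "bij e" and \<alpha>: "bij_betw \<alpha> UNIV {..<CARD('a)}"
    and v: "valid_table TYPE('a) (decode_table c)" "valid_table TYPE('a) (decode_table c')"
  shows "table_scaled CARD('a) k c c' \<longleftrightarrow>
    (\<forall>x. of_nat k * table_fun e \<alpha> (decode_table c) x = table_fun e \<alpha> (decode_table c') x)"
proof -
  let ?b = "CARD('a)"
  have \<alpha>_less: "\<alpha> y < ?b" for y using bij_betwE[OF \<alpha>] by auto
  note tf = table_val_decode[OF v(1) \<alpha>_less] table_val_decode[OF v(2) \<alpha>_less]
  show ?thesis
  proof (intro iffI allI)
    fix x assume *: "table_scaled ?b k c c'"
    obtain y where y: "y < ?b ^ Suc (c + c')" "\<And>i. i < Suc (c + c') \<Longrightarrow> digit ?b y i = \<alpha> (x (e i))"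
      using ex_digits[where v = "\<lambda>i. \<alpha> (x (e i))", OF \<alpha>_less] by metis
    have "table_val ?b c (digit ?b y) = table_val ?b c (\<lambda>i. \<alpha> (x (e i)))"
      "table_val ?b c' (digit ?b y) = table_val ?b c' (\<lambda>i. \<alpha> (x (e i)))"
      by (rule table_val_cong, use y in simp)+
    with * y(1) show "of_nat k * table_fun e \<alpha> (decode_table c) x = table_fun e \<alpha> (decode_table c') x"
      unfolding table_scaled_def tf by metis
  next
    assume *: "\<forall>x. of_nat k * table_fun e \<alpha> (decode_table c) x = table_fun e \<alpha> (decode_table c') x"
    show "table_scaled ?b k c c'"
      unfolding table_scaled_def
    proof (intro allI impI)
      fix y
      define x where "x = (\<lambda>g. inv_into UNIV \<alpha> (digit ?b y (inv e g)))"
      have "\<alpha> (x (e i)) = digit ?b y i" for i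
      proof -
        have "digit ?b y i \<in> range \<alpha>" using \<alpha> by (simp add: bij_betw_def digit_def)
        then show ?thesis using e by (simp add: x_def f_inv_into_f bij_is_inj inv_f_f)
      qed
      then have "(\<lambda>i. \<alpha> (x (e i))) = digit ?b y" by blast
      with *[rule_format, of x] show "of_nat k * nat_to_rat_surj (table_val ?b c (digit ?b y)) =
          nat_to_rat_surj (table_val ?b c' (digit ?b y))"
        unfolding tf by simp
    qed
  qed
qed

section \<open>Computability from above of the limit of a rescaled function\<close>

text \<open>The machine for \<open>P\<close> is run on all multiples of \<open>\<phi>\<close>, and the output is the running minimum of the results divided by the
  factors. No output is below \<open>f \<phi>\<close> because of \<open>ge\<close>; by \<open>lim\<close> some multiple, and then some run on it, comes
  as close to \<open>f \<phi>\<close> as desired.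

  An approximation of \<open>\<phi>\<close> within \<open>2\<^sup>-\<^sup>(\<^sup>n\<^sup>+\<^sup>k\<^sup>+\<^sup>1\<^sup>)\<close>, multiplied by \<open>k + 1 \<le> 2\<^sup>k\<^sup>+\<^sup>1\<close>, is one of the multiple
  within \<open>2\<^sup>-\<^sup>n\<close>. A table of the multiplied function exists in the enumeration because the function is locally
  constant, and is found by search.\<close>

theorem computable_from_above_rescaled_limit:
  fixes e :: "nat \<Rightarrow> 'g" and \<alpha> :: "'a::{finite,discrete_topology} \<Rightarrow> nat" and s :: "nat \<Rightarrow> lc_table"
    and P f :: "(('g \<Rightarrow> 'a) \<Rightarrow>\<^sub>C real) \<Rightarrow> real"
  assumes e: "bij e" and \<alpha>: "bij_betw \<alpha> UNIV {..<CARD('a)}"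
    and s: "computable_lc_enumeration e \<alpha> s"
    and P: "computable_from_above e \<alpha> s P"
    and ge: "\<And>\<phi> k. f \<phi> \<le> P (real (Suc k) *\<^sub>R \<phi>) / real (Suc k)"
    and lim: "\<And>\<phi>. (\<lambda>k. P (real (Suc k) *\<^sub>R \<phi>) / real (Suc k)) \<longlonglongrightarrow> f \<phi>"
  shows "computable_from_above e \<alpha> s f"
proof -
  define A where "A = {\<gamma>. \<exists>\<phi>. is_oracle e \<alpha> s \<phi> \<gamma>}"
  let ?b = "CARD('a)"
  obtain c where c: "turing_computable c" "\<And>n. s n = decode_table (c n)"
    and valid: "\<And>n. valid_table TYPE('a) (s n)"
    and surj: "\<And>h :: ('g \<Rightarrow> 'a) \<Rightarrow> rat. locally_constant h \<Longrightarrow> \<exists>n. table_fun e \<alpha> (s n) = h"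
    using s unfolding computable_lc_enumeration_def by metis
  note tb = apply_table_bcontfun[OF \<alpha> valid, of e]
  have scaled_iff: "table_scaled ?b k (c n) (c m) \<longleftrightarrow>
      (\<forall>x. of_nat k * table_fun e \<alpha> (s n) x = table_fun e \<alpha> (s m) x)" for k n m
    using table_scaled_iff[OF e \<alpha>, of "c n" "c m"] valid[of n] valid[of m] by (simp add: c(2))
  have ex_scaled: "\<exists>m. table_scaled ?b k (c n) (c m)" for k n
  proof -
    obtain "is" qs where t: "s n = (is, qs)" by fastforce
    have "locally_constant (\<lambda>x. of_nat k * table_fun e \<alpha> (s n) x)"
      unfolding locally_constant_def
    proof (rule exI[of _ "e ` set is"], intro conjI allI impI)
      fix x y :: "'g \<Rightarrow> 'a" assume "\<forall>g\<in>e ` set is. x g = y g"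
      then have "horner_sum (\<lambda>i. \<alpha> (x (e i))) ?b is = horner_sum (\<lambda>i. \<alpha> (y (e i))) ?b is"
        by (auto simp: horner_sum_eq_sum intro!: sum.cong)
      then show "of_nat k * table_fun e \<alpha> (s n) x = of_nat k * table_fun e \<alpha> (s n) y"
        by (simp add: t)
    qed simp
    from surj[OF this] obtain m where "table_fun e \<alpha> (s m) = (\<lambda>x. of_nat k * table_fun e \<alpha> (s n) x)"
      by blast
    then show ?thesis unfolding scaled_iff by (metis (no_types, lifting))
  qed
  \<comment> \<open>the oracle for \<open>k + 1\<close> times \<open>\<phi>\<close>, computed from an oracle \<open>\<gamma>\<close> for \<open>\<phi>\<close>\<close>
  define \<Gamma> where "\<Gamma> \<gamma> k n = (LEAST m. table_scaled ?b (Suc k) (c (\<gamma> (n + Suc k))) (c m))" for \<gamma> k n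
  have \<Gamma>_spec: "table_scaled ?b (Suc k) (c (\<gamma> (n + Suc k))) (c (\<Gamma> \<gamma> k n))" for \<gamma> k n
    unfolding \<Gamma>_def by (rule LeastI_ex[OF ex_scaled])
  have oc_\<Gamma>: "oracle_computable A (\<lambda>\<gamma> p. \<Gamma> \<gamma> (pfst p) (psnd p))"
    unfolding \<Gamma>_def by (intro comp_intros oc_turing_computable[OF c(1)] ex_scaled)
  have scaled_oracle: "is_oracle e \<alpha> s (real (Suc k) *\<^sub>R \<phi>) (\<Gamma> \<gamma> k)" if \<gamma>: "is_oracle e \<alpha> s \<phi> \<gamma>" for \<phi> \<gamma> k
    unfolding is_oracle_def
  proof
    fix n
    let ?n = "\<gamma> (n + Suc k)"
    have "table_bcontfun e \<alpha> (s (\<Gamma> \<gamma> k n)) = real (Suc k) *\<^sub>R table_bcontfun e \<alpha> (s ?n)"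
    proof (rule bcontfun_eqI)
      fix x
      have "table_fun e \<alpha> (s (\<Gamma> \<gamma> k n)) x = of_nat (Suc k) * table_fun e \<alpha> (s ?n) x"
        using \<Gamma>_spec[where \<gamma> = \<gamma> and k = k and n = n] unfolding scaled_iff by simp
      then show "apply_bcontfun (table_bcontfun e \<alpha> (s (\<Gamma> \<gamma> k n))) x =
          apply_bcontfun (real (Suc k) *\<^sub>R table_bcontfun e \<alpha> (s ?n)) x"
        by (simp only: tb scaleR_bcontfun.rep_eq) (simp add: of_rat_mult of_rat_add algebra_simps)
    qed
    then have "norm (table_bcontfun e \<alpha> (s (\<Gamma> \<gamma> k n)) - real (Suc k) *\<^sub>R \<phi>) =
        real (Suc k) * norm (table_bcontfun e \<alpha> (s ?n) - \<phi>)"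
      by (simp only: scaleR_right_diff_distrib[symmetric] norm_scaleR abs_of_nat)
    also have "\<dots> < real (Suc k) * (1/2) ^ (n + Suc k)"
      using \<gamma>[unfolded is_oracle_def, rule_format, of "n + Suc k"] by (intro mult_strict_left_mono) auto
    also have "\<dots> \<le> 2 ^ Suc k * (1/2) ^ (n + Suc k)"
      by (intro mult_right_mono) (use of_nat_less_two_power[of "Suc k", where 'a = real] in auto)
    also have "\<dots> = (1/2) ^ n" by (simp add: power_add power_divide)
    finally show "norm (table_bcontfun e \<alpha> (s (\<Gamma> \<gamma> k n)) - real (Suc k) *\<^sub>R \<phi>) < (1/2) ^ n" .
  qed
  obtain M where M: "wf_otm M" "\<And>\<phi> \<gamma>. is_oracle e \<alpha> s \<phi> \<gamma> \<Longrightarrow>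
      \<exists>r. (\<forall>n. otm_outputs M \<gamma> n (r n)) \<and> decseq (\<lambda>n. nat_to_rat_surj (r n)) \<and>
        (\<lambda>n. of_rat (nat_to_rat_surj (r n))) \<longlonglongrightarrow> P \<phi>"
    using P unfolding computable_from_above_def by blast
  have total: "\<exists>m. otm_outputs M (\<Gamma> \<gamma> k) n m" if "\<gamma> \<in> A" for \<gamma> k n
    using that M(2)[OF scaled_oracle] unfolding A_def by blast
  obtain R where oc_R: "oracle_computable A (\<lambda>\<gamma> p. R \<gamma> (pfst p) (psnd p))"
    and R: "\<And>\<gamma> k n. \<gamma> \<in> A \<Longrightarrow> otm_outputs M (\<Gamma> \<gamma> k) n (R \<gamma> k n)"
    using oc_simulate[OF M(1) oc_\<Gamma> total] by metis
  have R_lim: "decseq (\<lambda>n. nat_to_rat_surj (R \<gamma> k n))"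
      "(\<lambda>n. of_rat (nat_to_rat_surj (R \<gamma> k n))) \<longlonglongrightarrow> P (real (Suc k) *\<^sub>R \<phi>)"
    if \<gamma>: "is_oracle e \<alpha> s \<phi> \<gamma>" for \<phi> \<gamma> k
  proof -
    obtain r where r: "\<And>n. otm_outputs M (\<Gamma> \<gamma> k) n (r n)" "decseq (\<lambda>n. nat_to_rat_surj (r n))"
      "(\<lambda>n. of_rat (nat_to_rat_surj (r n))) \<longlonglongrightarrow> P (real (Suc k) *\<^sub>R \<phi>)"
      using M(2)[OF scaled_oracle[OF \<gamma>]] by blast
    have "r = R \<gamma> k"
      using otm_outputs_unique[OF r(1) R] \<gamma> by (auto simp: A_def)
    with r show "decseq (\<lambda>n. nat_to_rat_surj (R \<gamma> k n))"
      "(\<lambda>n. of_rat (nat_to_rat_surj (R \<gamma> k n))) \<longlonglongrightarrow> P (real (Suc k) *\<^sub>R \<phi>)" by auto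
  qed
  \<comment> \<open>a code of the \<open>j\<close>-th approximation for the factor \<open>k + 1\<close>, divided by the factor, where \<open>n\<close> codes \<open>(k, j)\<close>\<close>
  define v where "v \<gamma> n = (LEAST m. of_nat (Suc (pfst n)) * nat_to_rat_surj m = nat_to_rat_surj (R \<gamma> (pfst n) (psnd n)))"
    for \<gamma> n
  have ex_v: "\<exists>m. of_nat (Suc k) * nat_to_rat_surj m = q" for k q
  proof -
    obtain m where "nat_to_rat_surj m = q / of_nat (Suc k)" using surj_nat_to_rat_surj by (metis surjD)
    then show ?thesis by (intro exI[of _ m]) (simp del: of_nat_Suc)
  qed
  have v: "nat_to_rat_surj (v \<gamma> n) = nat_to_rat_surj (R \<gamma> (pfst n) (psnd n)) / of_nat (Suc (pfst n))" for \<gamma> n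
    using LeastI_ex[OF ex_v[of "pfst n" "nat_to_rat_surj (R \<gamma> (pfst n) (psnd n))"]]
    unfolding v_def[symmetric] by (simp add: field_simps del: of_nat_Suc)
  have oc_v: "oracle_computable A (\<lambda>\<gamma> n. v \<gamma> n)"
  proof -
    have 1: "oracle_computable A (\<lambda>\<gamma> x. R \<gamma> (pfst (pfst x)) (psnd (pfst x)))"
      by (rule oc_comp[OF oc_R]) (intro comp_intros)
    show ?thesis unfolding v_def by (intro comp_intros 1 ex_v)
  qed
  \<comment> \<open>running minimum\<close>
  define out where "out \<gamma> = rec_nat (v \<gamma> 0)
      (\<lambda>i r. if nat_to_rat_surj r \<le> nat_to_rat_surj (v \<gamma> (Suc i)) then r else v \<gamma> (Suc i))" for \<gamma>
  have oc_out: "oracle_computable A out"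
  proof -
    have 1: "oracle_computable A (\<lambda>\<gamma> x. v \<gamma> (Suc (pfst (psnd x))))" and 2: "oracle_computable A (\<lambda>\<gamma> x. v \<gamma> 0)"
      by (rule oc_comp[OF oc_v], intro comp_intros)+
    have "oracle_computable A (\<lambda>\<gamma> n. out \<gamma> n)" unfolding out_def by (intro comp_intros 1 2)
    then show ?thesis by simp
  qed
  obtain M' where M': "wf_otm M'" "\<And>\<gamma> n. \<gamma> \<in> A \<Longrightarrow> otm_outputs M' \<gamma> n (out \<gamma> n)"
    using oracle_computable_otm[OF oc_out] by blast
  have main: "decseq (\<lambda>n. nat_to_rat_surj (out \<gamma> n))" "(\<lambda>n. of_rat (nat_to_rat_surj (out \<gamma> n))) \<longlonglongrightarrow> f \<phi>"
    if \<gamma>: "is_oracle e \<alpha> s \<phi> \<gamma>" for \<phi> \<gamma>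
  proof -
    let ?o = "\<lambda>n. real_of_rat (nat_to_rat_surj (out \<gamma> n))"
    show dec: "decseq (\<lambda>n. nat_to_rat_surj (out \<gamma> n))"
      by (rule decseq_SucI) (simp add: out_def)
    have out_v: "nat_to_rat_surj (out \<gamma> n) \<le> nat_to_rat_surj (v \<gamma> n)" for n
      by (cases n) (auto simp: out_def)
    have v_real: "real_of_rat (nat_to_rat_surj (v \<gamma> n)) = real_of_rat (nat_to_rat_surj (R \<gamma> (pfst n) (psnd n))) / real (Suc (pfst n))" for n
      unfolding v of_rat_divide by (simp only: of_rat_of_nat_eq)
    have R_ge: "P (real (Suc k) *\<^sub>R \<phi>) \<le> real_of_rat (nat_to_rat_surj (R \<gamma> k n))" for k n
    proof (rule decseq_ge[OF _ R_lim(2)[OF \<gamma>]])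
      show "decseq (\<lambda>n. real_of_rat (nat_to_rat_surj (R \<gamma> k n)))"
        using R_lim(1)[OF \<gamma>, of k] by (simp add: decseq_def of_rat_less_eq)
    qed
    have v_ge: "f \<phi> \<le> real_of_rat (nat_to_rat_surj (v \<gamma> n))" for n
      unfolding v_real using ge[of \<phi> "pfst n"] divide_right_mono[OF R_ge[of "pfst n" "psnd n"], of "real (Suc (pfst n))"]
      by simp
    have out_ge: "f \<phi> \<le> ?o n" for n
      by (induction n) (auto simp: out_def v_ge)
    show "?o \<longlonglongrightarrow> f \<phi>"
    proof (rule order_tendstoI)
      fix a assume "a < f \<phi>"
      then show "eventually (\<lambda>n. a < ?o n) sequentially"
        using out_ge less_le_trans by (intro always_eventually) blast
    next
      fix a assume a: "f \<phi> < a"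
      obtain k where k: "P (real (Suc k) *\<^sub>R \<phi>) / real (Suc k) < a"
        using order_tendstoD(2)[OF lim a] by (auto simp: eventually_sequentially)
      then have "P (real (Suc k) *\<^sub>R \<phi>) < a * real (Suc k)" by (simp add: divide_less_eq del: of_nat_Suc)
      from order_tendstoD(2)[OF R_lim(2)[OF \<gamma>, of k] this]
      obtain n where n: "real_of_rat (nat_to_rat_surj (R \<gamma> k n)) < a * real (Suc k)"
        by (auto simp: eventually_sequentially)
      let ?m = "prod_encode (k, n)"
      have "real_of_rat (nat_to_rat_surj (v \<gamma> ?m)) < a"
        unfolding v_real using n by (simp add: divide_less_eq del: of_nat_Suc)
      then have "?o ?m < a" using out_v[of ?m] of_rat_less_eq[where 'a = real] le_less_trans by blast
      moreover have "?o i \<le> ?o ?m" if "?m \<le> i" for i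
        using decseqD[OF dec that] by (simp add: of_rat_less_eq)
      ultimately show "eventually (\<lambda>n. ?o n < a) sequentially"
        unfolding eventually_sequentially using le_less_trans by blast
    qed
  qed
  show ?thesis
    unfolding computable_from_above_def
  proof (intro exI conjI allI impI)
    fix \<phi> \<gamma> n assume "is_oracle e \<alpha> s \<phi> \<gamma>"
    then show "otm_outputs M' \<gamma> n (out \<gamma> n)" "decseq (\<lambda>n. nat_to_rat_surj (out \<gamma> n))"
      "(\<lambda>n. of_rat (nat_to_rat_surj (out \<gamma> n))) \<longlonglongrightarrow> f \<phi>"
      using M'(2) main by (auto simp: A_def)
  qed (rule M'(1))
qed

section \<open>The ground state energy is computable from above\<close>

theorem corollary5p4:
  fixes X :: "('g::{group_add,countable} \<Rightarrow> 'a::{finite,discrete_topology}) set"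
    and e :: "nat \<Rightarrow> 'g" and \<alpha> :: "'a \<Rightarrow> nat" and s :: "nat \<Rightarrow> lc_table"
  assumes "\<exists>F :: nat \<Rightarrow> 'g set. folner_sequence F"
    and "bij e" and "bij_betw \<alpha> UNIV {..<CARD('a)}"
    and "computable_lc_enumeration e \<alpha> s"
    and "subshift X"
    and "computable_from_above e \<alpha> s (pressure X)"
  shows "computable_from_above e \<alpha> s (ground_state_energy X)"
proof (rule computable_from_above_rescaled_limit[OF assms(2,3,4,6)])
  fix \<phi> :: "('g \<Rightarrow> 'a) \<Rightarrow>\<^sub>C real" and k
  show "ground_state_energy X \<phi> \<le> pressure X (real (Suc k) *\<^sub>R \<phi>) / real (Suc k)"
    by (rule ground_state_energy_le_pressure[OF assms(1,5)]) simp
  show "(\<lambda>k. pressure X (real (Suc k) *\<^sub>R \<phi>) / real (Suc k)) \<longlonglongrightarrow> ground_state_energy X \<phi>"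
    by (rule pressure_rescaled_limit[OF assms(1,5)])
qed

end
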